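(* Consider the bit-commitment based coin-flipping protocol parameterized by $\alpha_0,\alpha_1\in\mathrm{Prob}^A$ and $\beta_0,\beta_1\in\mathrm{Prob}^B$, where $A=A_1\times\cdots\times A_n$, $B=B_1\times\cdots\times B_n$, $n\ge1$. Then $$P_{\mathrm B,0}^*\ge\frac12+\frac12\sqrt{\mathrm F(\beta_0,\beta_1)}\qquad\text{and}\qquad P_{\mathrm B,0}^*\ge\frac12+\frac12\Delta\left(\mathrm{Tr}_{A_2\times\cdots\times A_n}(\alpha_0),\mathrm{Tr}_{A_2\times\cdots\times A_n}(\alpha_1)\right).$$ In a four-round protocol (i.e. $n=1$), \begin{align*} P_{\mathrm B,0}^* &\ \ge\ \frac12\sum_{a\in\{0,1\}}\mathrm F\left(\sum_{x\in A}\alpha_{a,x}v_x,\ \beta_a\right)\\ &\ \ge\ \frac12\sum_{x\in A}\lambda_{\max}\left(\sum_{a\in\{0,1\}}\alpha_{a,x}\sqrt{\beta_a}\sqrt{\beta_a}^{\mathrm T}\right)\\ &\ \ge\ \max\left\{\frac12+\frac12\Delta(\alpha_0,\alpha_1),\ \frac12+\frac12\sqrt{\mathrm F(\beta_0,\beta_1)}\right\}, \end{align*} where $\sqrt{v_x}$ is the normalized principal eigenvector of $\sum_{a\in\{0,1\}}\alpha_{a,x}\sqrt{\beta_a}\sqrt{\beta_a}^{\mathrm T}$. In a six-round protocol (i.e. $n=2$), \begin{align*} P_{\mathrm B,0}^* &\ \ge\ \frac12\sum_{a\in\{0,1\}}\mathrm F\left(\sum_{x\in A}\alpha_{a,x}\,\tilde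 p_2^{(x)},\ \beta_a\right)\\ &\ \ge\ \frac12\,\lambda_{\max}\left(\kappa\sqrt{\mathrm{Tr}_{B_2}(\beta_0)}\sqrt{\mathrm{Tr}_{B_2}(\beta_0)}^{\mathrm T}+\zeta\sqrt{\mathrm{Tr}_{B_2}(\beta_1)}\sqrt{\mathrm{Tr}_{B_2}(\beta_1)}^{\mathrm T}\right)\\ &\ \ge\ \left(\frac12+\frac12\sqrt{\mathrm F(\mathrm{Tr}_{B_2}(\beta_0),\mathrm{Tr}_{B_2}(\beta_1))}\right)\left(\frac12+\frac12\Delta(\alpha_0,\alpha_1)\right), \end{align*} where $$[\tilde p_2^{(x)}]_{y_1,y_2}=\begin{cases} c_{y_1}\dfrac{\beta_{g(x),y_1,y_2}}{[\mathrm{Tr}_{B_2}(\beta_{g(x)})]_{y_1}} & \text{if } [\mathrm{Tr}_{B_2}(\beta_{g(x)})]_{y_1}>0,\\[2ex] c_{y_1}\dfrac{1}{|B_2|} & \text{if } [\mathrm{Tr}_{B_2}(\beta_{g(x)})]_{y_1}=0,\end{cases}$$ $$\kappa=\sum_{x\in A:\ \alpha_{0,x}\ge\alpha_{1,x}}\alpha_{0,x},\qquad \zeta=\sum_{x\in A:\ \alpha_{0,x}<\alpha_{1,x}}\alpha_{1,x},\qquad g(x)=\arg\max_a\{\alpha_{a,x}\}$$ (with $g(x)=0$ in case of a tie), and $\sqrt c$ is the normalized principal eigenvector of $\kappa\sqrt{\mathrm{Tr}_{B_2}(\beta_0)}\sqrt{\mathrm{Tr}_{B_2}(\beta_0)}^{\mathrm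 T}+\zeta\sqrt{\mathrm{Tr}_{B_2}(\beta_1)}\sqrt{\mathrm{Tr}_{B_2}(\beta_1)}^{\mathrm T}$. Furthermore, if $|A_i|=|B_i|$ for all $i\in\{1,\ldots,n\}$ (with $A_i$ and $B_i$ identified), then $$P_{\mathrm B,0}^*\ge\frac12\sum_{a\in\{0,1\}}\mathrm F(\alpha_a,\beta_a).$$ Analogous lower bounds hold for $P_{\mathrm B,1}^*$, with the roles of $\beta_0$ and $\beta_1$ switched. Namely, for every $n\ge1$, $$P_{\mathrm B,1}^*\ge\frac12+\frac12\sqrt{\mathrm F(\beta_0,\beta_1)}\qquad\text{and}\qquad P_{\mathrm B,1}^*\ge\frac12+\frac12\Delta\left(\mathrm{Tr}_{A_2\times\cdots\times A_n}(\alpha_0),\mathrm{Tr}_{A_2\times\cdots\times A_n}(\alpha_1)\right).$$ In a four-round protocol (i.e. $n=1$), \begin{align*} P_{\mathrm B,1}^* &\ \ge\ \frac12\sum_{a\in\{0,1\}}\mathrm F\left(\sum_{x\in A}\alpha_{a,x}\hat v_x,\ \beta_{a\oplus1}\right)\\ &\ \ge\ \frac12\sum_{x\in A}\lambda_{\max}\left(\sum_{a\in\{0,1\}}\alpha_{a,x}\sqrt{\beta_{a\oplus1}}\sqrt{\beta_{a\oplus1}}^{\mathrm T}\right)\\ &\ \ge\ \max\left\{\frac12+\frac12\Delta(\alpha_0,\alpha_1),\ \frac12+\frac12\sqrt{\mathrm F(\beta_0,\beta_1)}\right\}, \end{align*} where $\sqrt{\hat v_x}$ is the normalized principal eigenvector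 of $\sum_{a\in\{0,1\}}\alpha_{a,x}\sqrt{\beta_{a\oplus1}}\sqrt{\beta_{a\oplus1}}^{\mathrm T}$. In a six-round protocol (i.e. $n=2$), with $\kappa$, $\zeta$ and $g$ given by the same formulas as for $P_{\mathrm B,0}^*$, \begin{align*} P_{\mathrm B,1}^* &\ \ge\ \frac12\sum_{a\in\{0,1\}}\mathrm F\left(\sum_{x\in A}\alpha_{a,x}\,\hat p_2^{(x)},\ \beta_{a\oplus1}\right)\\ &\ \ge\ \frac12\,\lambda_{\max}\left(\kappa\sqrt{\mathrm{Tr}_{B_2}(\beta_1)}\sqrt{\mathrm{Tr}_{B_2}(\beta_1)}^{\mathrm T}+\zeta\sqrt{\mathrm{Tr}_{B_2}(\beta_0)}\sqrt{\mathrm{Tr}_{B_2}(\beta_0)}^{\mathrm T}\right)\\ &\ \ge\ \left(\frac12+\frac12\sqrt{\mathrm F(\mathrm{Tr}_{B_2}(\beta_0),\mathrm{Tr}_{B_2}(\beta_1))}\right)\left(\frac12+\frac12\Delta(\alpha_0,\alpha_1)\right), \end{align*} where $$[\hat p_2^{(x)}]_{y_1,y_2}=\begin{cases} \hat c_{y_1}\dfrac{\beta_{g(x)\oplus1,y_1,y_2}}{[\mathrm{Tr}_{B_2}(\beta_{g(x)\oplus1})]_{y_1}} & \text{if } [\mathrm{Tr}_{B_2}(\beta_{g(x)\oplus1})]_{y_1}>0,\\[2ex] \hat c_{y_1}\dfrac{1}{|B_2|} & \text{if } [\mathrm{Tr}_{B_2}(\beta_{g(x)\oplus1})]_{y_1}=0,\end{cases}$$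 and $\sqrt{\hat c}$ is the normalized principal eigenvector of $\kappa\sqrt{\mathrm{Tr}_{B_2}(\beta_1)}\sqrt{\mathrm{Tr}_{B_2}(\beta_1)}^{\mathrm T}+\zeta\sqrt{\mathrm{Tr}_{B_2}(\beta_0)}\sqrt{\mathrm{Tr}_{B_2}(\beta_0)}^{\mathrm T}$. Finally, if $|A_i|=|B_i|$ for all $i\in\{1,\ldots,n\}$ (with $A_i$ and $B_i$ identified), then $$P_{\mathrm B,1}^*\ge\frac12\sum_{a\in\{0,1\}}\mathrm F(\alpha_a,\beta_{a\oplus1}).$$
   Context: Notation. For a finite set $S$: $\mathbb{R}_+^S$ is the set of nonnegative real vectors indexed by $S$; $\mathrm{Prob}^S$ is the set of probability vectors indexed by $S$; $e_x$ ($x\in S$) are the standard basis vectors. $\oplus$ is XOR of bits. For a nonnegative vector $x$, $\sqrt x$ is the entrywise square root; a principal eigenvector is an eigenvector for the largest eigenvalue $\lambda_{\max}$, normalized in Euclidean norm and here taken entrywise nonnegative, so $v_x$ and $c$ (and likewise $\hat v_x$ and $\hat c$) are the entrywise squares of such eigenvectors. For $p,q\in\mathbb{R}_+^S$, $\mathrm{F}(p,q)=\left(\sum_{x\in S}\sqrt{p_x}\sqrt{q_x}\right)^2$. $\Delta(p,q)=\frac12\|p-q\|_1$. For $v\in\mathbb{R}^{S\times T}$, $\mathrm{Tr}_S(v)\in\mathbb{R}^T$ is given by $[\mathrm{Tr}_S(v)]_t=\sum_{s\in S}v_{s,t}$; for $n=1$, $\mathrm{Tr}_{A_2\times\cdots\times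 A_n}$ is the identity. Protocol. Let $A_i,B_i$ be finite sets, let $A'=A$ and $B'=B$ be copies, and $A_0=A_0'=B_0=B_0'=\{0,1\}$; a set is used as a label for the quantum register with state space $\mathbb{C}^{\text{set}}$. Put $\psi_a=\sum_{x\in A}\sqrt{\alpha_{a,x}}\,e_x\otimes e_x\in\mathbb{C}^A\otimes\mathbb{C}^{A'}$, $\psi=\sum_{a\in\{0,1\}}\frac{1}{\sqrt2}e_a\otimes e_a\otimes\psi_a\in\mathbb{C}^{A_0}\otimes\mathbb{C}^{A_0'}\otimes\mathbb{C}^A\otimes\mathbb{C}^{A'}$, $\phi_b=\sum_{y\in B}\sqrt{\beta_{b,y}}\,e_y\otimes e_y\in\mathbb{C}^B\otimes\mathbb{C}^{B'}$, $\phi=\sum_{b\in\{0,1\}}\frac{1}{\sqrt2}e_b\otimes e_b\otimes\phi_b\in\mathbb{C}^{B_0}\otimes\mathbb{C}^{B_0'}\otimes\mathbb{C}^B\otimes\mathbb{C}^{B'}$. Alice prepares $\psi$ and Bob prepares $\phi$. For $i=1,\ldots,n$: Alice sends $\mathbb{C}^{A_i}$ to Bob, who replies with $\mathbb{C}^{B_i}$. Then Alice sends $\mathbb{C}^{A_0'}$ and $\mathbb{C}^{A'}$ to Bob, and then Bob sends $\mathbb{C}^{B_0'}$ and $\mathbb{C}^{B'}$ to Alice (so there are $2n+2$ rounds). Finally Alice measures registers $A_0,B_0',B,B'$ with the POVM $(\Pi_{\mathrm A,0},\Pi_{\mathrm A,1},\Pi_{\mathrm A,\mathrm{abort}})$,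 where $\Pi_{\mathrm A,c}=\sum_{b\in\{0,1\}}e_{b\oplus c}e_{b\oplus c}^*\otimes e_be_b^*\otimes\phi_b\phi_b^*$ and $\Pi_{\mathrm A,\mathrm{abort}}=\mathrm I-\Pi_{\mathrm A,0}-\Pi_{\mathrm A,1}$; Bob measures registers $B_0,A_0',A,A'$ with $(\Pi_{\mathrm B,0},\Pi_{\mathrm B,1},\Pi_{\mathrm B,\mathrm{abort}})$, where $\Pi_{\mathrm B,c}=\sum_{a\in\{0,1\}}e_{a\oplus c}e_{a\oplus c}^*\otimes e_ae_a^*\otimes\psi_a\psi_a^*$ and $\Pi_{\mathrm B,\mathrm{abort}}=\mathrm I-\Pi_{\mathrm B,0}-\Pi_{\mathrm B,1}$. The measurement outcome is the party's output. Cheating. A cheating party may use a private workspace of arbitrary finite dimension, an arbitrary initial state (unentangled with the honest party), arbitrary quantum operations on the qubits in its possession between messages, and an arbitrary final measurement; the only restriction is that its messages have the dimensions prescribed by the protocol. The other party follows the protocol. $P_{\mathrm B,c}^*$ is the supremum, over all cheating strategies of Bob, of the probability that honest Alice outputs $c$. *)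

theory Defs
  imports "HOL-Analysis.Analysis" "HOL-Library.Z2"
begin

text \<open>
  Vectors and matrices indexed by a finite set are functions on the ambient type of the indices;
  every notion takes the index set as an argument and only looks at values on that set.  This
  allows the registers \<open>A\<^sub>1, \<dots>, A\<^sub>n\<close> to form a family of sets with \<open>n\<close> arbitrary.  Bits are
  elements of \<^typ>\<open>bit\<close>, whose addition is XOR.
\<close>


section \<open>Vectors, fidelity, eigenvalues\<close>

text \<open>
  \<open>A\<^sub>1 \<times> \<dots> \<times> A\<^sub>n\<close> is the set of (extensional) functions on \<open>{1..n}\<close>.  For \<open>n = 0\<close> it is the
  singleton of the everywhere undefined function.
\<close>

abbreviation tuples :: "nat \<Rightarrow> (nat \<Rightarrow> 'a set) \<Rightarrow> (nat \<Rightarrow> 'a) set" where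
  "tuples n A \<equiv> PiE {1..n} A"

definition prob_vec :: "'i set \<Rightarrow> ('i \<Rightarrow> real) \<Rightarrow> bool" where
  "prob_vec S p \<longleftrightarrow> (\<forall>x\<in>S. 0 \<le> p x) \<and> (\<Sum>x\<in>S. p x) = 1"

definition fidelity :: "'i set \<Rightarrow> ('i \<Rightarrow> real) \<Rightarrow> ('i \<Rightarrow> real) \<Rightarrow> real" where
  "fidelity S p q = (\<Sum>x\<in>S. sqrt (p x) * sqrt (q x))\<^sup>2"

definition trace_dist :: "'i set \<Rightarrow> ('i \<Rightarrow> real) \<Rightarrow> ('i \<Rightarrow> real) \<Rightarrow> real" where
  "trace_dist S p q = 1/2 * (\<Sum>x\<in>S. \<bar>p x - q x\<bar>)"

text \<open>
  \<open>partial_trace A T K v\<close> traces out the coordinates \<open>T\<close> of a vector indexed by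
  \<open>PiE (T \<union> K) A\<close> (\<open>T\<close> and \<open>K\<close> disjoint); the result is indexed by \<open>PiE K A\<close>.
\<close>

definition partial_trace ::
  "(nat \<Rightarrow> 'a set) \<Rightarrow> nat set \<Rightarrow> nat set \<Rightarrow> ((nat \<Rightarrow> 'a) \<Rightarrow> real) \<Rightarrow> (nat \<Rightarrow> 'a) \<Rightarrow> real" where
  "partial_trace A T K v = (\<lambda>t. \<Sum>s\<in>PiE T A. v (merge T K (s, t)))"

definition vsqrt :: "('i \<Rightarrow> real) \<Rightarrow> 'i \<Rightarrow> real" where
  "vsqrt p = (\<lambda>x. sqrt (p x))"

definition outer :: "('i \<Rightarrow> real) \<Rightarrow> 'i \<Rightarrow> 'i \<Rightarrow> real" where
  "outer v = (\<lambda>x y. v x * v y)"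

definition eigenvector_on :: "'i set \<Rightarrow> ('i \<Rightarrow> 'i \<Rightarrow> real) \<Rightarrow> ('i \<Rightarrow> real) \<Rightarrow> real \<Rightarrow> bool" where
  "eigenvector_on S M v l \<longleftrightarrow>
     (\<exists>x\<in>S. v x \<noteq> 0) \<and> (\<forall>x\<in>S. (\<Sum>y\<in>S. M x y * v y) = l * v x)"

text \<open>Only used for real symmetric matrices, which have no other than real eigenvalues.\<close>

definition lambda_max :: "'i set \<Rightarrow> ('i \<Rightarrow> 'i \<Rightarrow> real) \<Rightarrow> real" where
  "lambda_max S M = Max {l. \<exists>v. eigenvector_on S M v l}"

text \<open>
  In applications \<open>v\<close> is \<open>vsqrt w\<close>; as \<^const>\<open>sqrt\<close> preserves signs in HOL, the condition
  \<open>v \<ge> 0\<close> then says \<open>w \<ge> 0\<close>.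
\<close>

definition principal_eigenvector :: "'i set \<Rightarrow> ('i \<Rightarrow> 'i \<Rightarrow> real) \<Rightarrow> ('i \<Rightarrow> real) \<Rightarrow> bool" where
  "principal_eigenvector S M v \<longleftrightarrow>
     eigenvector_on S M v (lambda_max S M) \<and> L2_set v S = 1 \<and> (\<forall>x\<in>S. 0 \<le> v x)"


section \<open>States and quantum operations\<close>

definition basis_vec :: "'i \<Rightarrow> 'i \<Rightarrow> complex" where
  "basis_vec z = (\<lambda>x. if x = z then 1 else 0)"

definition density_operator :: "'i set \<Rightarrow> ('i \<Rightarrow> 'i \<Rightarrow> complex) \<Rightarrow> bool" where
  "density_operator S \<rho> \<longleftrightarrow>
     (\<forall>v. let q = (\<Sum>i\<in>S. \<Sum>j\<in>S. cnj (v i) * \<rho> i j * v j) in Im q = 0 \<and> 0 \<le> Re q) \<and>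
     (\<Sum>i\<in>S. \<rho> i i) = 1"

text \<open>
  A quantum operation (completely positive trace preserving map) from register \<open>I\<close> to register
  \<open>J\<close>, given by finitely many Kraus matrices \<open>E\<close> with \<open>\<Sum>\<^sub>E E\<^sup>* E = 1\<close>.
\<close>

definition quantum_operation :: "'i set \<Rightarrow> 'j set \<Rightarrow> ('j \<Rightarrow> 'i \<Rightarrow> complex) list \<Rightarrow> bool" where
  "quantum_operation I J Es \<longleftrightarrow>
     (\<forall>i\<in>I. \<forall>i'\<in>I. (\<Sum>E\<leftarrow>Es. \<Sum>j\<in>J. cnj (E j i) * E j i') = (if i = i' then 1 else 0))"

text \<open>The operation is applied to the second tensor factor of \<open>\<rho>\<close>, and the identity to the first.\<close>

definition apply_second ::
  "'i set \<Rightarrow> ('j \<Rightarrow> 'i \<Rightarrow> complex) list \<Rightarrow> ('r \<times> 'i \<Rightarrow> 'r \<times> 'i \<Rightarrow> complex)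
     \<Rightarrow> 'r \<times> 'j \<Rightarrow> 'r \<times> 'j \<Rightarrow> complex" where
  "apply_second I Es \<rho> = (\<lambda>(r, j) (r', j').
     \<Sum>E\<leftarrow>Es. \<Sum>i\<in>I. \<Sum>i'\<in>I. E j i * \<rho> (r, i) (r', i') * cnj (E j' i'))"

text \<open>
  Passing a register from one party to the other regroups the tensor factors: \<open>f\<close> maps the new
  index of the joint state to the old one.
\<close>

definition reindex :: "('t \<Rightarrow> 's) \<Rightarrow> ('s \<Rightarrow> 's \<Rightarrow> complex) \<Rightarrow> 't \<Rightarrow> 't \<Rightarrow> complex" where
  "reindex f \<rho> = (\<lambda>s t. \<rho> (f s) (f t))"


section \<open>The protocol with honest Alice and cheating Bob\<close>

text \<open>
  \<open>commit_state S p\<close> is \<open>\<psi>\<^sub>a\<close> (for \<open>p = \<alpha>\<^sub>a\<close> and \<open>S = A\<close>) or \<open>\<phi>\<^sub>b\<close> (for \<open>p = \<beta>\<^sub>b\<close> and \<open>S = B\<close>).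
\<close>

definition commit_state :: "'i set \<Rightarrow> ('i \<Rightarrow> real) \<Rightarrow> 'i \<Rightarrow> 'i \<Rightarrow> complex" where
  "commit_state S p = (\<lambda>x x'.
     \<Sum>z\<in>S. complex_of_real (sqrt (p z)) * basis_vec z x * basis_vec z x')"

text \<open>\<open>\<psi>\<close>; the arguments are indices of the registers \<open>A\<^sub>0, A\<^sub>0', A, A'\<close>.\<close>

definition alice_state ::
  "'i set \<Rightarrow> (bit \<Rightarrow> 'i \<Rightarrow> real) \<Rightarrow> bit \<Rightarrow> bit \<Rightarrow> 'i \<Rightarrow> 'i \<Rightarrow> complex" where
  "alice_state S \<alpha> = (\<lambda>a a' x x'.
     \<Sum>b\<in>{0,1}. complex_of_real (1 / sqrt 2) * basis_vec b a * basis_vec b a'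
       * commit_state S (\<alpha> b) x x')"

text \<open>\<open>\<Pi>\<^sub>A\<^sub>,\<^sub>c\<close>, a matrix indexed by the registers \<open>A\<^sub>0, B\<^sub>0', B, B'\<close>.\<close>

definition alice_povm ::
  "'i set \<Rightarrow> (bit \<Rightarrow> 'i \<Rightarrow> real) \<Rightarrow> bit
     \<Rightarrow> bit \<times> bit \<times> 'i \<times> 'i \<Rightarrow> bit \<times> bit \<times> 'i \<times> 'i \<Rightarrow> complex" where
  "alice_povm S \<beta> c = (\<lambda>(s, t, y, y') (s2, t2, y2, y2').
     \<Sum>b\<in>{0,1}. (basis_vec (b + c) s * cnj (basis_vec (b + c) s2))
       * (basis_vec b t * cnj (basis_vec b t2))
       * (commit_state S (\<beta> b) y y' * cnj (commit_state S (\<beta> b) y2 y2')))"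

text \<open>
  Bob's workspace after his \<open>i\<close>-th reply has dimension \<open>wdim i\<close>; \<open>init\<close> is its initial state,
  \<open>reply i\<close> the operation producing the \<open>i\<close>-th reply, and \<open>reveal\<close> the operation that turns
  \<open>A\<^sub>0', A'\<close> and the workspace into \<open>B\<^sub>0', B'\<close> and a workspace of dimension \<open>wdim (n + 1)\<close>.
  Bob's measurement after his last message is left out: the outcomes of a POVM sum to the
  identity, so it does not change the probability of Alice's output.
\<close>

record ('a, 'b) bob_strategy =
  wdim :: "nat \<Rightarrow> nat"
  init :: "nat \<Rightarrow> nat \<Rightarrow> complex"
  reply :: "nat \<Rightarrow> ('b \<times> nat \<Rightarrow> 'a \<times> nat \<Rightarrow> complex) list"
  reveal :: "(bit \<times> (nat \<Rightarrow> 'b) \<times> nat \<Rightarrow> bit \<times> (nat \<Rightarrow> 'a) \<times> nat \<Rightarrow> complex) list"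

definition valid_strategy ::
  "nat \<Rightarrow> (nat \<Rightarrow> 'a set) \<Rightarrow> (nat \<Rightarrow> 'b set) \<Rightarrow> ('a, 'b) bob_strategy \<Rightarrow> bool" where
  "valid_strategy n A B S \<longleftrightarrow>
     density_operator {..<wdim S 0} (init S) \<and>
     (\<forall>i\<in>{1..n}. quantum_operation (A i \<times> {..<wdim S (i - 1)}) (B i \<times> {..<wdim S i}) (reply S i)) \<and>
     quantum_operation (UNIV \<times> tuples n A \<times> {..<wdim S n})
       (UNIV \<times> tuples n B \<times> {..<wdim S (n + 1)}) (reveal S)"

text \<open>
  \<open>joint_state n A \<alpha> S i\<close> is the joint state after \<open>i\<close> replies.  Its indices are
  \<open>((a, a', x, x', y), w)\<close>: Alice holds \<open>A\<^sub>0, A\<^sub>0'\<close>, the registers \<open>A\<^sub>j\<close> not yet sent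
  (\<open>x\<close> is extensional on \<open>{i+1..n}\<close>), \<open>A'\<close>, and \<open>B\<^sub>1, \<dots>, B\<^sub>i\<close> (\<open>y\<close> is extensional on
  \<open>{1..i}\<close>); Bob holds his workspace \<open>w\<close>.  \<open>send_index\<close> moves \<open>A\<^sub>i\<close> to Bob, \<open>reply_index\<close>
  moves \<open>B\<^sub>i\<close> to Alice, and \<open>reveal_index\<close> moves \<open>A\<^sub>0', A'\<close> to Bob (\<open>x\<close> is then the empty tuple).
\<close>

type_synonym ('a, 'b) alice_index = "bit \<times> bit \<times> (nat \<Rightarrow> 'a) \<times> (nat \<Rightarrow> 'a) \<times> (nat \<Rightarrow> 'b)"

definition send_index ::
  "nat \<Rightarrow> ('a, 'b) alice_index \<times> 'a \<times> nat \<Rightarrow> ('a, 'b) alice_index \<times> nat" where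
  "send_index i = (\<lambda>((a, a', x, x', y), (u, w)). ((a, a', x(i := u), x', y), w))"

definition reply_index ::
  "nat \<Rightarrow> ('a, 'b) alice_index \<times> nat \<Rightarrow> ('a, 'b) alice_index \<times> 'b \<times> nat" where
  "reply_index i = (\<lambda>((a, a', x, x', y), w). ((a, a', x, x', y(i := undefined)), (y i, w)))"

definition reveal_index ::
  "(bit \<times> (nat \<Rightarrow> 'b)) \<times> bit \<times> (nat \<Rightarrow> 'a) \<times> nat \<Rightarrow> ('a, 'b) alice_index \<times> nat" where
  "reveal_index = (\<lambda>((a, y), (a', x', w)). ((a, a', (\<lambda>_. undefined), x', y), w))"

primrec joint_state ::
  "nat \<Rightarrow> (nat \<Rightarrow> 'a set) \<Rightarrow> (bit \<Rightarrow> (nat \<Rightarrow> 'a) \<Rightarrow> real) \<Rightarrow> ('a, 'b) bob_strategy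
     \<Rightarrow> nat \<Rightarrow> ('a, 'b) alice_index \<times> nat \<Rightarrow> ('a, 'b) alice_index \<times> nat \<Rightarrow> complex" where
  "joint_state n A \<alpha> S 0 = (\<lambda>((a, a', x, x', y), w) ((a2, a2', x2, x2', y2), w2).
     alice_state (tuples n A) \<alpha> a a' x x' * cnj (alice_state (tuples n A) \<alpha> a2 a2' x2 x2')
       * init S w w2)"
| "joint_state n A \<alpha> S (Suc i) =
     reindex (reply_index (Suc i))
       (apply_second (A (Suc i) \<times> {..<wdim S i}) (reply S (Suc i))
         (reindex (send_index (Suc i)) (joint_state n A \<alpha> S i)))"

text \<open>
  Indices of the final state are \<open>((a, y), (b, y', w))\<close>, for \<open>A\<^sub>0, B\<close> and \<open>B\<^sub>0', B'\<close>, workspace.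
\<close>

definition final_state ::
  "nat \<Rightarrow> (nat \<Rightarrow> 'a set) \<Rightarrow> (bit \<Rightarrow> (nat \<Rightarrow> 'a) \<Rightarrow> real) \<Rightarrow> ('a, 'b) bob_strategy
     \<Rightarrow> (bit \<times> (nat \<Rightarrow> 'b)) \<times> bit \<times> (nat \<Rightarrow> 'b) \<times> nat
     \<Rightarrow> (bit \<times> (nat \<Rightarrow> 'b)) \<times> bit \<times> (nat \<Rightarrow> 'b) \<times> nat \<Rightarrow> complex" where
  "final_state n A \<alpha> S =
     apply_second (UNIV \<times> tuples n A \<times> {..<wdim S n}) (reveal S)
       (reindex reveal_index (joint_state n A \<alpha> S n))"

text \<open>The trace of \<open>(\<Pi>\<^sub>A\<^sub>,\<^sub>c \<otimes> I) \<rho>\<close> for the final state \<open>\<rho>\<close>.\<close>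

definition alice_outputs_prob ::
  "nat \<Rightarrow> (nat \<Rightarrow> 'a set) \<Rightarrow> (nat \<Rightarrow> 'b set) \<Rightarrow> (bit \<Rightarrow> (nat \<Rightarrow> 'a) \<Rightarrow> real)
     \<Rightarrow> (bit \<Rightarrow> (nat \<Rightarrow> 'b) \<Rightarrow> real) \<Rightarrow> bit \<Rightarrow> ('a, 'b) bob_strategy \<Rightarrow> real" where
  "alice_outputs_prob n A B \<alpha> \<beta> c S =
     (let R = UNIV \<times> UNIV \<times> tuples n B \<times> tuples n B in
      Re (\<Sum>(a, b, y, y')\<in>R. \<Sum>(a2, b2, y2, y2')\<in>R. \<Sum>w<wdim S (n + 1).
        alice_povm (tuples n B) \<beta> c (a, b, y, y') (a2, b2, y2, y2')
          * final_state n A \<alpha> S ((a2, y2), (b2, y2', w)) ((a, y), (b, y', w))))"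

definition P_Bob ::
  "nat \<Rightarrow> (nat \<Rightarrow> 'a set) \<Rightarrow> (nat \<Rightarrow> 'b set) \<Rightarrow> (bit \<Rightarrow> (nat \<Rightarrow> 'a) \<Rightarrow> real)
     \<Rightarrow> (bit \<Rightarrow> (nat \<Rightarrow> 'b) \<Rightarrow> real) \<Rightarrow> bit \<Rightarrow> real" where
  "P_Bob n A B \<alpha> \<beta> c =
     (SUP S\<in>{S. valid_strategy n A B S}. alice_outputs_prob n A B \<alpha> \<beta> c S)"


section \<open>Quantities in the lower bounds\<close>

text \<open>
  The family \<open>\<gamma>\<close> below is \<open>\<beta>\<close> for Alice's output 0, and \<open>\<beta>\<close> with \<open>\<beta>\<^sub>0\<close> and \<open>\<beta>\<^sub>1\<close> switched
  for her output 1.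
\<close>

definition four_round_matrix ::
  "(bit \<Rightarrow> 'i \<Rightarrow> real) \<Rightarrow> (bit \<Rightarrow> 'j \<Rightarrow> real) \<Rightarrow> 'i \<Rightarrow> 'j \<Rightarrow> 'j \<Rightarrow> real" where
  "four_round_matrix \<alpha> \<gamma> x = (\<lambda>y y'. \<Sum>a\<in>{0,1}. \<alpha> a x * outer (vsqrt (\<gamma> a)) y y')"

definition kappa :: "'i set \<Rightarrow> (bit \<Rightarrow> 'i \<Rightarrow> real) \<Rightarrow> real" where
  "kappa S \<alpha> = (\<Sum>x | x \<in> S \<and> \<alpha> 0 x \<ge> \<alpha> 1 x. \<alpha> 0 x)"

definition zeta :: "'i set \<Rightarrow> (bit \<Rightarrow> 'i \<Rightarrow> real) \<Rightarrow> real" where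
  "zeta S \<alpha> = (\<Sum>x | x \<in> S \<and> \<alpha> 0 x < \<alpha> 1 x. \<alpha> 1 x)"

definition guess :: "(bit \<Rightarrow> 'i \<Rightarrow> real) \<Rightarrow> 'i \<Rightarrow> bit" where
  "guess \<alpha> x = (if \<alpha> 0 x \<ge> \<alpha> 1 x then 0 else 1)"

definition six_round_matrix ::
  "'i set \<Rightarrow> (bit \<Rightarrow> 'i \<Rightarrow> real) \<Rightarrow> (nat \<Rightarrow> 'b set) \<Rightarrow> (bit \<Rightarrow> (nat \<Rightarrow> 'b) \<Rightarrow> real)
     \<Rightarrow> (nat \<Rightarrow> 'b) \<Rightarrow> (nat \<Rightarrow> 'b) \<Rightarrow> real" where
  "six_round_matrix S \<alpha> B \<gamma> = (\<lambda>y y'.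
     kappa S \<alpha> * outer (vsqrt (partial_trace B {2} {1} (\<gamma> 0))) y y' +
     zeta S \<alpha> * outer (vsqrt (partial_trace B {2} {1} (\<gamma> 1))) y y')"

definition six_round_p2 ::
  "(bit \<Rightarrow> 'i \<Rightarrow> real) \<Rightarrow> (nat \<Rightarrow> 'b set) \<Rightarrow> (bit \<Rightarrow> (nat \<Rightarrow> 'b) \<Rightarrow> real)
     \<Rightarrow> ((nat \<Rightarrow> 'b) \<Rightarrow> real) \<Rightarrow> 'i \<Rightarrow> (nat \<Rightarrow> 'b) \<Rightarrow> real" where
  "six_round_p2 \<alpha> B \<gamma> u x = (\<lambda>y.
     let y1 = restrict y {1};
         q = partial_trace B {2} {1} (\<gamma> (guess \<alpha> x)) y1
     in if q > 0 then u y1 * (\<gamma> (guess \<alpha> x) y / q) else u y1 * (1 / real (card (B 2))))"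

end

theory Submission
  imports Defs
begin

text \<open>
  All the lower bounds are success probabilities of explicit strategies, and all these strategies
  belong to one family.  Bob fixes conditional distributions
  \<open>q\<^sub>i(y\<^sub>i | x\<^sub>1, \<dots>, x\<^sub>i, y\<^sub>1, \<dots>, y\<^sub>i\<^sub>-\<^sub>1)\<close>.  When the basis state \<open>x\<^sub>i\<close> arrives he creates the
  superposition of the states \<open>y\<^sub>i, y\<^sub>i\<close> with amplitudes \<open>\<surd>q\<^sub>i\<close>, sends one copy of \<open>y\<^sub>i\<close> and
  keeps the other one together with \<open>x\<^sub>i\<close>.  Write \<open>p(y | x)\<close> for the product of the \<open>q\<^sub>i\<close>.  Once
  Alice has handed over \<open>a\<close> and her second copy of \<open>x\<close>, the branch of \<open>a\<close> and \<open>y\<close> leaves Bob with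
  the vector with entries \<open>\<surd>(\<alpha>\<^bsub>a,x\<^esub> p(y | x))\<close>, whose squared norm is
  \<open>r\<^sub>a(y) = \<Sum>\<^sub>x \<alpha>\<^bsub>a,x\<^esub> p(y | x)\<close>.  As he knows \<open>a\<close> and \<open>y\<close>, he can rotate this vector to a fixed
  one, and what remains is the superposition of the states \<open>y, y\<close> with amplitudes \<open>\<surd>r\<^sub>a(y)\<close>.
  He claims \<open>b = a + c\<close>, and Alice's projection onto \<open>\<phi>\<^sub>b\<close> succeeds with probability
  \<open>F(r\<^sub>a, \<beta>\<^bsub>a+c\<^esub>)\<close>.  Hence \<open>P\<^sub>B\<^sub>,\<^sub>c \<ge> 1/2 \<Sum>\<^sub>a F(r\<^sub>a, \<beta>\<^bsub>a+c\<^esub>)\<close>, which is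
  \<open>controlled_replies.P_Bob_ge_controlled_replies\<close>.  A supremum of reals is at least each of its
  values only if they are bounded; that is \<open>alice_outputs_prob_le\<close>, which holds because all the
  states that occur are density operators.

  The bounds come from different choices of \<open>q\<close>, where \<open>\<gamma>\<^sub>a = \<beta>\<^bsub>a+c\<^esub>\<close>.
  Any family of distributions on \<open>B\<close> indexed by the first message is a product of such
  conditionals, by the chain rule (\<open>P_Bob_ge_first_message\<close>).  A distribution whose square root
  bisects the angle between \<open>\<surd>\<beta>\<^sub>0\<close> and \<open>\<surd>\<beta>\<^sub>1\<close> gives the bound by the fidelity; pretending to
  have committed honestly to the more likely value of \<open>a\<close>, given the first message, gives the
  bound by the trace distance.  In four rounds the squares of the principal eigenvectors are
  used.  In six rounds \<open>y\<^sub>1\<close> follows the square of the principal eigenvector, and \<open>y\<^sub>2\<close> the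
  conditional distribution of the guessed \<open>\<gamma>\<^sub>a\<close>.  If \<open>A\<close> and \<open>B\<close> are identified, Bob returns a
  copy of what he receives.

  The comparisons between the bounds use that \<open>F\<close> is concave and monotone in one argument, and
  that each matrix \<open>p u u\<^sup>T + q v v\<^sup>T\<close> with unit vectors \<open>u, v \<ge> 0\<close> has a nonnegative principal
  eigenvector and a largest eigenvalue that bounds its Rayleigh quotients.  Such a matrix acts on
  the span of \<open>u\<close> and \<open>v\<close>, so its nonzero eigenvalues satisfy the quadratic equation
  \<open>(l - p) (l - q) = p q \<langle>u, v\<rangle>\<^sup>2\<close>, and everything can be computed explicitly
  (\<open>two_rank_one_principal\<close>).
\<close>

section \<open>Fidelity\<close>

lemma fidelity_cong:
  "(\<And>x. x \<in> S \<Longrightarrow> p x = p' x) \<Longrightarrow> (\<And>x. x \<in> S \<Longrightarrow> q x = q' x) \<Longrightarrow> fidelity S p q = fidelity S p' q'"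
  unfolding fidelity_def by (intro arg_cong[of _ _ "\<lambda>x. x\<^sup>2"] sum.cong) auto

lemma fidelity_commute: "fidelity S p q = fidelity S q p"
  by (simp add: fidelity_def mult.commute)

lemma fidelity_shift: "fidelity S (\<beta> (0 + c)) (\<beta> (1 + c)) = fidelity S (\<beta> 0) (\<beta> (1 :: bit))"
  by (cases c) (simp_all add: fidelity_commute)

text \<open>
  Expand the square into a double sum over \<open>y, y'\<close>: each \<open>\<surd>(v y) \<surd>(v y')\<close> is a geometric mean,
  which is superadditive in \<open>v\<close> by the Cauchy-Schwarz inequality, and homogeneous.
\<close>

lemma fidelity_concave:
  assumes t: "\<And>x. x \<in> X \<Longrightarrow> 0 \<le> t x"
    and v: "\<And>x y. x \<in> X \<Longrightarrow> y \<in> S \<Longrightarrow> 0 \<le> v x y"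
    and g: "\<And>y. y \<in> S \<Longrightarrow> 0 \<le> \<gamma> y"
  shows "(\<Sum>x\<in>X. t x * fidelity S (v x) \<gamma>) \<le> fidelity S (\<lambda>y. \<Sum>x\<in>X. t x * v x y) \<gamma>"
proof -
  have "(\<Sum>x\<in>X. t x * fidelity S (v x) \<gamma>)
      = (\<Sum>x\<in>X. \<Sum>y\<in>S. \<Sum>y'\<in>S. t x * (sqrt (v x y) * sqrt (\<gamma> y) * (sqrt (v x y') * sqrt (\<gamma> y'))))"
    unfolding fidelity_def power2_eq_square sum_product unfolding sum_distrib_left ..
  also have "\<dots> = (\<Sum>y\<in>S. \<Sum>y'\<in>S. \<Sum>x\<in>X. t x * (sqrt (v x y) * sqrt (\<gamma> y) * (sqrt (v x y') * sqrt (\<gamma> y'))))"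
    by (subst sum.swap, rule sum.cong[OF refl], rule sum.swap)
  also have "\<dots> \<le> (\<Sum>y\<in>S. \<Sum>y'\<in>S. sqrt (\<Sum>x\<in>X. t x * v x y) * sqrt (\<gamma> y) * (sqrt (\<Sum>x\<in>X. t x * v x y') * sqrt (\<gamma> y')))"
  proof (intro sum_mono)
    fix y y' assume y: "y \<in> S" "y' \<in> S"
    have "(\<Sum>x\<in>X. sqrt (t x * v x y) * sqrt (t x * v x y'))
        \<le> sqrt (\<Sum>x\<in>X. t x * v x y) * sqrt (\<Sum>x\<in>X. t x * v x y')"
    proof -
      have "(\<Sum>x\<in>X. sqrt (t x * v x y) * sqrt (t x * v x y'))
         \<le> L2_set (\<lambda>x. sqrt (t x * v x y)) X * L2_set (\<lambda>x. sqrt (t x * v x y')) X"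
        by (rule order_trans[OF sum_mono L2_set_mult_ineq]) (metis abs_ge_self abs_mult)
      also have "L2_set (\<lambda>x. sqrt (t x * v x y)) X = sqrt (\<Sum>x\<in>X. t x * v x y)"
        unfolding L2_set_def by (intro arg_cong[of _ _ sqrt] sum.cong) (use y t v in auto)
      also have "L2_set (\<lambda>x. sqrt (t x * v x y')) X = sqrt (\<Sum>x\<in>X. t x * v x y')"
        unfolding L2_set_def by (intro arg_cong[of _ _ sqrt] sum.cong) (use y t v in auto)
      finally show ?thesis .
    qed
    moreover have "(\<Sum>x\<in>X. sqrt (t x * v x y) * sqrt (t x * v x y'))
        = (\<Sum>x\<in>X. t x * (sqrt (v x y) * sqrt (v x y')))"
      by (rule sum.cong) (use t in \<open>auto simp: real_sqrt_mult algebra_simps power2_eq_square\<close>)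
    ultimately have "(\<Sum>x\<in>X. t x * (sqrt (v x y) * sqrt (v x y'))) * (sqrt (\<gamma> y) * sqrt (\<gamma> y'))
        \<le> sqrt (\<Sum>x\<in>X. t x * v x y) * sqrt (\<Sum>x\<in>X. t x * v x y') * (sqrt (\<gamma> y) * sqrt (\<gamma> y'))"
      using g y by (intro mult_right_mono) auto
    thus "(\<Sum>x\<in>X. t x * (sqrt (v x y) * sqrt (\<gamma> y) * (sqrt (v x y') * sqrt (\<gamma> y'))))
       \<le> sqrt (\<Sum>x\<in>X. t x * v x y) * sqrt (\<gamma> y) * (sqrt (\<Sum>x\<in>X. t x * v x y') * sqrt (\<gamma> y'))"
      by (simp add: sum_distrib_left mult_ac)
  qed
  also have "\<dots> = fidelity S (\<lambda>y. \<Sum>x\<in>X. t x * v x y) \<gamma>"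
    by (simp add: fidelity_def power2_eq_square sum_product)
  finally show ?thesis .
qed

lemma fidelity_mono:
  assumes "\<And>y. y \<in> S \<Longrightarrow> 0 \<le> \<gamma> y" "\<And>y. y \<in> S \<Longrightarrow> 0 \<le> p y" "\<And>y. y \<in> S \<Longrightarrow> p y \<le> p' y"
  shows "fidelity S p \<gamma> \<le> fidelity S p' \<gamma>"
  unfolding fidelity_def using assms
  by (intro power_mono sum_mono mult_right_mono sum_nonneg mult_nonneg_nonneg) auto

lemma fidelity_scale: "0 \<le> t \<Longrightarrow> fidelity S (\<lambda>y. t * p y) \<gamma> = t * fidelity S p \<gamma>"
  by (simp add: fidelity_def real_sqrt_mult mult.assoc power_mult_distrib flip: sum_distrib_left)

lemma fidelity_self: "prob_vec S p \<Longrightarrow> fidelity S p p = 1"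
  by (simp add: fidelity_def prob_vec_def)

text \<open>
  The normalized sum of \<open>\<surd>p\<close> and \<open>\<surd>q\<close>.  It bisects the angle \<open>\<theta>\<close> between these unit vectors, so
  both squared overlaps are \<open>(1 + cos \<theta>) / 2\<close>, and \<open>cos \<theta>\<close> is the square root of the fidelity.
\<close>

lemma bisecting_vector:
  assumes p: "prob_vec S p" and q: "prob_vec S q"
  obtains z where "\<And>x. x \<in> S \<Longrightarrow> 0 \<le> z x" "(\<Sum>x\<in>S. (z x)\<^sup>2) = 1"
    "(\<Sum>x\<in>S. vsqrt p x * z x)\<^sup>2 = 1/2 + 1/2 * sqrt (fidelity S p q)"
    "(\<Sum>x\<in>S. vsqrt q x * z x)\<^sup>2 = 1/2 + 1/2 * sqrt (fidelity S p q)"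
proof -
  define s where "s = (\<Sum>x\<in>S. sqrt (p x) * sqrt (q x))"
  have s0: "0 \<le> s" unfolding s_def using p q by (intro sum_nonneg) (auto simp: prob_vec_def)
  have F: "sqrt (fidelity S p q) = s" using s0 by (simp add: fidelity_def s_def)
  have p1: "(\<Sum>x\<in>S. sqrt (p x) * sqrt (p x)) = 1" and q1: "(\<Sum>x\<in>S. sqrt (q x) * sqrt (q x)) = 1"
    using p q by (auto simp: prob_vec_def)
  \<comment> \<open>The squared norm of \<open>\<surd>p + \<surd>q\<close> is \<open>2 + 2 s\<close>.\<close>
  define z where "z x = (sqrt (p x) + sqrt (q x)) / sqrt (2 + 2 * s)" for x
  have "(\<Sum>x\<in>S. sqrt (p x) * z x) = (1 + s) / sqrt (2 + 2 * s)"
    using p1 by (simp add: z_def sum.distrib distrib_left s_def flip: sum_divide_distrib)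
  moreover have "(\<Sum>x\<in>S. sqrt (q x) * z x) = (1 + s) / sqrt (2 + 2 * s)"
    using q1 by (simp add: z_def sum.distrib distrib_left s_def mult.commute flip: sum_divide_distrib)
  moreover have "((1 + s) / sqrt (2 + 2 * s))\<^sup>2 = 1/2 + 1/2 * s"
    using s0 by (simp add: power_divide field_simps power2_eq_square)
  moreover have "(\<Sum>x\<in>S. (z x)\<^sup>2) = 1"
  proof -
    have "(\<Sum>x\<in>S. (z x)\<^sup>2) = (\<Sum>x\<in>S. sqrt (p x) * sqrt (p x) + sqrt (q x) * sqrt (q x)
        + 2 * (sqrt (p x) * sqrt (q x))) / (2 + 2 * s)"
      unfolding z_def sum_divide_distrib using s0
      by (intro sum.cong) (auto simp: power_divide power2_eq_square algebra_simps)
    also have "\<dots> = 1" unfolding sum.distrib p1 q1 using s0 by (simp add: s_def flip: sum_distrib_left)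
    finally show ?thesis .
  qed
  moreover have "0 \<le> z x" if "x \<in> S" for x
    using p q s0 that by (auto simp: z_def prob_vec_def)
  ultimately show thesis using that[of z] by (simp add: F vsqrt_def)
qed

section \<open>Sums of two rank-one matrices\<close>

text \<open>
  Multiply by \<open>P\<close> and complete the square.
\<close>

lemma psd_two_by_two:
  fixes P Q k a b :: real
  assumes "0 \<le> P" and "0 \<le> Q" and "P * Q = k\<^sup>2"
  shows "2 * k * a * b \<le> P * a\<^sup>2 + Q * b\<^sup>2"
proof (cases "P = 0")
  case True
  thus ?thesis using assms by auto
next
  case False
  have "P * (P * a\<^sup>2 + Q * b\<^sup>2 - 2 * k * a * b) = P\<^sup>2 * a\<^sup>2 + (P * Q) * b\<^sup>2 - 2 * (P * a) * (k * b)"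
    by (simp add: algebra_simps power2_eq_square)
  also have "\<dots> = (P * a - k * b)\<^sup>2"
    unfolding assms(3) by (simp add: algebra_simps power2_eq_square)
  finally have "0 \<le> P * (P * a\<^sup>2 + Q * b\<^sup>2 - 2 * k * a * b)" by simp
  thus ?thesis using False assms(1) by (simp add: zero_le_mult_iff)
qed

text \<open>
  With \<open>M = p u u\<^sup>T + q v v\<^sup>T\<close> and \<open>m = M z\<close>, the left-hand side is \<open>\<langle>m, z\<rangle>\<close>.  On the span of \<open>u\<close> and
  \<open>v\<close> the matrix is bounded by \<open>L\<close>, which gives \<open>\<langle>m, m\<rangle> \<le> L \<langle>m, z\<rangle>\<close>; the difference of the two sides
  is a quadratic form in \<open>\<langle>u, z\<rangle>\<close> and \<open>\<langle>v, z\<rangle>\<close> whose discriminant vanishes because of the equation for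
  \<open>L\<close>.  The Cauchy-Schwarz inequality \<open>\<langle>m, z\<rangle>\<^sup>2 \<le> \<langle>m, m\<rangle> \<langle>z, z\<rangle>\<close> then allows one factor \<open>\<langle>m, z\<rangle>\<close> to be
  cancelled.
\<close>

lemma two_rank_one_rayleigh:
  fixes u v z :: "'i \<Rightarrow> real"
  assumes u: "(\<Sum>x\<in>S. (u x)\<^sup>2) = 1" and v: "(\<Sum>x\<in>S. (v x)\<^sup>2) = 1"
    and p: "0 \<le> p" and q: "0 \<le> q" and pL: "p \<le> L" and qL: "q \<le> L"
    and L: "(L - p) * (L - q) = p * q * (\<Sum>x\<in>S. u x * v x)\<^sup>2"
  shows "p * (\<Sum>x\<in>S. u x * z x)\<^sup>2 + q * (\<Sum>x\<in>S. v x * z x)\<^sup>2 \<le> L * (\<Sum>x\<in>S. (z x)\<^sup>2)"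
proof -
  define a where "a = (\<Sum>x\<in>S. u x * z x)"
  define b where "b = (\<Sum>x\<in>S. v x * z x)"
  define s where "s = (\<Sum>x\<in>S. u x * v x)"
  define N where "N = (\<Sum>x\<in>S. (z x)\<^sup>2)"
  define m where "m = p * a\<^sup>2 + q * b\<^sup>2"
  have N0: "0 \<le> N" unfolding N_def by (rule sum_nonneg) simp
  have m0: "0 \<le> m" unfolding m_def using p q by simp
  have L0: "0 \<le> L" using p pL by simp
  have mz: "(\<Sum>x\<in>S. (p * a * u x + q * b * v x) * z x) = m"
  proof -
    have "(\<Sum>x\<in>S. (p * a * u x + q * b * v x) * z x)
        = (\<Sum>x\<in>S. p * a * (u x * z x) + q * b * (v x * z x))"
      by (rule sum.cong) (auto simp: algebra_simps)
    also have "\<dots> = p * a * a + q * b * b"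
      unfolding sum.distrib by (simp add: a_def b_def flip: sum_distrib_left)
    finally show ?thesis by (simp add: m_def power2_eq_square)
  qed
  have mm: "(\<Sum>x\<in>S. (p * a * u x + q * b * v x)\<^sup>2) = p\<^sup>2 * a\<^sup>2 + q\<^sup>2 * b\<^sup>2 + 2 * p * q * a * b * s"
  proof -
    have "(\<Sum>x\<in>S. (p * a * u x + q * b * v x)\<^sup>2)
      = (\<Sum>x\<in>S. (p * a)\<^sup>2 * (u x)\<^sup>2 + (q * b)\<^sup>2 * (v x)\<^sup>2 + 2 * (p * a * q * b) * (u x * v x))"
      by (rule sum.cong) (auto simp: power2_eq_square algebra_simps)
    also have "\<dots> = (p * a)\<^sup>2 * 1 + (q * b)\<^sup>2 * 1 + 2 * (p * a * q * b) * s"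
      unfolding sum.distrib by (simp add: u v s_def flip: sum_distrib_left)
    finally show ?thesis by (simp add: power_mult_distrib)
  qed
  have cs: "m\<^sup>2 \<le> (p\<^sup>2 * a\<^sup>2 + q\<^sup>2 * b\<^sup>2 + 2 * p * q * a * b * s) * N"
    using Cauchy_Schwarz_ineq_sum[of "\<lambda>x. p * a * u x + q * b * v x" z S]
    by (simp add: mz mm N_def)
  have disc: "2 * (p * q * s) * a * b \<le> p * (L - p) * a\<^sup>2 + q * (L - q) * b\<^sup>2"
  proof (rule psd_two_by_two)
    have "(p * (L - p)) * (q * (L - q)) = p * q * ((L - p) * (L - q))" by (simp only: mult_ac)
    thus "(p * (L - p)) * (q * (L - q)) = (p * q * s)\<^sup>2"
      by (simp add: L s_def[symmetric] power2_eq_square)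
  qed (use p q pL qL in auto)
  have "p\<^sup>2 * a\<^sup>2 + q\<^sup>2 * b\<^sup>2 + 2 * p * q * a * b * s \<le> L * m"
    using disc unfolding m_def by (simp add: algebra_simps power2_eq_square)
  hence "m\<^sup>2 \<le> L * m * N" using cs N0 by (meson mult_right_mono order_trans)
  hence "m * m \<le> m * (L * N)" by (simp add: power2_eq_square mult_ac)
  hence "m \<le> L * N" using m0 L0 N0 by (cases "m = 0") auto
  thus ?thesis by (simp add: m_def a_def b_def N_def)
qed

text \<open>
  The second factor \<open>p + q - L\<close> is the other root, by the sum of the roots.
\<close>

lemma two_rank_one_top_root:
  fixes p q s :: real
  assumes "0 \<le> p" and "0 \<le> q"
  obtains L where "p \<le> L" "q \<le> L" "(L - p) * (L - q) = p * q * s\<^sup>2"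
    "\<And>l. (l - p) * (l - q) = p * q * s\<^sup>2 \<Longrightarrow> l = L \<or> l = p + q - L"
proof
  define D where "D = sqrt ((p - q)\<^sup>2 + 4 * p * q * s\<^sup>2)"
  define L where "L = (p + q + D) / 2"
  have nn: "0 \<le> 4 * p * q * s\<^sup>2" using assms by simp
  have D2: "D\<^sup>2 = (p - q)\<^sup>2 + 4 * p * q * s\<^sup>2" unfolding D_def using nn by simp
  have "\<bar>p - q\<bar> \<le> D" unfolding D_def using nn by (intro real_le_rsqrt) simp
  thus "p \<le> L" "q \<le> L" unfolding L_def by auto
  have "4 * ((L - p) * (L - q)) = D\<^sup>2 - (p - q)\<^sup>2"
    unfolding L_def by (simp add: field_simps power2_eq_square)
  thus LL: "(L - p) * (L - q) = p * q * s\<^sup>2" using D2 by simp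
  show "l = L \<or> l = p + q - L" if "(l - p) * (l - q) = p * q * s\<^sup>2" for l
  proof -
    have "(l - L) * (l - (p + q - L)) = (l - p) * (l - q) - (L - p) * (L - q)"
      by (simp add: algebra_simps)
    hence "(l - L) * (l - (p + q - L)) = 0" using that LL by simp
    thus ?thesis by auto
  qed
qed

lemma two_rank_one_apply:
  fixes u v w :: "'i \<Rightarrow> real"
  assumes M: "\<And>x y. M x y = p * outer u x y + q * outer v x y"
  shows "(\<Sum>y\<in>S. M x y * w y) = p * (\<Sum>y\<in>S. u y * w y) * u x + q * (\<Sum>y\<in>S. v y * w y) * v x"
  by (simp add: M outer_def sum.distrib sum_distrib_left algebra_simps)

text \<open>
  An eigenvector for an eigenvalue \<open>l \<noteq> 0\<close> is a combination of \<open>u\<close> and \<open>v\<close>, so that \<open>l\<close> is a root of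
  \<open>(l - p) (l - q) = p q s\<^sup>2\<close> with \<open>s = \<langle>u, v\<rangle>\<close>.  Thus there are at most three eigenvalues, which makes
  the \<open>Max\<close> in \<open>lambda_max\<close> meaningful, and it remains to exhibit a nonnegative eigenvector for the
  larger root \<open>L\<close>.
\<close>

lemma two_rank_one_principal:
  fixes u v :: "'i \<Rightarrow> real"
  assumes u: "(\<Sum>x\<in>S. (u x)\<^sup>2) = 1" and v: "(\<Sum>x\<in>S. (v x)\<^sup>2) = 1"
    and u0: "\<forall>x\<in>S. 0 \<le> u x" and v0: "\<forall>x\<in>S. 0 \<le> v x"
    and p: "0 \<le> p" and q: "0 \<le> q"
    and M: "\<And>x y. M x y = p * outer u x y + q * outer v x y"
  shows "\<exists>w. principal_eigenvector S M (vsqrt w)"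
    and "p * (\<Sum>x\<in>S. u x * z x)\<^sup>2 + q * (\<Sum>x\<in>S. v x * z x)\<^sup>2 \<le> lambda_max S M * (\<Sum>x\<in>S. (z x)\<^sup>2)"
    and "principal_eigenvector S M z \<Longrightarrow>
      lambda_max S M = p * (\<Sum>x\<in>S. u x * z x)\<^sup>2 + q * (\<Sum>x\<in>S. v x * z x)\<^sup>2"
proof -
  define s where "s = (\<Sum>x\<in>S. u x * v x)"
  have s0: "0 \<le> s" unfolding s_def by (rule sum_nonneg) (simp add: u0 v0)
  have sc: "(\<Sum>x\<in>S. v x * u x) = s" by (simp add: s_def mult.commute)
  obtain L where L: "p \<le> L" "q \<le> L" "(L - p) * (L - q) = p * q * s\<^sup>2"
    "\<And>l. (l - p) * (l - q) = p * q * s\<^sup>2 \<Longrightarrow> l = L \<or> l = p + q - L"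
    using two_rank_one_top_root[OF p q, of s] by metis
  have eig: "l = 0 \<or> l = L \<or> l = p + q - L" if ev: "eigenvector_on S M w l" for w l
  proof (cases "l = 0")
    case False
    define a where "a = (\<Sum>x\<in>S. u x * w x)"
    define b where "b = (\<Sum>x\<in>S. v x * w x)"
    have e: "l * w x = p * a * u x + q * b * v x" if "x \<in> S" for x
      using ev that unfolding eigenvector_on_def two_rank_one_apply[OF M] a_def b_def by auto
    have "l * a = (\<Sum>x\<in>S. u x * (l * w x))" by (simp add: a_def sum_distrib_left mult_ac)
    also have "\<dots> = (\<Sum>x\<in>S. p * a * (u x)\<^sup>2 + q * b * (u x * v x))"
      by (rule sum.cong) (auto simp: e algebra_simps power2_eq_square)
    also have "\<dots> = p * a + q * b * s" by (simp add: sum.distrib u s_def flip: sum_distrib_left)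
    finally have ea: "(l - p) * a = q * b * s" by (simp add: algebra_simps)
    have "l * b = (\<Sum>x\<in>S. v x * (l * w x))" by (simp add: b_def sum_distrib_left mult_ac)
    also have "\<dots> = (\<Sum>x\<in>S. p * a * (u x * v x) + q * b * (v x)\<^sup>2)"
      by (rule sum.cong) (auto simp: e algebra_simps power2_eq_square)
    also have "\<dots> = p * a * s + q * b" by (simp add: sum.distrib v s_def flip: sum_distrib_left)
    finally have eb: "(l - q) * b = p * a * s" by (simp add: algebra_simps)
    have ab: "a \<noteq> 0 \<or> b \<noteq> 0"
    proof (rule ccontr)
      assume "\<not> ?thesis"
      hence "\<forall>x\<in>S. w x = 0" using e False by auto
      thus False using ev by (auto simp: eigenvector_on_def)
    qed
    have "((l - p) * (l - q) - p * q * s\<^sup>2) * a = 0"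
    proof -
      have "(l - p) * (l - q) * a = (l - q) * ((l - p) * a)" by simp
      also have "\<dots> = q * s * ((l - q) * b)" unfolding ea by (simp add: algebra_simps)
      finally show ?thesis unfolding eb by (simp add: algebra_simps power2_eq_square)
    qed
    moreover have "((l - p) * (l - q) - p * q * s\<^sup>2) * b = 0"
    proof -
      have "(l - p) * (l - q) * b = (l - p) * ((l - q) * b)" by simp
      also have "\<dots> = p * s * ((l - p) * a)" unfolding eb by (simp add: algebra_simps)
      finally show ?thesis unfolding ea by (simp add: algebra_simps power2_eq_square)
    qed
    ultimately have "(l - p) * (l - q) = p * q * s\<^sup>2" using ab by auto
    thus ?thesis using L(4) by blast
  qed simp
  \<comment> \<open>Coefficients of a nonnegative eigenvector \<open>a u + b v\<close>.  The two equations are proportional by the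
  equation for \<open>L\<close>, so a solution of one of them that is not zero will do.\<close>
  obtain a b where ab: "0 \<le> a" "0 \<le> b" "a \<noteq> 0 \<or> b \<noteq> 0"
    and e1: "(L - p) * a = p * s * b" and e2: "(L - q) * b = q * s * a"
  proof -
    consider "p * s \<noteq> 0 \<or> L \<noteq> p" | "L = p" "p * s = 0" "L \<noteq> q \<or> q * s \<noteq> 0"
      | "L = p" "p * s = 0" "L = q" "q * s = 0" by blast
    thus thesis
    proof cases
      case 1 thus thesis using L p s0
        by (intro that[of "p * s" "L - p"]) (auto simp: algebra_simps power2_eq_square)
    next
      case 2 thus thesis using L q s0
        by (intro that[of "L - q" "q * s"]) (auto simp: algebra_simps power2_eq_square)
    next
      case 3 thus thesis by (intro that[of 1 0]) auto
    qed
  qed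
  define w where "w x = a * u x + b * v x" for x
  have w0: "0 \<le> w x" if "x \<in> S" for x using u0 v0 that ab by (simp add: w_def)
  have uw: "(\<Sum>x\<in>S. u x * w x) = a + b * s"
  proof -
    have "(\<Sum>x\<in>S. u x * w x) = (\<Sum>x\<in>S. a * (u x)\<^sup>2 + b * (u x * v x))"
      by (rule sum.cong) (auto simp: w_def algebra_simps power2_eq_square)
    thus ?thesis by (simp add: sum.distrib u s_def flip: sum_distrib_left)
  qed
  have vw: "(\<Sum>x\<in>S. v x * w x) = a * s + b"
  proof -
    have "(\<Sum>x\<in>S. v x * w x) = (\<Sum>x\<in>S. a * (u x * v x) + b * (v x)\<^sup>2)"
      by (rule sum.cong) (auto simp: w_def algebra_simps power2_eq_square)
    thus ?thesis by (simp add: sum.distrib v s_def flip: sum_distrib_left)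
  qed
  have Mw: "(\<Sum>y\<in>S. M x y * w y) = L * w x" for x
  proof -
    have "p * (a + b * s) = L * a" "q * (a * s + b) = L * b" using e1 e2 by (auto simp: algebra_simps)
    thus ?thesis unfolding two_rank_one_apply[OF M] uw vw by (simp add: w_def algebra_simps)
  qed
  define N where "N = (\<Sum>x\<in>S. (w x)\<^sup>2)"
  have N: "0 < N"
  proof -
    have "N = (\<Sum>x\<in>S. a * (u x * w x) + b * (v x * w x))"
      unfolding N_def by (rule sum.cong) (auto simp: w_def algebra_simps power2_eq_square)
    also have "\<dots> = a * (a + b * s) + b * (a * s + b)"
      by (simp add: sum.distrib uw vw flip: sum_distrib_left)
    also have "\<dots> = a\<^sup>2 + b\<^sup>2 + 2 * a * b * s" by (simp add: algebra_simps power2_eq_square)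
    also have "\<dots> > 0" using ab s0
      by (metis add_nonneg_pos add_pos_nonneg less_eq_real_def mult_nonneg_nonneg zero_le_numeral
          zero_less_power2 zero_le_power2)
    finally show ?thesis .
  qed
  have wnz: "\<exists>x\<in>S. w x \<noteq> 0"
  proof (rule ccontr)
    assume "\<not> ?thesis" hence "N = 0" unfolding N_def by (intro sum.neutral) auto
    thus False using N by simp
  qed
  have evw: "eigenvector_on S M w L" using wnz Mw by (auto simp: eigenvector_on_def)
  have lmax: "lambda_max S M = L"
    unfolding lambda_max_def
  proof (rule Max_eqI)
    have "{l. \<exists>v. eigenvector_on S M v l} \<subseteq> {0, L, p + q - L}" using eig by blast
    thus "finite {l. \<exists>v. eigenvector_on S M v l}" by (rule finite_subset) simp
    show "l \<le> L" if "l \<in> {l. \<exists>v. eigenvector_on S M v l}" for l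
      using that eig L(1,2) p q by fastforce
    show "L \<in> {l. \<exists>v. eigenvector_on S M v l}" using evw by blast
  qed
  have "principal_eigenvector S M (vsqrt (\<lambda>x. (w x)\<^sup>2 / N))"
  proof -
    have eq: "vsqrt (\<lambda>x. (w x)\<^sup>2 / N) x = w x / sqrt N" if "x \<in> S" for x
      using w0[OF that] by (simp add: vsqrt_def real_sqrt_divide)
    have "(\<Sum>y\<in>S. M x y * vsqrt (\<lambda>x. (w x)\<^sup>2 / N) y) = L * (w x / sqrt N)" for x
    proof -
      have "(\<Sum>y\<in>S. M x y * vsqrt (\<lambda>x. (w x)\<^sup>2 / N) y) = (\<Sum>y\<in>S. M x y * w y / sqrt N)"
        by (rule sum.cong) (auto simp: eq)
      thus ?thesis using Mw[of x] by (simp flip: sum_divide_distrib)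
    qed
    moreover have "L2_set (vsqrt (\<lambda>x. (w x)\<^sup>2 / N)) S = 1"
    proof -
      have "(\<Sum>x\<in>S. (vsqrt (\<lambda>x. (w x)\<^sup>2 / N) x)\<^sup>2) = (\<Sum>x\<in>S. (w x)\<^sup>2 / N)"
        by (rule sum.cong) (use N in \<open>auto simp: vsqrt_def\<close>)
      also have "\<dots> = 1" using N by (simp add: N_def flip: sum_divide_distrib)
      finally show ?thesis by (simp add: L2_set_def)
    qed
    ultimately show ?thesis
      unfolding principal_eigenvector_def eigenvector_on_def lmax
      using wnz N w0 eq by auto
  qed
  thus "\<exists>w. principal_eigenvector S M (vsqrt w)" by blast
  show "p * (\<Sum>x\<in>S. u x * z x)\<^sup>2 + q * (\<Sum>x\<in>S. v x * z x)\<^sup>2 \<le> lambda_max S M * (\<Sum>x\<in>S. (z x)\<^sup>2)"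
    unfolding lmax using two_rank_one_rayleigh[OF u v p q L(1,2)] L(3) s_def by blast
  show "lambda_max S M = p * (\<Sum>x\<in>S. u x * z x)\<^sup>2 + q * (\<Sum>x\<in>S. v x * z x)\<^sup>2"
    if pz: "principal_eigenvector S M z"
  proof -
    have zz: "(\<Sum>x\<in>S. (z x)\<^sup>2) = 1"
      using pz by (simp add: principal_eigenvector_def L2_set_def)
    have ez: "L * z x = p * (\<Sum>y\<in>S. u y * z y) * u x + q * (\<Sum>y\<in>S. v y * z y) * v x" if "x \<in> S" for x
      using pz that unfolding principal_eigenvector_def eigenvector_on_def two_rank_one_apply[OF M] lmax
      by auto
    have "L = (\<Sum>x\<in>S. (L * z x) * z x)"
      using zz by (simp add: power2_eq_square mult.assoc flip: sum_distrib_left)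
    also have "\<dots> = (\<Sum>x\<in>S. p * (\<Sum>y\<in>S. u y * z y) * (u x * z x) + q * (\<Sum>y\<in>S. v y * z y) * (v x * z x))"
      by (rule sum.cong) (auto simp: ez algebra_simps)
    also have "\<dots> = p * (\<Sum>x\<in>S. u x * z x)\<^sup>2 + q * (\<Sum>x\<in>S. v x * z x)\<^sup>2"
      by (simp add: sum.distrib power2_eq_square flip: sum_distrib_left)
    finally show ?thesis using lmax by simp
  qed
qed

lemma prob_vec_sq_vsqrt: "prob_vec S p \<Longrightarrow> (\<Sum>x\<in>S. (vsqrt p x)\<^sup>2) = 1"
  by (simp add: vsqrt_def prob_vec_def)

lemma prob_vec_principal_eigenvector:
  assumes "principal_eigenvector S M (vsqrt w)"
  shows "prob_vec S w"
proof -
  have w: "0 \<le> w x" if "x \<in> S" for x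
    using assms that by (auto simp: principal_eigenvector_def vsqrt_def)
  have "(\<Sum>x\<in>S. (vsqrt w x)\<^sup>2) = 1" using assms by (simp add: principal_eigenvector_def L2_set_def)
  thus ?thesis using w by (simp add: prob_vec_def vsqrt_def)
qed

section \<open>Density operators and quantum operations\<close>

lemma bit_UNIV: "(UNIV :: bit set) = {0, 1}"
  by (auto intro: bit_not_one_iff[THEN iffD1])

lemma finite_bit_UNIV [simp]: "finite (UNIV :: bit set)"
  by (simp add: bit_UNIV)

lemma bit_add_cancel [simp]: "(a::bit) + c + c = a"
  by (cases a; cases c) auto

lemma bit_add_eq_iff: "(a::bit) = b + c \<longleftrightarrow> b = a + c"
  by (cases a; cases b; cases c) auto

lemma density_operator_iff:
  "density_operator S \<rho> \<longleftrightarrow>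
     (\<forall>v. (\<Sum>i\<in>S. \<Sum>j\<in>S. cnj (v i) * \<rho> i j * v j) \<in> \<real>\<^sub>\<ge>\<^sub>0) \<and> (\<Sum>i\<in>S. \<rho> i i) = 1"
  unfolding density_operator_def Let_def complex_nonneg_Reals_iff by blast

lemma sum_nonneg_Reals: "(\<And>x. x \<in> X \<Longrightarrow> f x \<in> \<real>\<^sub>\<ge>\<^sub>0) \<Longrightarrow> (\<Sum>x\<in>X. f x :: complex) \<in> \<real>\<^sub>\<ge>\<^sub>0"
  by (auto simp: complex_nonneg_Reals_iff intro!: sum_nonneg)

lemma sum_list_nonneg_Reals:
  "(\<And>x. x \<in> set xs \<Longrightarrow> f x \<in> \<real>\<^sub>\<ge>\<^sub>0) \<Longrightarrow> (\<Sum>x\<leftarrow>xs. f x :: complex) \<in> \<real>\<^sub>\<ge>\<^sub>0"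
  by (induction xs) auto

lemma sum_sum_list_swap:
  "(\<Sum>x\<in>X. \<Sum>E\<leftarrow>Es. f x E) = (\<Sum>E\<leftarrow>Es. \<Sum>x\<in>X. f x E :: 'c::comm_monoid_add)"
  by (induction Es) (auto simp: sum.distrib)

lemma sum_list_times: "x * (\<Sum>E\<leftarrow>Es. f E) * y = (\<Sum>E\<leftarrow>Es. x * f E * y :: 'c::comm_semiring_0)"
  by (induction Es) (auto simp: algebra_simps)

lemma density_reindex:
  assumes "bij_betw f T S" and "density_operator S \<rho>"
  shows "density_operator T (reindex f \<rho>)"
proof -
  have inj: "inj_on f T" using assms(1) by (rule bij_betw_imp_inj_on)
  have "(\<Sum>i\<in>T. \<Sum>j\<in>T. cnj (v i) * reindex f \<rho> i j * v j) \<in> \<real>\<^sub>\<ge>\<^sub>0" for v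
  proof -
    define g where "g = v \<circ> the_inv_into T f"
    have g: "v i = g (f i)" if "i \<in> T" for i
      using that inj by (simp add: g_def the_inv_into_f_f)
    have "(\<Sum>i\<in>T. \<Sum>j\<in>T. cnj (v i) * reindex f \<rho> i j * v j)
        = (\<Sum>i\<in>T. \<Sum>j\<in>T. cnj (g (f i)) * \<rho> (f i) (f j) * g (f j))"
      by (intro sum.cong refl) (simp add: reindex_def g)
    also have "\<dots> = (\<Sum>i\<in>T. \<Sum>j\<in>S. cnj (g (f i)) * \<rho> (f i) j * g j)"
      by (intro sum.cong refl sum.reindex_bij_betw[OF assms(1)])
    also have "\<dots> = (\<Sum>i\<in>S. \<Sum>j\<in>S. cnj (g i) * \<rho> i j * g j)"
      by (rule sum.reindex_bij_betw[OF assms(1)])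
    finally show ?thesis using assms(2) by (simp add: density_operator_iff)
  qed
  moreover have "(\<Sum>i\<in>T. reindex f \<rho> i i) = 1"
    using sum.reindex_bij_betw[OF assms(1), of "\<lambda>i. \<rho> i i"] assms(2)
    by (simp add: reindex_def density_operator_iff)
  ultimately show ?thesis by (simp add: density_operator_iff)
qed

text \<open>
  The quadratic form of the product at \<open>v\<close> is the quadratic form of \<open>\<rho>\<close> at the partial inner product
  of \<open>\<phi>\<close> with \<open>v\<close>.
\<close>

lemma density_tensor_pure:
  assumes \<phi>: "(\<Sum>r\<in>R. \<phi> r * cnj (\<phi> r)) = 1" and d: "density_operator W \<rho>"
  shows "density_operator (R \<times> W) (\<lambda>(r, w) (r', w'). \<phi> r * cnj (\<phi> r') * \<rho> w w')"
    (is "density_operator _ ?M")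
proof -
  have "(\<Sum>i\<in>R\<times>W. \<Sum>j\<in>R\<times>W. cnj (v i) * ?M i j * v j) \<in> \<real>\<^sub>\<ge>\<^sub>0" for v
  proof -
    define u where "u w = (\<Sum>r\<in>R. cnj (\<phi> r) * v (r, w))" for w
    have "(\<Sum>i\<in>R\<times>W. \<Sum>j\<in>R\<times>W. cnj (v i) * ?M i j * v j)
        = (\<Sum>r\<in>R. \<Sum>w\<in>W. \<Sum>r'\<in>R. \<Sum>w'\<in>W. cnj (v (r, w)) * (\<phi> r * cnj (\<phi> r') * \<rho> w w') * v (r', w'))"
      by (simp add: sum.cartesian_product')
    also have "\<dots> = (\<Sum>w\<in>W. \<Sum>r\<in>R. \<Sum>w'\<in>W. \<Sum>r'\<in>R. cnj (v (r, w)) * (\<phi> r * cnj (\<phi> r') * \<rho> w w') * v (r', w'))"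
      by (subst sum.swap, intro sum.cong refl, rule sum.swap)
    also have "\<dots> = (\<Sum>w\<in>W. \<Sum>w'\<in>W. \<Sum>r\<in>R. \<Sum>r'\<in>R. cnj (v (r, w)) * (\<phi> r * cnj (\<phi> r') * \<rho> w w') * v (r', w'))"
      by (intro sum.cong refl, rule sum.swap)
    also have "\<dots> = (\<Sum>w\<in>W. \<Sum>w'\<in>W. cnj (u w) * \<rho> w w' * u w')"
    proof (intro sum.cong refl)
      fix w w'
      have "cnj (u w) * \<rho> w w' * u w' = \<rho> w w' * (cnj (u w) * u w')" by (simp add: mult_ac)
      also have "\<dots> = \<rho> w w' * (\<Sum>r\<in>R. \<Sum>r'\<in>R. (\<phi> r * cnj (v (r, w))) * (cnj (\<phi> r') * v (r', w')))"
        by (simp add: u_def sum_product)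
      also have "\<dots> = (\<Sum>r\<in>R. \<Sum>r'\<in>R. cnj (v (r, w)) * (\<phi> r * cnj (\<phi> r') * \<rho> w w') * v (r', w'))"
        unfolding sum_distrib_left by (intro sum.cong refl) (simp add: mult_ac)
      finally show "(\<Sum>r\<in>R. \<Sum>r'\<in>R. cnj (v (r, w)) * (\<phi> r * cnj (\<phi> r') * \<rho> w w') * v (r', w'))
         = cnj (u w) * \<rho> w w' * u w'" by simp
    qed
    finally show ?thesis using d by (simp add: density_operator_iff)
  qed
  moreover have "(\<Sum>i\<in>R\<times>W. ?M i i) = 1"
  proof -
    have "(\<Sum>i\<in>R\<times>W. ?M i i) = (\<Sum>r\<in>R. \<phi> r * cnj (\<phi> r)) * (\<Sum>w\<in>W. \<rho> w w)"
      by (simp add: sum_product sum.cartesian_product split_def)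
    thus ?thesis using \<phi> d by (simp add: density_operator_iff)
  qed
  ultimately show ?thesis by (simp add: density_operator_iff)
qed

lemma sum_swap_pairs:
  "(\<Sum>j\<in>J. \<Sum>j'\<in>J'. \<Sum>i\<in>I. \<Sum>i'\<in>I'. f j j' i i')
    = (\<Sum>i\<in>I. \<Sum>i'\<in>I'. \<Sum>j\<in>J. \<Sum>j'\<in>J'. f j j' i i' :: 'c::comm_monoid_add)"
proof -
  have "(\<Sum>j\<in>J. \<Sum>j'\<in>J'. \<Sum>i\<in>I. \<Sum>i'\<in>I'. f j j' i i')
      = (\<Sum>i\<in>I. \<Sum>j\<in>J. \<Sum>j'\<in>J'. \<Sum>i'\<in>I'. f j j' i i')"
    by (subst sum.swap, rule sum.cong[OF refl], rule sum.swap)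
  also have "\<dots> = (\<Sum>i\<in>I. \<Sum>i'\<in>I'. \<Sum>j\<in>J. \<Sum>j'\<in>J'. f j j' i i')"
    by (rule sum.cong[OF refl], subst sum.swap, rule sum.cong[OF refl], rule sum.swap)
  finally show ?thesis .
qed

text \<open>
  The quadratic form of \<open>(1 \<otimes> E) \<rho> (1 \<otimes> E)\<^sup>*\<close> at \<open>g\<close> is that of \<open>\<rho>\<close> at \<open>(1 \<otimes> E)\<^sup>* g\<close>; this is why
  quantum operations preserve positivity.
\<close>

lemma apply_second_Kraus_form:
  "(\<Sum>s\<in>R\<times>J. \<Sum>t\<in>R\<times>J. cnj (g s) * apply_second I Es \<rho> s t * g t) =
   (\<Sum>E\<leftarrow>Es. \<Sum>s\<in>R\<times>I. \<Sum>t\<in>R\<times>I. cnj (\<Sum>j\<in>J. cnj (E j (snd s)) * g (fst s, j)) * \<rho> s t *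
      (\<Sum>j\<in>J. cnj (E j (snd t)) * g (fst t, j)))"
proof -
  have one: "(\<Sum>s\<in>R\<times>J. \<Sum>t\<in>R\<times>J. cnj (g s) *
        (\<Sum>i\<in>I. \<Sum>i'\<in>I. E (snd s) i * \<rho> (fst s, i) (fst t, i') * cnj (E (snd t) i')) * g t) =
      (\<Sum>s\<in>R\<times>I. \<Sum>t\<in>R\<times>I. cnj (\<Sum>j\<in>J. cnj (E j (snd s)) * g (fst s, j)) * \<rho> s t *
      (\<Sum>j\<in>J. cnj (E j (snd t)) * g (fst t, j)))" (is "?l = ?r") for E
  proof -
    define F where "F r r' j j' i i' =
      cnj (g (r, j)) * (E j i * \<rho> (r, i) (r', i') * cnj (E j' i')) * g (r', j')" for r r' j j' i i'
    have "?l = (\<Sum>r\<in>R. \<Sum>j\<in>J. \<Sum>r'\<in>R. \<Sum>j'\<in>J. \<Sum>i\<in>I. \<Sum>i'\<in>I. F r r' j j' i i')"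
      by (simp add: sum.cartesian_product' F_def sum_distrib_left sum_distrib_right)
    also have "\<dots> = (\<Sum>r\<in>R. \<Sum>r'\<in>R. \<Sum>j\<in>J. \<Sum>j'\<in>J. \<Sum>i\<in>I. \<Sum>i'\<in>I. F r r' j j' i i')"
      by (intro sum.cong refl, rule sum.swap)
    also have "\<dots> = (\<Sum>r\<in>R. \<Sum>r'\<in>R. \<Sum>i\<in>I. \<Sum>i'\<in>I. \<Sum>j\<in>J. \<Sum>j'\<in>J. F r r' j j' i i')"
      by (intro sum.cong refl, rule sum_swap_pairs)
    also have "\<dots> = (\<Sum>r\<in>R. \<Sum>i\<in>I. \<Sum>r'\<in>R. \<Sum>i'\<in>I. \<Sum>j\<in>J. \<Sum>j'\<in>J. F r r' j j' i i')"
      by (intro sum.cong refl, rule sum.swap)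
    also have "\<dots> = (\<Sum>r\<in>R. \<Sum>i\<in>I. \<Sum>r'\<in>R. \<Sum>i'\<in>I. cnj (\<Sum>j\<in>J. cnj (E j i) * g (r, j)) * \<rho> (r, i) (r', i') *
      (\<Sum>j\<in>J. cnj (E j i') * g (r', j)))"
    proof (intro sum.cong refl)
      fix r i r' i'
      have "cnj (\<Sum>j\<in>J. cnj (E j i) * g (r, j)) * \<rho> (r, i) (r', i') * (\<Sum>j\<in>J. cnj (E j i') * g (r', j))
        = \<rho> (r, i) (r', i') * ((\<Sum>j\<in>J. E j i * cnj (g (r, j))) * (\<Sum>j\<in>J. cnj (E j i') * g (r', j)))"
        by (simp add: mult_ac)
      also have "\<dots> = (\<Sum>j\<in>J. \<Sum>j'\<in>J. F r r' j j' i i')"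
        unfolding sum_product unfolding sum_distrib_left F_def by (intro sum.cong refl) (simp add: mult_ac)
      finally show "(\<Sum>j\<in>J. \<Sum>j'\<in>J. F r r' j j' i i') =
        cnj (\<Sum>j\<in>J. cnj (E j i) * g (r, j)) * \<rho> (r, i) (r', i') * (\<Sum>j\<in>J. cnj (E j i') * g (r', j))"
        by simp
    qed
    also have "\<dots> = ?r" by (simp add: sum.cartesian_product')
    finally show ?thesis .
  qed
  have "(\<Sum>s\<in>R\<times>J. \<Sum>t\<in>R\<times>J. cnj (g s) * apply_second I Es \<rho> s t * g t) =
    (\<Sum>s\<in>R\<times>J. \<Sum>t\<in>R\<times>J. \<Sum>E\<leftarrow>Es. cnj (g s) *
        (\<Sum>i\<in>I. \<Sum>i'\<in>I. E (snd s) i * \<rho> (fst s, i) (fst t, i') * cnj (E (snd t) i')) * g t)"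
    by (simp add: apply_second_def split_def sum_list_times)
  also have "\<dots> = (\<Sum>E\<leftarrow>Es. \<Sum>s\<in>R\<times>J. \<Sum>t\<in>R\<times>J. cnj (g s) *
        (\<Sum>i\<in>I. \<Sum>i'\<in>I. E (snd s) i * \<rho> (fst s, i) (fst t, i') * cnj (E (snd t) i')) * g t)"
    by (simp add: sum_sum_list_swap)
  finally show ?thesis by (simp add: one)
qed

lemma apply_second_trace:
  assumes "quantum_operation I J Es" and "finite I"
  shows "(\<Sum>s\<in>R\<times>J. apply_second I Es \<rho> s s) = (\<Sum>s\<in>R\<times>I. \<rho> s s)"
proof -
  have "(\<Sum>s\<in>R\<times>J. apply_second I Es \<rho> s s)
      = (\<Sum>E\<leftarrow>Es. \<Sum>r\<in>R. \<Sum>j\<in>J. \<Sum>i\<in>I. \<Sum>i'\<in>I. E j i * \<rho> (r, i) (r, i') * cnj (E j i'))"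
    by (simp add: apply_second_def split_def sum_sum_list_swap sum.cartesian_product')
  also have "\<dots> = (\<Sum>E\<leftarrow>Es. \<Sum>r\<in>R. \<Sum>i\<in>I. \<Sum>i'\<in>I. \<rho> (r, i) (r, i') * (\<Sum>j\<in>J. cnj (E j i') * E j i))"
  proof -
    have "(\<Sum>j\<in>J. \<Sum>i\<in>I. \<Sum>i'\<in>I. E j i * \<rho> (r, i) (r, i') * cnj (E j i'))
       = (\<Sum>i\<in>I. \<Sum>i'\<in>I. \<rho> (r, i) (r, i') * (\<Sum>j\<in>J. cnj (E j i') * E j i))" for E :: "'b \<Rightarrow> 'a \<Rightarrow> complex" and r
      unfolding sum_distrib_left
      by (subst sum.swap, rule sum.cong[OF refl], subst sum.swap, intro sum.cong refl) (simp add: mult_ac)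
    thus ?thesis by simp
  qed
  also have "\<dots> = (\<Sum>r\<in>R. \<Sum>i\<in>I. \<Sum>i'\<in>I. \<rho> (r, i) (r, i') * (\<Sum>E\<leftarrow>Es. \<Sum>j\<in>J. cnj (E j i') * E j i))"
    by (simp add: sum_list_const_mult flip: sum_sum_list_swap)
  also have "\<dots> = (\<Sum>r\<in>R. \<Sum>i\<in>I. \<Sum>i'\<in>I. \<rho> (r, i) (r, i') * (if i' = i then 1 else 0))"
    using assms(1) unfolding quantum_operation_def by (intro sum.cong refl) simp
  also have "\<dots> = (\<Sum>r\<in>R. \<Sum>i\<in>I. \<rho> (r, i) (r, i))"
    using assms(2) by (simp add: if_distrib[of "\<lambda>x. _ * x"] sum.delta cong: if_cong)
  finally show ?thesis by (simp add: sum.cartesian_product')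
qed

lemma density_apply_second:
  assumes "quantum_operation I J Es" and "finite I" and "density_operator (R \<times> I) \<rho>"
  shows "density_operator (R \<times> J) (apply_second I Es \<rho>)"
  unfolding density_operator_iff apply_second_Kraus_form apply_second_trace[OF assms(1,2)]
proof (intro conjI allI sum_list_nonneg_Reals)
  note d = assms(3)[unfolded density_operator_iff]
  show "(\<Sum>s\<in>R\<times>I. \<rho> s s) = 1" using d by blast
  show "(\<Sum>s\<in>R\<times>I. \<Sum>t\<in>R\<times>I. cnj (\<Sum>j\<in>J. cnj (E j (snd s)) * g (fst s, j)) * \<rho> s t *
      (\<Sum>j\<in>J. cnj (E j (snd t)) * g (fst t, j))) \<in> \<real>\<^sub>\<ge>\<^sub>0" for E g
    by (rule d[THEN conjunct1, THEN spec])
qed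

lemma density_diag_nonneg:
  assumes "density_operator T \<rho>" and "finite T" and "s \<in> T"
  shows "0 \<le> Re (\<rho> s s)"
proof -
  define v :: "'a \<Rightarrow> complex" where "v i = (if i = s then 1 else 0)" for i
  have sv: "(\<Sum>i\<in>T. f i * v i) = f s" for f
    using assms(2,3) by (simp add: v_def if_distrib[of "\<lambda>x. _ * x"] cong: if_cong)
  have "(\<Sum>i\<in>T. \<Sum>j\<in>T. cnj (v i) * \<rho> i j * v j) = (\<Sum>i\<in>T. cnj (v i) * \<rho> i s)"
    by (simp only: sv)
  also have "\<dots> = (\<Sum>i\<in>T. \<rho> i s * v i)"
    by (intro sum.cong refl) (simp add: v_def)
  finally have "(\<Sum>i\<in>T. \<Sum>j\<in>T. cnj (v i) * \<rho> i j * v j) = (\<Sum>i\<in>T. \<rho> i s * v i)" .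
  moreover have "(\<Sum>i\<in>T. \<Sum>j\<in>T. cnj (v i) * \<rho> i j * v j) \<in> \<real>\<^sub>\<ge>\<^sub>0"
    using assms(1) unfolding density_operator_iff by blast
  ultimately show ?thesis by (simp add: sv complex_nonneg_Reals_iff)
qed

text \<open>
  Evaluate the quadratic form at the vectors that are 1 at \<open>s\<close>, \<open>k\<close> at \<open>t\<close> and 0 elsewhere: \<open>k = -1\<close> bounds
  \<open>Re (\<rho> s t) + Re (\<rho> t s)\<close>, and that the values at \<open>k = \<plusminus>\<i>\<close> are real shows that both summands are
  equal.
\<close>

lemma density_Re_entry_le:
  assumes d: "density_operator T \<rho>" and "finite T" and "s \<in> T" and "t \<in> T"
  shows "Re (\<rho> s t) \<le> (Re (\<rho> s s) + Re (\<rho> t t)) / 2"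
proof (cases "s = t")
  case False
  have q: "\<rho> s s + cnj c * c * \<rho> t t + c * \<rho> s t + cnj c * \<rho> t s \<in> \<real>\<^sub>\<ge>\<^sub>0" for c
  proof -
    define v where "v i = (if i = s then 1 else 0) + (if i = t then c else 0)" for i
    have sv: "(\<Sum>i\<in>T. f i * v i) = f s + f t * c" for f
      using assms(2-4) by (simp add: v_def distrib_left sum.distrib if_distrib[of "\<lambda>x. _ * x"] cong: if_cong)
    have svc: "(\<Sum>i\<in>T. cnj (v i) * f i) = f s + cnj c * f t" for f
      using arg_cong[OF sv[of "\<lambda>i. cnj (f i)"], of cnj] by (simp add: mult.commute)
    have "(\<Sum>i\<in>T. \<Sum>j\<in>T. cnj (v i) * \<rho> i j * v j) = (\<Sum>i\<in>T. cnj (v i) * (\<rho> i s + \<rho> i t * c))"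
      by (simp add: sv mult.assoc flip: sum_distrib_left)
    also have "\<dots> = \<rho> s s + \<rho> s t * c + cnj c * (\<rho> t s + \<rho> t t * c)" by (rule svc)
    also have "\<dots> = \<rho> s s + cnj c * c * \<rho> t t + c * \<rho> s t + cnj c * \<rho> t s"
      by (simp add: algebra_simps)
    finally have e: "(\<Sum>i\<in>T. \<Sum>j\<in>T. cnj (v i) * \<rho> i j * v j)
      = \<rho> s s + cnj c * c * \<rho> t t + c * \<rho> s t + cnj c * \<rho> t s" .
    have "(\<Sum>i\<in>T. \<Sum>j\<in>T. cnj (v i) * \<rho> i j * v j) \<in> \<real>\<^sub>\<ge>\<^sub>0"
      using d unfolding density_operator_iff by blast
    thus ?thesis unfolding e .
  qed
  have d1: "0 \<le> Re (\<rho> s s)" "0 \<le> Re (\<rho> t t)" using assms by (auto intro: density_diag_nonneg[OF d])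
  show ?thesis using q[of "-1"] q[of \<i>] q[of 0] q[of 1] q[of "-\<i>"]
    by (auto simp: complex_nonneg_Reals_iff)
qed simp

text \<open>
  The assumption on \<open>E\<close> says that its rows are orthogonal, each of norm 1 or 0, so that \<open>P = E\<^sup>* E\<close> is a
  projection.  For every basis vector \<open>e\<^sub>k\<close> one further Kraus matrix maps \<open>x\<close> to \<open>\<langle>e\<^sub>k, (1 - P) x\<rangle>\<close>
  times a fixed basis vector \<open>j0\<close>; together they contribute \<open>(1 - P)\<^sup>* (1 - P) = 1 - P\<close>.
\<close>

lemma quantum_operation_complete:
  fixes E :: "'j \<Rightarrow> 'i \<Rightarrow> complex"
  assumes I: "finite I" and J: "finite J" and j0: "j0 \<in> J"
    and E: "\<And>j j' i. j \<in> J \<Longrightarrow> j' \<in> J \<Longrightarrow> i \<in> I \<Longrightarrow>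
      (\<Sum>k\<in>I. E j k * cnj (E j' k)) * E j' i = (if j = j' then E j i else 0)"
  obtains Es where "quantum_operation I J (E # Es)"
proof -
  obtain ks where ks: "set ks = I" "distinct ks" using finite_distinct_list[OF I] by blast
  define P where "P i i' = (\<Sum>j\<in>J. cnj (E j i) * E j i')" for i i'
  define F where "F k = (\<lambda>j i. if j = j0 then (if k = i then 1 else 0) - P k i else 0)" for k
  have cP: "cnj (P i i') = P i' i" for i i' by (simp add: P_def mult.commute)
  have PP: "(\<Sum>k\<in>I. P i k * P k i') = P i i'" if "i \<in> I" "i' \<in> I" for i i'
  proof -
    have "(\<Sum>k\<in>I. P i k * P k i') = (\<Sum>k\<in>I. \<Sum>j\<in>J. \<Sum>j'\<in>J. cnj (E j i) * (E j k * cnj (E j' k) * E j' i'))"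
      by (simp add: P_def sum_product mult.assoc)
    also have "\<dots> = (\<Sum>j\<in>J. \<Sum>j'\<in>J. cnj (E j i) * ((\<Sum>k\<in>I. E j k * cnj (E j' k)) * E j' i'))"
      unfolding sum_distrib_left sum_distrib_right
      by (subst sum.swap, rule sum.cong[OF refl], rule sum.swap)
    also have "\<dots> = (\<Sum>j\<in>J. \<Sum>j'\<in>J. cnj (E j i) * (if j = j' then E j i' else 0))"
      by (intro sum.cong refl) (use E that in simp)
    also have "\<dots> = P i i'" using J by (simp add: P_def if_distrib[of "\<lambda>x. _ * x"] cong: if_cong)
    finally show ?thesis .
  qed
  have "(\<Sum>G\<leftarrow>E # map F ks. \<Sum>j\<in>J. cnj (G j i) * G j i') = (if i = i' then 1 else 0)"
    if i: "i \<in> I" "i' \<in> I" for i i'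
  proof -
    have "(\<Sum>j\<in>J. cnj (F k j i) * F k j i')
        = cnj ((if k = i then 1 else 0) - P k i) * ((if k = i' then 1 else 0) - P k i')" for k
    proof -
      have "(\<Sum>j\<in>J. cnj (F k j i) * F k j i')
        = (\<Sum>j\<in>J. if j = j0 then cnj ((if k = i then 1 else 0) - P k i) * ((if k = i' then 1 else 0) - P k i') else 0)"
        by (intro sum.cong refl) (simp add: F_def)
      thus ?thesis using J j0 by simp
    qed
    hence "(\<Sum>G\<leftarrow>map F ks. \<Sum>j\<in>J. cnj (G j i) * G j i')
       = (\<Sum>k\<in>I. cnj ((if k = i then 1 else 0) - P k i) * ((if k = i' then 1 else 0) - P k i'))"
      using ks by (simp add: comp_def sum_list_distinct_conv_sum_set)
    also have "\<dots> = (\<Sum>k\<in>I. (if k = i then (if k = i' then 1 else 0) else 0)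
        - (if k = i then P k i' else 0) - (if k = i' then P i k else 0) + P i k * P k i')"
      by (intro sum.cong refl) (simp add: cP algebra_simps)
    also have "\<dots> = (if i = i' then 1 else 0) - P i i' - P i i' + P i i'"
      using i I PP by (simp add: sum.distrib sum_subtractf)
    finally show ?thesis by (simp add: P_def)
  qed
  hence "quantum_operation I J (E # map F ks)" by (simp add: quantum_operation_def)
  thus thesis by (rule that)
qed

section \<open>The probability that Alice outputs a given bit\<close>

text \<open>
  Used to collapse sums over all register indices to the few that carry a nonzero summand.
\<close>

lemma sum_reindex_support:
  assumes "finite R" and "h ` D \<subseteq> R" and "inj_on h D" and "\<And>r. r \<in> R \<Longrightarrow> r \<notin> h ` D \<Longrightarrow> X r = 0"
  shows "sum X R = (\<Sum>d\<in>D. X (h d))"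
proof -
  have "sum X R = sum X (h ` D)" by (rule sum.mono_neutral_right) (use assms in auto)
  thus ?thesis by (simp add: sum.reindex[OF assms(3)])
qed

lemma commit_state_eq:
  assumes "finite S"
  shows "commit_state S p x x' = (if x = x' \<and> x \<in> S then complex_of_real (sqrt (p x)) else 0)"
proof -
  have "commit_state S p x x' = (\<Sum>z\<in>S. if z = x then (if x = x' then complex_of_real (sqrt (p x)) else 0) else 0)"
    unfolding commit_state_def by (intro sum.cong refl) (auto simp: basis_vec_def)
  thus ?thesis using assms by simp
qed

lemma alice_state_eq:
  assumes "finite S"
  shows "alice_state S \<alpha> a a' x x' =
    (if a = a' \<and> x = x' \<and> x \<in> S then complex_of_real (sqrt (\<alpha> a x) / sqrt 2) else 0)"
  unfolding alice_state_def commit_state_eq[OF assms] by (cases a; cases a') (auto simp: basis_vec_def)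

text \<open>
  Both \<open>\<phi>\<^sub>b\<close> and the classical parts of \<open>\<Pi>\<^sub>A\<^sub>,\<^sub>c\<close> are perfectly correlated, so that a nonzero entry has
  equal indices in \<open>B\<close> and \<open>B'\<close>, and the bit in \<open>A\<^sub>0\<close> is the bit in \<open>B\<^sub>0'\<close> plus \<open>c\<close>.
\<close>

lemma alice_povm_eq:
  assumes "finite S" and "y \<in> S" "y2 \<in> S"
  shows "alice_povm S \<beta> c (a, b, y, y') (a2, b2, y2, y2') =
    (if a = b + c \<and> y' = y \<and> a2 = b + c \<and> b2 = b \<and> y2' = y2
     then complex_of_real (sqrt (\<beta> b y) * sqrt (\<beta> b y2)) else 0)"
  unfolding alice_povm_def split commit_state_eq[OF assms(1)]
  by (cases b; cases b2) (use assms(2,3) in \<open>auto simp: basis_vec_def\<close>)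

lemma alice_outputs_prob_eq:
  assumes "finite (tuples n B)"
  shows "alice_outputs_prob n A B \<alpha> \<beta> c S =
    Re (\<Sum>b\<in>UNIV. \<Sum>y\<in>tuples n B. \<Sum>y2\<in>tuples n B. \<Sum>w<wdim S (n + 1).
      complex_of_real (sqrt (\<beta> b y) * sqrt (\<beta> b y2)) *
        final_state n A \<alpha> S ((b + c, y2), (b, y2, w)) ((b + c, y), (b, y, w)))"
proof -
  define T where "T = tuples n B"
  define R where "R = (UNIV :: bit set) \<times> (UNIV :: bit set) \<times> T \<times> T"
  define F where "F r r2 = (\<Sum>w<wdim S (n + 1). (case r of (a, b, y, y') \<Rightarrow> case r2 of (a2, b2, y2, y2') \<Rightarrow>
    alice_povm T \<beta> c (a, b, y, y') (a2, b2, y2, y2')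
          * final_state n A \<alpha> S ((a2, y2), (b2, y2', w)) ((a, y), (b, y', w))))" for r r2
  have T: "finite T" using assms by (simp add: T_def)
  have R: "finite R" using T by (simp add: R_def)
  have F0: "F (a, b, y, y') (a2, b2, y2, y2') = 0"
    if "y \<in> T" "y2 \<in> T" "\<not> (a = b + c \<and> y' = y \<and> a2 = b + c \<and> b2 = b \<and> y2' = y2)" for a b y y' a2 b2 y2 y2'
    using that(3) by (auto simp: F_def alice_povm_eq[OF T that(1,2)])
  have "alice_outputs_prob n A B \<alpha> \<beta> c S = Re (\<Sum>r\<in>R. \<Sum>r2\<in>R. F r r2)"
    unfolding alice_outputs_prob_def Let_def F_def R_def T_def
    by (intro arg_cong[of _ _ Re] sum.cong refl) (auto intro!: sum.cong)
  also have "(\<Sum>r\<in>R. \<Sum>r2\<in>R. F r r2) = (\<Sum>r\<in>UNIV\<times>T. \<Sum>r2\<in>R. F ((\<lambda>(b, y). (b + c, b, y, y)) r) r2)"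
  proof (rule sum_reindex_support[OF R])
    show "(\<lambda>(b, y). (b + c, b, y, y)) ` (UNIV \<times> T) \<subseteq> R" by (auto simp: R_def)
    show "inj_on (\<lambda>(b, y). (b + c, b, y, y)) (UNIV \<times> T)" by (auto simp: inj_on_def)
    show "(\<Sum>r2\<in>R. F r r2) = 0" if "r \<in> R" "r \<notin> (\<lambda>(b, y). (b + c, b, y, y)) ` (UNIV \<times> T)" for r
    proof (rule sum.neutral, rule ballI)
      fix r2 assume "r2 \<in> R"
      thus "F r r2 = 0" using that
        by (cases r; cases r2) (auto simp: R_def image_iff intro!: F0)
    qed
  qed
  also have "\<dots> = (\<Sum>b\<in>UNIV. \<Sum>y\<in>T. \<Sum>r2\<in>R. F (b + c, b, y, y) r2)"
    by (simp add: sum.cartesian_product')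
  also have "\<dots> = (\<Sum>b\<in>UNIV. \<Sum>y\<in>T. \<Sum>y2\<in>T. F (b + c, b, y, y) (b + c, b, y2, y2))"
  proof (intro sum.cong refl sum_reindex_support[OF R])
    fix b y r2 assume y: "y \<in> T"
    show "(\<lambda>y2. (b + c, b, y2, y2)) ` T \<subseteq> R" by (auto simp: R_def)
    show "inj_on (\<lambda>y2. (b + c, b, y2, y2)) T" by (auto simp: inj_on_def)
    assume "r2 \<in> R" "r2 \<notin> (\<lambda>y2. (b + c, b, y2, y2)) ` T"
    thus "F (b + c, b, y, y) r2 = 0" using y by (cases r2) (auto simp: R_def image_iff intro!: F0)
  qed
  also have "\<dots> = (\<Sum>b\<in>UNIV. \<Sum>y\<in>T. \<Sum>y2\<in>T. \<Sum>w<wdim S (n + 1).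
      complex_of_real (sqrt (\<beta> b y) * sqrt (\<beta> b y2)) *
        final_state n A \<alpha> S ((b + c, y2), (b, y2, w)) ((b + c, y), (b, y, w)))"
    unfolding F_def by (intro sum.cong refl) (simp add: alice_povm_eq[OF T])
  finally show ?thesis by (simp add: T_def)
qed

text \<open>
  The indices of Alice's registers after \<open>i\<close> replies, and below those after she has also sent
  \<open>A\<^bsub>i+1\<^esub>\<close>.
\<close>

definition alice_indices :: "nat \<Rightarrow> (nat \<Rightarrow> 'a set) \<Rightarrow> (nat \<Rightarrow> 'b set) \<Rightarrow> nat \<Rightarrow> ('a, 'b) alice_index set" where
  "alice_indices n A B i = UNIV \<times> UNIV \<times> PiE {Suc i..n} A \<times> tuples n A \<times> PiE {1..i} B"

definition sent_indices :: "nat \<Rightarrow> (nat \<Rightarrow> 'a set) \<Rightarrow> (nat \<Rightarrow> 'b set) \<Rightarrow> nat \<Rightarrow> ('a, 'b) alice_index set" where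
  "sent_indices n A B i = UNIV \<times> UNIV \<times> PiE {Suc (Suc i)..n} A \<times> tuples n A \<times> PiE {1..i} B"

lemma bij_betw_send_index:
  assumes "i < n"
  shows "bij_betw (send_index (Suc i)) (sent_indices n A B i \<times> (A (Suc i) \<times> W)) (alice_indices n A B i \<times> W)"
proof (rule bij_betw_byWitness)
  let ?g = "\<lambda>((a, a', x, x', y), w). ((a, a', x(Suc i := undefined), x', y), (x (Suc i), w))"
  have I: "{Suc i..n} = insert (Suc i) {Suc (Suc i)..n}" using assms by auto
  show "\<forall>s\<in>sent_indices n A B i \<times> (A (Suc i) \<times> W). ?g (send_index (Suc i) s) = s"
    by (auto simp: sent_indices_def send_index_def PiE_def extensional_def fun_eq_iff)
  show "\<forall>s\<in>alice_indices n A B i \<times> W. send_index (Suc i) (?g s) = s"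
    by (auto simp: send_index_def)
  show "send_index (Suc i) ` (sent_indices n A B i \<times> (A (Suc i) \<times> W)) \<subseteq> alice_indices n A B i \<times> W"
    by (auto simp: sent_indices_def alice_indices_def send_index_def I intro!: PiE_fun_upd)
  show "?g ` (alice_indices n A B i \<times> W) \<subseteq> sent_indices n A B i \<times> (A (Suc i) \<times> W)"
    using assms by (auto simp: sent_indices_def alice_indices_def PiE_iff extensional_def)
qed

lemma bij_betw_reply_index:
  "bij_betw (reply_index (Suc i)) (alice_indices n A B (Suc i) \<times> W) (sent_indices n A B i \<times> (B (Suc i) \<times> W))"
proof (rule bij_betw_byWitness)
  let ?g = "\<lambda>((a, a', x, x', y), (u, w)). ((a, a', x, x', y(Suc i := u)), w)"
  have I: "{1..Suc i} = insert (Suc i) {1..i}" by auto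
  show "\<forall>s\<in>alice_indices n A B (Suc i) \<times> W. ?g (reply_index (Suc i) s) = s"
    by (auto simp: reply_index_def)
  show "\<forall>s\<in>sent_indices n A B i \<times> (B (Suc i) \<times> W). reply_index (Suc i) (?g s) = s"
    by (auto simp: sent_indices_def reply_index_def PiE_def extensional_def fun_eq_iff)
  show "reply_index (Suc i) ` (alice_indices n A B (Suc i) \<times> W) \<subseteq> sent_indices n A B i \<times> (B (Suc i) \<times> W)"
    by (auto simp: sent_indices_def alice_indices_def reply_index_def PiE_iff extensional_def)
  show "?g ` (sent_indices n A B i \<times> (B (Suc i) \<times> W)) \<subseteq> alice_indices n A B (Suc i) \<times> W"
    by (auto simp: sent_indices_def alice_indices_def PiE_iff extensional_def)
qed

lemma bij_betw_reveal_index: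
  "bij_betw reveal_index ((UNIV \<times> tuples n B) \<times> (UNIV \<times> tuples n A \<times> W)) (alice_indices n A B n \<times> W)"
proof (rule bij_betw_byWitness)
  let ?g = "\<lambda>((a, a', x, x', y), w). ((a, y), (a', x', w))"
  show "\<forall>s\<in>(UNIV \<times> tuples n B) \<times> (UNIV \<times> tuples n A \<times> W). ?g (reveal_index s) = s"
    by (auto simp: reveal_index_def)
  show "\<forall>s\<in>alice_indices n A B n \<times> W. reveal_index (?g s) = s"
    by (auto simp: alice_indices_def reveal_index_def)
  show "reveal_index ` ((UNIV \<times> tuples n B) \<times> (UNIV \<times> tuples n A \<times> W)) \<subseteq> alice_indices n A B n \<times> W"
    by (auto simp: alice_indices_def reveal_index_def)
  show "?g ` (alice_indices n A B n \<times> W) \<subseteq> (UNIV \<times> tuples n B) \<times> (UNIV \<times> tuples n A \<times> W)"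
    by (auto simp: alice_indices_def)
qed

lemma density_joint_state:
  assumes fin: "\<forall>i\<in>{1..n}. finite (A i) \<and> finite (B i)"
    and \<alpha>: "\<forall>a. prob_vec (tuples n A) (\<alpha> a)"
    and S: "valid_strategy n A B S" and "i \<le> n"
  shows "density_operator (alice_indices n A B i \<times> {..<wdim S i}) (joint_state n A \<alpha> S i)"
  using \<open>i \<le> n\<close>
proof (induction i)
  case 0
  have fA: "finite (tuples n A)" using fin by (intro finite_PiE) auto
  define \<phi> where "\<phi> = (\<lambda>(a, a', x, x', y :: nat \<Rightarrow> 'b). alice_state (tuples n A) \<alpha> a a' x x')"
  have "(\<Sum>r\<in>alice_indices n A B 0. \<phi> r * cnj (\<phi> r))
      = (\<Sum>a\<in>UNIV. \<Sum>a'\<in>UNIV. \<Sum>x\<in>tuples n A. \<Sum>x'\<in>tuples n A. 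
         if a = a' then if x' = x then complex_of_real (\<alpha> a x / 2) else 0 else 0)"
    unfolding alice_indices_def sum.cartesian_product'
    using \<alpha> by (intro sum.cong refl)
      (auto simp: \<phi>_def alice_state_eq[OF fA, unfolded One_nat_def] prob_vec_def simp flip: of_real_mult)
  also have "\<dots> = (\<Sum>a\<in>UNIV. \<Sum>a'\<in>UNIV. if a = a' then \<Sum>x\<in>tuples n A. complex_of_real (\<alpha> a x / 2) else 0)"
    using fA by (intro sum.cong refl) auto
  also have "\<dots> = (\<Sum>a\<in>UNIV. complex_of_real (\<Sum>x\<in>tuples n A. \<alpha> a x / 2))"
    by simp
  also have "\<dots> = 1" using \<alpha> by (simp add: prob_vec_def bit_UNIV flip: sum_divide_distrib)
  finally have "density_operator (alice_indices n A B 0 \<times> {..<wdim S 0})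
     (\<lambda>(r, w) (r', w'). \<phi> r * cnj (\<phi> r') * init S w w')"
    using S fA by (intro density_tensor_pure) (auto simp: alice_indices_def valid_strategy_def)
  thus ?case by (simp add: \<phi>_def split_def)
next
  case (Suc i)
  have op: "quantum_operation (A (Suc i) \<times> {..<wdim S i}) (B (Suc i) \<times> {..<wdim S (Suc i)}) (reply S (Suc i))"
  proof -
    have "\<forall>i\<in>{1..n}. quantum_operation (A i \<times> {..<wdim S (i - 1)}) (B i \<times> {..<wdim S i}) (reply S i)"
      using S by (simp add: valid_strategy_def)
    from bspec[OF this, of "Suc i"] show ?thesis using Suc.prems by simp
  qed
  have fi: "finite (A (Suc i) \<times> {..<wdim S i})" using fin Suc.prems by auto
  show ?case unfolding joint_state.simps
    using Suc by (intro density_reindex[OF bij_betw_reply_index] density_apply_second[OF op fi]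
        density_reindex[OF bij_betw_send_index]) auto
qed

lemma density_final_state:
  assumes fin: "\<forall>i\<in>{1..n}. finite (A i) \<and> finite (B i)"
    and \<alpha>: "\<forall>a. prob_vec (tuples n A) (\<alpha> a)"
    and S: "valid_strategy n A B S"
  shows "density_operator ((UNIV \<times> tuples n B) \<times> (UNIV \<times> tuples n B \<times> {..<wdim S (n + 1)})) (final_state n A \<alpha> S)"
proof -
  have fA: "finite (tuples n A)" using fin by (intro finite_PiE) auto
  show ?thesis unfolding final_state_def
  proof (rule density_apply_second)
    show "quantum_operation (UNIV \<times> tuples n A \<times> {..<wdim S n})
       (UNIV \<times> tuples n B \<times> {..<wdim S (n + 1)}) (reveal S)" using S by (simp add: valid_strategy_def)
    show "density_operator ((UNIV \<times> tuples n B) \<times> UNIV \<times> tuples n A \<times> {..<wdim S n})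
     (reindex reveal_index (joint_state n A \<alpha> S n))"
      by (rule density_reindex[OF bij_betw_reveal_index density_joint_state[OF fin \<alpha> S order_refl]])
  qed (use fA in auto)
qed

text \<open>
  Any bound that does not depend on the strategy is good enough for the supremum, hence the crude
  \<open>card B\<close>: the amplitudes \<open>\<surd>\<beta>\<close> are at most 1, the off-diagonal entries are bounded by the diagonal
  ones, and each diagonal entry then occurs \<open>card B\<close> times.
\<close>

lemma alice_outputs_prob_le:
  assumes fin: "\<forall>i\<in>{1..n}. finite (A i) \<and> finite (B i)"
    and \<alpha>: "\<forall>a. prob_vec (tuples n A) (\<alpha> a)"
    and \<beta>: "\<forall>b. prob_vec (tuples n B) (\<beta> b)"
    and S: "valid_strategy n A B S"
  shows "alice_outputs_prob n A B \<alpha> \<beta> c S \<le> card (tuples n B)"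
proof -
  define T where "T = tuples n B"
  define W where "W = {..<wdim S (n + 1)}"
  define \<rho> where "\<rho> = final_state n A \<alpha> S"
  define D where "D b y w = Re (\<rho> ((b + c, y), (b, y, w)) ((b + c, y), (b, y, w)))" for b y w
  have T: "finite T" using fin unfolding T_def by (intro finite_PiE) auto
  have d: "density_operator ((UNIV \<times> T) \<times> (UNIV \<times> T \<times> W)) \<rho>"
    using density_final_state[OF fin \<alpha> S] by (simp add: T_def W_def \<rho>_def)
  have fin': "finite (((UNIV :: bit set) \<times> T) \<times> ((UNIV :: bit set) \<times> T \<times> W))" using T by (simp add: W_def)
  have D0: "0 \<le> D b y w" if "y \<in> T" "w \<in> W" for b y w
    unfolding D_def using that by (intro density_diag_nonneg[OF d fin']) auto
  have sq: "0 \<le> sqrt (\<beta> b y)" "sqrt (\<beta> b y) \<le> 1" if "y \<in> T" for b y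
  proof -
    have "\<beta> b y \<le> sum (\<beta> b) T" using \<beta> that T by (intro member_le_sum) (auto simp: prob_vec_def T_def)
    thus "0 \<le> sqrt (\<beta> b y)" "sqrt (\<beta> b y) \<le> 1" using \<beta> that by (auto simp: prob_vec_def T_def)
  qed
  have "alice_outputs_prob n A B \<alpha> \<beta> c S = (\<Sum>b\<in>UNIV. \<Sum>y\<in>T. \<Sum>y2\<in>T. \<Sum>w\<in>W.
      (sqrt (\<beta> b y) * sqrt (\<beta> b y2)) * Re (\<rho> ((b + c, y2), (b, y2, w)) ((b + c, y), (b, y, w))))"
    using alice_outputs_prob_eq[of n B A \<alpha> \<beta> c S] T by (simp add: T_def W_def \<rho>_def flip: of_real_mult)
  also have "\<dots> \<le> (\<Sum>b\<in>UNIV. \<Sum>y\<in>T. \<Sum>y2\<in>T. \<Sum>w\<in>W. (D b y2 w + D b y w) / 2)"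
  proof (intro sum_mono)
    fix b y y2 w assume h: "y \<in> T" "y2 \<in> T" "w \<in> W"
    define k where "k = sqrt (\<beta> b y) * sqrt (\<beta> b y2)"
    have k: "0 \<le> k" "k \<le> 1" unfolding k_def using sq h by (auto intro: mult_le_one)
    have "k * Re (\<rho> ((b + c, y2), (b, y2, w)) ((b + c, y), (b, y, w))) \<le> k * ((D b y2 w + D b y w) / 2)"
      unfolding D_def using h k by (intro mult_left_mono density_Re_entry_le[OF d fin']) auto
    also have "\<dots> \<le> (D b y2 w + D b y w) / 2"
      using k D0 h by (intro mult_left_le_one_le) auto
    finally show "sqrt (\<beta> b y) * sqrt (\<beta> b y2) * Re (\<rho> ((b + c, y2), (b, y2, w)) ((b + c, y), (b, y, w)))
       \<le> (D b y2 w + D b y w) / 2" by (simp add: k_def)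
  qed
  also have "\<dots> = card T * (\<Sum>b\<in>UNIV. \<Sum>y\<in>T. \<Sum>w\<in>W. D b y w)"
    by (simp add: sum.distrib sum_divide_distrib[symmetric] add_divide_distrib sum_distrib_left)
  also have "(\<Sum>b\<in>UNIV. \<Sum>y\<in>T. \<Sum>w\<in>W. D b y w) \<le> 1"
  proof -
    have "(\<Sum>b\<in>UNIV. \<Sum>y\<in>T. \<Sum>w\<in>W. D b y w) = (\<Sum>(b,y,w)\<in>UNIV\<times>T\<times>W. Re (\<rho> ((b + c, y), (b, y, w)) ((b + c, y), (b, y, w))))"
      by (simp add: D_def sum.cartesian_product')
    also have "\<dots> = (\<Sum>s\<in>(\<lambda>(b,y,w). ((b + c, y), (b, y, w))) ` (UNIV\<times>T\<times>W). Re (\<rho> s s))"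
      by (subst sum.reindex) (auto simp: inj_on_def split_def)
    also have "\<dots> \<le> (\<Sum>s\<in>(UNIV \<times> T) \<times> (UNIV \<times> T \<times> W). Re (\<rho> s s))"
      by (intro sum_mono2 fin' density_diag_nonneg[OF d fin']) auto
    also have "\<dots> = Re (\<Sum>s\<in>(UNIV \<times> T) \<times> (UNIV \<times> T \<times> W). \<rho> s s)" by simp
    also have "\<dots> = 1" using d by (simp add: density_operator_iff)
    finally show ?thesis .
  qed
  finally show ?thesis unfolding T_def by (simp add: mult_left_mono)
qed

lemma alice_outputs_prob_le_P_Bob:
  assumes fin: "\<forall>i\<in>{1..n}. finite (A i) \<and> finite (B i)"
    and \<alpha>: "\<forall>a. prob_vec (tuples n A) (\<alpha> a)"
    and \<beta>: "\<forall>b. prob_vec (tuples n B) (\<beta> b)"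
    and S: "valid_strategy n A B S"
  shows "alice_outputs_prob n A B \<alpha> \<beta> c S \<le> P_Bob n A B \<alpha> \<beta> c"
  unfolding P_Bob_def
proof (rule cSUP_upper)
  show "bdd_above (alice_outputs_prob n A B \<alpha> \<beta> c ` {S. valid_strategy n A B S})"
    using alice_outputs_prob_le[OF fin \<alpha> \<beta>] by (intro bdd_aboveI) auto
qed (use S in simp)

section \<open>Replies controlled by the received messages\<close>

locale coin_flipping =
  fixes n :: nat and A :: "nat \<Rightarrow> 'a set" and B :: "nat \<Rightarrow> 'b set"
    and \<alpha> :: "bit \<Rightarrow> (nat \<Rightarrow> 'a) \<Rightarrow> real" and \<beta> :: "bit \<Rightarrow> (nat \<Rightarrow> 'b) \<Rightarrow> real"
    and c :: bit
  assumes n_pos: "1 \<le> n"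
    and fin: "\<forall>i\<in>{1..n}. finite (A i) \<and> finite (B i)"
    and \<alpha>: "\<forall>a. prob_vec (tuples n A) (\<alpha> a)"
    and \<beta>: "\<forall>b. prob_vec (tuples n B) (\<beta> b)"

context coin_flipping
begin

lemma finite_tuples: "finite (tuples n A)" "finite (tuples n B)"
  using fin by (auto intro!: finite_PiE)

lemma weights_nonneg: "x \<in> tuples n A \<Longrightarrow> 0 \<le> \<alpha> a x" "y \<in> tuples n B \<Longrightarrow> 0 \<le> \<beta> b y"
  using \<alpha> \<beta> by (auto simp: prob_vec_def)

end

text \<open>
  \<open>q i h k\<close> is the probability of the \<open>i\<close>-th reply \<open>k i\<close>, given the earlier replies in \<open>k\<close> and the
  messages \<open>h\<close> received so far.
\<close>

locale controlled_replies = coin_flipping n A B \<alpha> \<beta> c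
  for n :: nat and A :: "nat \<Rightarrow> 'a set" and B :: "nat \<Rightarrow> 'b set"
    and \<alpha> :: "bit \<Rightarrow> (nat \<Rightarrow> 'a) \<Rightarrow> real" and \<beta> :: "bit \<Rightarrow> (nat \<Rightarrow> 'b) \<Rightarrow> real"
    and c :: bit +
  fixes q :: "nat \<Rightarrow> (nat \<Rightarrow> 'a) \<Rightarrow> (nat \<Rightarrow> 'b) \<Rightarrow> real"
  assumes q_nonneg: "\<And>i h k. i \<in> {1..n} \<Longrightarrow> h \<in> tuples i A \<Longrightarrow> k \<in> tuples i B \<Longrightarrow> 0 \<le> q i h k"
    and q_sum: "\<And>i h k. i \<in> {1..n} \<Longrightarrow> h \<in> tuples i A \<Longrightarrow> k \<in> tuples (i - 1) B \<Longrightarrow>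
      (\<Sum>b\<in>B i. q i h (k(i := b))) = 1"
begin

text \<open>
  Bob's workspace after \<open>i\<close> replies records the messages and the replies so far.  As workspaces are
  spanned by natural numbers, \<open>decode i\<close> numbers these records.
\<close>

definition histories :: "nat \<Rightarrow> ((nat \<Rightarrow> 'a) \<times> (nat \<Rightarrow> 'b)) set" where
  "histories i = tuples i A \<times> tuples i B"

definition decode :: "nat \<Rightarrow> nat \<Rightarrow> (nat \<Rightarrow> 'a) \<times> (nat \<Rightarrow> 'b)" where
  "decode i = (SOME f. bij_betw f {..<card (histories i)} (histories i))"

definition reply_prob :: "nat \<Rightarrow> (nat \<Rightarrow> 'a) \<Rightarrow> (nat \<Rightarrow> 'b) \<Rightarrow> real" where
  "reply_prob i x y = (\<Prod>j\<in>{1..i}. q j (restrict x {1..j}) (restrict y {1..j}))"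

definition reply_kraus :: "nat \<Rightarrow> 'b \<times> nat \<Rightarrow> 'a \<times> nat \<Rightarrow> complex" where
  "reply_kraus i = (\<lambda>(b, w') (u, w).
     if decode i w' = ((fst (decode (i - 1) w))(i := u), (snd (decode (i - 1) w))(i := b))
     then complex_of_real (sqrt (q i (fst (decode i w')) (snd (decode i w')))) else 0)"

definition reply_marginal :: "bit \<Rightarrow> (nat \<Rightarrow> 'b) \<Rightarrow> real" where
  "reply_marginal a y = (\<Sum>x\<in>tuples n A. \<alpha> a x * reply_prob n x y)"

text \<open>
  The useful branch of Bob's last operation: conditioned on \<open>a\<close> and \<open>y'\<close> it projects the two
  copies of \<open>x\<close> onto the state in which Bob holds them, the one with amplitudes proportional to
  \<open>\<surd>(\<alpha>\<^bsub>a,x\<^esub> p(y' | x))\<close>, and replaces them by \<open>b = a + c\<close> and \<open>y'\<close>.  If \<open>reply_marginal a y'\<close> is 0,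
  the division makes the matrix entry 0, too.
\<close>

definition reveal_kraus :: "bit \<times> (nat \<Rightarrow> 'b) \<times> nat \<Rightarrow> bit \<times> (nat \<Rightarrow> 'a) \<times> nat \<Rightarrow> complex" where
  "reveal_kraus = (\<lambda>(b, y', w') (a, x, w).
     if b = a + c \<and> decode n w = (x, y')
     then complex_of_real (sqrt (\<alpha> a x * reply_prob n x y') / sqrt (reply_marginal a y')) else 0)"

text \<open>
  The joint state after \<open>i\<close> coherent replies is pure; these are its amplitudes.
\<close>

definition amplitude :: "nat \<Rightarrow> ('a, 'b) alice_index \<times> nat \<Rightarrow> complex" where
  "amplitude i = (\<lambda>((a, a', x, x', y), w).
     if a = a' \<and> x = restrict x' {Suc i..n} \<and> decode i w = (restrict x' {1..i}, y)
     then complex_of_real (sqrt (\<alpha> a x' * reply_prob i x' y) / sqrt 2) else 0)"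

lemma finA: "i \<le> n \<Longrightarrow> finite (tuples i A)" and finB: "i \<le> n \<Longrightarrow> finite (tuples i B)"
  using fin by (auto intro!: finite_PiE)

lemma finite_histories: "i \<le> n \<Longrightarrow> finite (histories i)"
  unfolding histories_def using finA finB by simp

lemma bij_decode: "i \<le> n \<Longrightarrow> bij_betw (decode i) {..<card (histories i)} (histories i)"
  unfolding decode_def using ex_bij_betw_nat_finite[OF finite_histories]
  by (metis (mono_tags, lifting) atLeast0LessThan someI_ex)

lemma sum_decode:
  assumes "i \<le> n" and "z \<in> histories i"
  shows "(\<Sum>w<card (histories i). if decode i w = z then v else 0) = v"
  using sum.reindex_bij_betw[OF bij_decode[OF assms(1)], of "\<lambda>z'. if z' = z then v else 0"]
    finite_histories[OF assms(1)] assms(2) by simp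

lemma decode_inj: "i \<le> n \<Longrightarrow> w < card (histories i) \<Longrightarrow> w' < card (histories i) \<Longrightarrow> decode i w = decode i w' \<longleftrightarrow> w = w'"
  using bij_betw_imp_inj_on[OF bij_decode] by (auto simp: inj_on_def)

lemma decode_mem: "i \<le> n \<Longrightarrow> w < card (histories i) \<Longrightarrow> decode i w \<in> histories i"
  using bij_betwE[OF bij_decode] by auto

lemma tuples_restrict: "x \<in> tuples n X \<Longrightarrow> i \<le> n \<Longrightarrow> restrict x {1..i} \<in> tuples i X"
  by (auto simp: PiE_iff)

lemma tuples_upd: "x \<in> tuples (i - 1) X \<Longrightarrow> 1 \<le> i \<Longrightarrow> u \<in> X i \<Longrightarrow> x(i := u) \<in> tuples i X"
  by (auto simp: PiE_iff extensional_def)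

lemma tuples_upd_eq:
  assumes "x \<in> tuples (i - 1) X" "x' \<in> tuples (i - 1) X" "1 \<le> i"
  shows "x(i := u) = x'(i := u') \<longleftrightarrow> x = x' \<and> u = u'"
proof
  assume e: "x(i := u) = x'(i := u')"
  have "x j = x' j" for j
  proof (cases "j = i")
    case True
    thus ?thesis using assms by (auto simp: PiE_iff extensional_def)
  next
    case False thus ?thesis using fun_cong[OF e, of j] by simp
  qed
  thus "x = x' \<and> u = u'" using fun_cong[OF e, of i] by auto
qed simp

lemma reply_prob_nonneg: "x \<in> tuples n A \<Longrightarrow> y \<in> tuples n B \<Longrightarrow> i \<le> n \<Longrightarrow> 0 \<le> reply_prob i x y"
  unfolding reply_prob_def by (intro prod_nonneg ballI q_nonneg tuples_restrict) auto

text \<open>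
  The reply is an isometry: Bob keeps a record of what he received, so distinct basis states stay
  orthogonal, and the probabilities \<open>q\<close> of the replies sum to 1.
\<close>

lemma reply_kraus_quantum_operation:
  assumes i: "i \<in> {1..n}"
  shows "quantum_operation (A i \<times> {..<card (histories (i - 1))}) (B i \<times> {..<card (histories i)}) [reply_kraus i]"
  unfolding quantum_operation_def
proof (intro ballI)
  fix s s2 assume s: "s \<in> A i \<times> {..<card (histories (i - 1))}" and s2: "s2 \<in> A i \<times> {..<card (histories (i - 1))}"
  obtain u w where uw: "s = (u, w)" by (cases s)
  obtain u2 w2 where uw2: "s2 = (u2, w2)" by (cases s2)
  have i': "1 \<le> i" "i \<le> n" "i - 1 \<le> n" using i by auto
  obtain h k where hk: "decode (i - 1) w = (h, k)" by (cases "decode (i - 1) w")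
  obtain h2 k2 where hk2: "decode (i - 1) w2 = (h2, k2)" by (cases "decode (i - 1) w2")
  have mem: "h \<in> tuples (i - 1) A" "k \<in> tuples (i - 1) B" "h2 \<in> tuples (i - 1) A" "k2 \<in> tuples (i - 1) B"
      "u \<in> A i" "u2 \<in> A i"
    using decode_mem[OF i'(3), of w] decode_mem[OF i'(3), of w2] s s2 hk hk2 uw uw2 by (auto simp: histories_def)
  have fB: "finite (B i)" using fin i by auto
  have eq: "s = s2 \<longleftrightarrow> h = h2 \<and> k = k2 \<and> u = u2"
    using decode_inj[OF i'(3), of w w2] s s2 hk hk2 uw uw2 by auto
  define X where "X b = (h(i := u), k(i := b))" for b
  define X2 where "X2 b = (h2(i := u2), k2(i := b))" for b
  have X: "X b \<in> histories i" if "b \<in> B i" for b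
    unfolding X_def histories_def using tuples_upd[OF mem(1) i'(1) mem(5)] tuples_upd[where X = B, OF mem(2) i'(1) that] by blast
  have K: "reply_kraus i (b, w') s = (if decode i w' = X b then complex_of_real (sqrt (q i (fst (X b)) (snd (X b)))) else 0)"
          "reply_kraus i (b, w') s2 = (if decode i w' = X2 b then complex_of_real (sqrt (q i (fst (X2 b)) (snd (X2 b)))) else 0)" for b w'
    by (simp_all only: reply_kraus_def uw uw2 hk hk2 split fst_conv snd_conv X_def X2_def cong: if_cong)
  have "(\<Sum>j\<in>B i \<times> {..<card (histories i)}. cnj (reply_kraus i j s) * reply_kraus i j s2)
      = (\<Sum>b\<in>B i. \<Sum>w'<card (histories i). if decode i w' = X b then
          (if X b = X2 b then complex_of_real (q i (fst (X b)) (snd (X b))) else 0) else 0)"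
    unfolding sum.cartesian_product'
  proof (intro sum.cong refl, goal_cases)
    case (1 b w')
    have "0 \<le> q i (fst (X b)) (snd (X b))"
      using X[of b] 1 i by (intro q_nonneg) (auto simp: histories_def mem_Times_iff)
    thus ?case by (cases "decode i w' = X b"; cases "X b = X2 b") (simp_all add: K flip: of_real_mult)
  qed
  also have "\<dots> = (\<Sum>b\<in>B i. if X b = X2 b then complex_of_real (q i (fst (X b)) (snd (X b))) else 0)"
    by (intro sum.cong refl sum_decode[OF i'(2)] X)
  also have "\<dots> = (if s = s2 then complex_of_real (\<Sum>b\<in>B i. q i (h(i := u)) (k(i := b))) else 0)"
    unfolding eq X_def X2_def prod.inject tuples_upd_eq[OF mem(1,3) i'(1)] tuples_upd_eq[OF mem(2,4) i'(1)] by auto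
  also have "\<dots> = (if s = s2 then 1 else 0)"
    using q_sum[OF i tuples_upd[OF mem(1) i'(1) mem(5)] mem(2)] by simp
  finally show "(\<Sum>E\<leftarrow>[reply_kraus i]. \<Sum>j\<in>B i \<times> {..<card (histories i)}. cnj (E j s) * E j s2) = (if s = s2 then 1 else 0)"
    by simp
qed

text \<open>
  Rows for different \<open>(b, y')\<close> have disjoint supports, and each row is the normalization of the vector
  with entries \<open>\<surd>(\<alpha>\<^bsub>a,x\<^esub> p(y' | x))\<close>, or 0 if that vector is 0.
\<close>

lemma reveal_kraus_rows:
  assumes "j \<in> UNIV \<times> tuples n B \<times> {..<Suc 0}" "j' \<in> UNIV \<times> tuples n B \<times> {..<Suc 0}"
  shows "(\<Sum>k\<in>UNIV \<times> tuples n A \<times> {..<card (histories n)}. reveal_kraus j k * cnj (reveal_kraus j' k)) * reveal_kraus j' i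
    = (if j = j' then reveal_kraus j i else 0)"
proof -
  obtain b y b' y' where j: "j = (b, y, 0)" "j' = (b', y', 0)" and y: "y \<in> tuples n B" "y' \<in> tuples n B"
    using assms by (cases j; cases j') auto
  have "(\<Sum>k\<in>UNIV \<times> tuples n A \<times> {..<card (histories n)}. reveal_kraus j k * cnj (reveal_kraus j' k))
      = (\<Sum>a\<in>UNIV. \<Sum>x\<in>tuples n A. \<Sum>w<card (histories n). if decode n w = (x, y) then
         if b = a + c \<and> b' = a + c \<and> y' = y then complex_of_real (\<alpha> a x * reply_prob n x y / reply_marginal a y) else 0 else 0)"
    unfolding sum.cartesian_product' j
  proof (intro sum.cong refl, goal_cases)
    case (1 a x w)
    have "0 \<le> \<alpha> a x * reply_prob n x y" if "x \<in> tuples n A" "y \<in> tuples n B" for x y a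
      using weights_nonneg(1) reply_prob_nonneg that by (intro mult_nonneg_nonneg) auto
    moreover hence "0 \<le> reply_marginal a y" for a unfolding reply_marginal_def using y by (intro sum_nonneg) auto
    ultimately show ?case using y 1 by (auto simp: reveal_kraus_def simp flip: of_real_mult)
  qed
  also have "\<dots> = (\<Sum>a\<in>UNIV. \<Sum>x\<in>tuples n A. if b = a + c \<and> b' = a + c \<and> y' = y then complex_of_real (\<alpha> a x * reply_prob n x y / reply_marginal a y) else 0)"
    using y by (intro sum.cong refl sum_decode) (auto simp: histories_def)
  also have "\<dots> = (\<Sum>a\<in>UNIV. if a = b + c then if j = j' then complex_of_real (reply_marginal a y / reply_marginal a y) else 0 else 0)"
  proof (intro sum.cong refl)
    fix a
    have "b = a + c \<and> b' = a + c \<and> y' = y \<longleftrightarrow> a = b + c \<and> j = j'"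
      unfolding j bit_add_eq_iff[of a b] by blast
    moreover have "(\<Sum>x\<in>tuples n A. complex_of_real (\<alpha> a x * reply_prob n x y / reply_marginal a y))
        = complex_of_real (reply_marginal a y / reply_marginal a y)"
      by (simp only: reply_marginal_def sum_divide_distrib of_real_sum)
    ultimately show "(\<Sum>x\<in>tuples n A. if b = a + c \<and> b' = a + c \<and> y' = y then complex_of_real (\<alpha> a x * reply_prob n x y / reply_marginal a y) else 0)
       = (if a = b + c then if j = j' then complex_of_real (reply_marginal a y / reply_marginal a y) else 0 else 0)"
      by (cases "a = b + c"; cases "j = j'") (simp_all only: simp_thms if_True if_False sum.neutral_const)
  qed
  also have "\<dots> = (if j = j' then complex_of_real (reply_marginal (b + c) y / reply_marginal (b + c) y) else 0)"
    by simp
  finally have e: "(\<Sum>k\<in>UNIV \<times> tuples n A \<times> {..<card (histories n)}. reveal_kraus j k * cnj (reveal_kraus j' k))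
    = (if j = j' then complex_of_real (reply_marginal (b + c) y / reply_marginal (b + c) y) else 0)" .
  have "reveal_kraus j' i = 0" if "reply_marginal (b + c) y = 0" "j = j'"
    using that by (cases i) (auto simp: j reveal_kraus_def bit_add_eq_iff)
  thus ?thesis unfolding e by (cases "reply_marginal (b + c) y = 0") auto
qed

text \<open>
  Each operation so far has a single Kraus matrix, so it maps a pure state to a pure state.  In the
  step exactly one term of the sum over Bob's input survives: the message is the \<open>(i+1)\<close>-st component
  of Alice's second copy \<open>x'\<close>, and the record is the one fixed by \<open>x'\<close> and \<open>y\<close>.
\<close>

lemma joint_state_amplitude:
  fixes S :: "('a, 'b) bob_strategy"
  assumes W: "\<And>i. i \<le> n \<Longrightarrow> wdim S i = card (histories i)"
    and init: "init S = (\<lambda>_ _. 1)" and reply: "\<And>i. reply S i = [reply_kraus i]"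
    and "i \<le> n" "s \<in> alice_indices n A B i \<times> {..<card (histories i)}" "t \<in> alice_indices n A B i \<times> {..<card (histories i)}"
  shows "joint_state n A \<alpha> S i s t = amplitude i s * cnj (amplitude i t)"
  using assms(4-6)
proof (induction i arbitrary: s t)
  case 0
  have "decode 0 w = (\<lambda>_. undefined, \<lambda>_. undefined)" if "w < card (histories 0)" for w
    using decode_mem[OF _ that] by (auto simp: histories_def)
  moreover have "restrict x {Suc 0..n} = x" if "x \<in> tuples n A" for x
    using that by (auto simp: PiE_iff extensional_restrict)
  ultimately show ?case using 0
    by (auto simp: init amplitude_def alice_state_eq[OF finA[OF order_refl], unfolded One_nat_def] alice_indices_def
       reply_prob_def restrict_def)
next
  case (Suc i)
  have i: "i < n" "Suc i \<in> {1..n}" using Suc.prems by auto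
  define I where "I = A (Suc i) \<times> {..<card (histories i)}"
  define E where "E = reply_kraus (Suc i)"
  have step: "(\<Sum>k\<in>I. E (snd (reply_index (Suc i) s)) k * amplitude i (send_index (Suc i) (fst (reply_index (Suc i) s), k)))
      = amplitude (Suc i) s" if s: "s \<in> alice_indices n A B (Suc i) \<times> {..<card (histories (Suc i))}" for s
  proof -
    obtain a a' x x' y w' where sd: "s = ((a, a', x, x', y), w')" by (metis prod.exhaust)
    have mem: "x \<in> PiE {Suc (Suc i)..n} A" "x' \<in> tuples n A" "y \<in> tuples (Suc i) B" "w' < card (histories (Suc i))"
      using s by (auto simp: sd alice_indices_def)
    define y0 where "y0 = y(Suc i := undefined)"
    have y0: "y0 \<in> tuples i B" using mem(3) by (auto simp: y0_def PiE_iff extensional_def)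
    define H0 where "H0 = restrict x' {1..i}"
    define H1 where "H1 = restrict x' {1..Suc i}"
    define K where "K = complex_of_real (sqrt (q (Suc i) H1 y) * (sqrt (\<alpha> a x' * reply_prob i x' y) / sqrt 2))"
    have yy: "y0(Suc i := y (Suc i)) = y" by (simp add: y0_def)
    have xx: "H0(Suc i := x' (Suc i)) = H1"
      by (auto simp: H0_def H1_def restrict_def fun_eq_iff)
    have rp: "reply_prob i x' y0 = reply_prob i x' y"
      unfolding reply_prob_def y0_def by (intro prod.cong refl arg_cong[of _ _ "q _ _"]) (auto simp: restrict_def)
    have xu: "x(Suc i := u) = restrict x' {Suc i..n} \<longleftrightarrow> x = restrict x' {Suc (Suc i)..n} \<and> u = x' (Suc i)" for u
    proof
      assume e: "x(Suc i := u) = restrict x' {Suc i..n}"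
      have "u = x' (Suc i)" using fun_cong[OF e, of "Suc i"] i by simp
      moreover have "x j = restrict x' {Suc (Suc i)..n} j" for j
        using fun_cong[OF e, of j] mem(1) by (cases "j = Suc i") (auto simp: PiE_iff extensional_def restrict_def)
      ultimately show "x = restrict x' {Suc (Suc i)..n} \<and> u = x' (Suc i)" by auto
    qed (use i in \<open>auto simp: restrict_def fun_eq_iff\<close>)
    have "(\<Sum>k\<in>I. E (snd (reply_index (Suc i) s)) k * amplitude i (send_index (Suc i) (fst (reply_index (Suc i) s), k)))
      = (\<Sum>u\<in>A (Suc i). \<Sum>w<card (histories i). if decode i w = (H0, y0) then 
           if u = x' (Suc i) then if a = a' \<and> x = restrict x' {Suc (Suc i)..n} \<and> decode (Suc i) w' = (H1, y) then K else 0 else 0 else 0)"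
      unfolding I_def sum.cartesian_product'
    proof (intro sum.cong refl, goal_cases)
      case (1 u w)
      show ?case
        by (simp only: sd reply_index_def send_index_def split snd_conv fst_conv E_def reply_kraus_def
          amplitude_def diff_Suc_1 y0_def[symmetric] xu rp K_def H0_def[symmetric])
          (auto simp: xx yy simp flip: of_real_mult)
    qed
    also have "\<dots> = (\<Sum>u\<in>A (Suc i). if u = x' (Suc i) then if a = a' \<and> x = restrict x' {Suc (Suc i)..n} \<and> decode (Suc i) w' = (H1, y) then K else 0 else 0)"
      using y0 H0_def tuples_restrict[OF mem(2) less_imp_le[OF i(1)]] i(1)
      by (intro sum.cong refl sum_decode) (simp_all add: histories_def)
    also have "\<dots> = (if a = a' \<and> x = restrict x' {Suc (Suc i)..n} \<and> decode (Suc i) w' = (H1, y) then K else 0)"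
    proof -
      have "x' (Suc i) \<in> A (Suc i)" "finite (A (Suc i))" using mem(2) i fin by (auto simp: PiE_iff)
      thus ?thesis by simp
    qed
    also have "\<dots> = amplitude (Suc i) s"
    proof -
      have "restrict y {1..Suc i} = y" using mem(3) by (auto simp: PiE_iff extensional_restrict)
      hence "reply_prob (Suc i) x' y = reply_prob i x' y * q (Suc i) (H1) y"
        by (simp add: reply_prob_def H1_def)
      thus ?thesis by (simp add: amplitude_def sd K_def real_sqrt_mult H1_def)
    qed
    finally show ?thesis .
  qed
  have mem: "send_index (Suc i) (fst (reply_index (Suc i) s), k) \<in> alice_indices n A B i \<times> {..<card (histories i)}"
    if "s \<in> alice_indices n A B (Suc i) \<times> {..<card (histories (Suc i))}" "k \<in> I" for s k
  proof -
    have "reply_index (Suc i) s \<in> sent_indices n A B i \<times> (B (Suc i) \<times> {..<card (histories (Suc i))})"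
      using bij_betwE[OF bij_betw_reply_index, rule_format, OF that(1)] .
    hence "(fst (reply_index (Suc i) s), k) \<in> sent_indices n A B i \<times> (A (Suc i) \<times> {..<card (histories i)})"
      using that(2) by (simp only: mem_Times_iff fst_conv snd_conv I_def)
    thus ?thesis by (rule bij_betwE[OF bij_betw_send_index[OF i(1)], rule_format])
  qed
  have "joint_state n A \<alpha> S (Suc i) s t = 
      (\<Sum>k\<in>I. \<Sum>k'\<in>I. E (snd (reply_index (Suc i) s)) k * 
         (amplitude i (send_index (Suc i) (fst (reply_index (Suc i) s), k)) * cnj (amplitude i (send_index (Suc i) (fst (reply_index (Suc i) t), k'))))
         * cnj (E (snd (reply_index (Suc i) t)) k'))"
    using Suc.prems(1) W[of i]
    by (simp add: reindex_def apply_second_def split_def reply E_def I_def Suc.IH mem[unfolded I_def] Suc.prems(2,3) cong: sum.cong)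
  also have "\<dots> = amplitude (Suc i) s * cnj (amplitude (Suc i) t)"
    unfolding step[OF Suc.prems(2), symmetric] step[OF Suc.prems(3), symmetric] cnj_sum sum_product
    by (simp add: mult_ac)
  finally show ?case .
qed

text \<open>
  \<open>\<Phi> E\<close> is the unnormalized final state in the branch of the Kraus matrix \<open>E\<close>, and \<open>G E b\<close> its overlap with
  \<open>e\<^bsub>b+c\<^esub> \<otimes> e\<^sub>b \<otimes> \<phi>\<^sub>b\<close>.  Every branch contributes a nonnegative probability, so that it suffices to
  compute the contribution of \<open>reveal_kraus\<close>, where \<open>\<Phi>\<close> has the amplitudes \<open>\<surd>(r\<^bsub>b+c\<^esub>(y) / 2)\<close>.
\<close>

theorem P_Bob_ge_controlled_replies:
  "P_Bob n A B \<alpha> \<beta> c \<ge> 1/2 * (\<Sum>a\<in>{0,1}. fidelity (tuples n B)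
      (\<lambda>y. \<Sum>x\<in>tuples n A. \<alpha> a x *
         (\<Prod>j\<in>{1..n}. q j (restrict x {1..j}) (restrict y {1..j}))) (\<beta> (a + c)))"
proof -
  define T where "T = tuples n B"
  have fT: "finite T" using finB by (simp add: T_def)
  have "T \<noteq> {}" using \<beta> by (auto simp: T_def prob_vec_def)
  then obtain y0 where y0: "y0 \<in> T" by blast
  obtain Es where Es: "quantum_operation (UNIV \<times> tuples n A \<times> {..<card (histories n)})
       (UNIV \<times> tuples n B \<times> {..<Suc 0}) (reveal_kraus # Es)"
  proof (rule quantum_operation_complete)
    show "finite (UNIV \<times> tuples n A \<times> {..<card (histories n)} :: (bit \<times> (nat \<Rightarrow> 'a) \<times> nat) set)" using finA by simp
    show "finite (UNIV \<times> tuples n B \<times> {..<Suc 0} :: (bit \<times> (nat \<Rightarrow> 'b) \<times> nat) set)" using finB by simp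
    show "(0, y0, 0) \<in> UNIV \<times> tuples n B \<times> {..<Suc 0}" using y0 by (simp add: T_def)
  qed (rule reveal_kraus_rows)
  define S :: "('a, 'b) bob_strategy" where
    "S = \<lparr>wdim = (\<lambda>i. if i \<le> n then card (histories i) else 1), init = (\<lambda>_ _. 1),
      reply = (\<lambda>i. [reply_kraus i]), reveal = reveal_kraus # Es\<rparr>"
  have W: "wdim S i = card (histories i)" if "i \<le> n" for i using that by (simp add: S_def)
  have "histories 0 = {(\<lambda>_. undefined, \<lambda>_. undefined)}" by (simp add: histories_def)
  hence W0: "wdim S 0 = Suc 0" by (simp add: S_def)
  have valid: "valid_strategy n A B S"
    unfolding valid_strategy_def
  proof (intro conjI ballI)
    show "density_operator {..<wdim S 0} (init S)"
      unfolding W0 density_operator_def by (simp add: S_def Let_def)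
    show "quantum_operation (A i \<times> {..<wdim S (i - 1)}) (B i \<times> {..<wdim S i}) (reply S i)" if "i \<in> {1..n}" for i
    proof -
      have "i - 1 \<le> n" using that by auto
      thus ?thesis using reply_kraus_quantum_operation[OF that] that W by (simp add: S_def)
    qed
    show "quantum_operation (UNIV \<times> tuples n A \<times> {..<wdim S n})
       (UNIV \<times> tuples n B \<times> {..<wdim S (n + 1)}) (reveal S)" using Es by (simp add: S_def)
  qed
  define I where "I = (UNIV :: bit set) \<times> tuples n A \<times> {..<card (histories n)}"
  define \<Phi> where "\<Phi> E s = (\<Sum>k\<in>I. E (snd s) k * amplitude n (reveal_index (fst s, k)))" 
    for E and s :: "(bit \<times> (nat \<Rightarrow> 'b)) \<times> bit \<times> (nat \<Rightarrow> 'b) \<times> nat"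
  have final: "final_state n A \<alpha> S s t = (\<Sum>E\<leftarrow>reveal_kraus # Es. \<Phi> E s * cnj (\<Phi> E t))"
    if s: "snd (fst s) \<in> T" "snd (fst t) \<in> T" for s t
  proof -
    have mem: "reveal_index (fst s, k) \<in> alice_indices n A B n \<times> {..<card (histories n)}"
      if "snd (fst s) \<in> T" "k \<in> I" for s :: "(bit \<times> (nat \<Rightarrow> 'b)) \<times> bit \<times> (nat \<Rightarrow> 'b) \<times> nat" and k
      using bij_betwE[OF bij_betw_reveal_index, of n B A "{..<card (histories n)}"] that unfolding I_def T_def
      by (cases s) (auto simp del: One_nat_def)
    have "final_state n A \<alpha> S s t = (\<Sum>E\<leftarrow>reveal_kraus # Es. \<Sum>k\<in>I. \<Sum>k'\<in>I. 
       E (snd s) k * joint_state n A \<alpha> S n (reveal_index (fst s, k)) (reveal_index (fst t, k')) * cnj (E (snd t) k'))"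
      by (simp add: final_state_def apply_second_def split_def reindex_def I_def W) (simp add: S_def)
    also have "\<dots> = (\<Sum>E\<leftarrow>reveal_kraus # Es. \<Sum>k\<in>I. \<Sum>k'\<in>I. 
       E (snd s) k * (amplitude n (reveal_index (fst s, k)) * cnj (amplitude n (reveal_index (fst t, k')))) * cnj (E (snd t) k'))"
    proof -
      have "joint_state n A \<alpha> S n (reveal_index (fst s, k)) (reveal_index (fst t, k'))
        = amplitude n (reveal_index (fst s, k)) * cnj (amplitude n (reveal_index (fst t, k')))"
        if "k \<in> I" "k' \<in> I" for k k'
        by (rule joint_state_amplitude) (use W mem that s in \<open>auto simp: S_def\<close>)
      thus ?thesis by (simp cong: sum.cong)
    qed
    also have "\<dots> = (\<Sum>E\<leftarrow>reveal_kraus # Es. \<Phi> E s * cnj (\<Phi> E t))"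
      unfolding \<Phi>_def cnj_sum sum_product by (simp add: mult_ac)
    finally show ?thesis .
  qed
  have \<Phi>: "\<Phi> reveal_kraus ((b + c, y), (b, y, 0)) = complex_of_real (sqrt (reply_marginal (b + c) y) / sqrt 2)"
    if y: "y \<in> T" for b y
  proof -
    define r where "r = reply_marginal (b + c) y"
    have nn: "0 \<le> \<alpha> (b + c) x * reply_prob n x y" if "x \<in> tuples n A" for x
      using weights_nonneg(1) reply_prob_nonneg that y by (auto simp: T_def)
    have r0: "0 \<le> r" unfolding r_def reply_marginal_def using nn by (intro sum_nonneg) auto
    have "\<Phi> reveal_kraus ((b + c, y), (b, y, 0)) = (\<Sum>a\<in>UNIV. \<Sum>x\<in>tuples n A. \<Sum>w<card (histories n). 
       if decode n w = (x, y) then if a = b + c then complex_of_real (\<alpha> (b + c) x * reply_prob n x y / sqrt r / sqrt 2) else 0 else 0)"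
      unfolding \<Phi>_def I_def sum.cartesian_product'
    proof (intro sum.cong refl, goal_cases)
      case (1 a x w)
      have "restrict x {1..n} = x" using 1 by (auto simp: PiE_iff extensional_restrict)
      moreover have "restrict x {Suc n..n} = (\<lambda>_. undefined)" by (simp add: restrict_def)
      ultimately show ?case using nn[of x] 1
        by (auto simp: reveal_kraus_def reveal_index_def amplitude_def r_def bit_add_eq_iff
          simp del: One_nat_def simp flip: of_real_mult)
    qed
    also have "\<dots> = (\<Sum>a\<in>UNIV. \<Sum>x\<in>tuples n A. if a = b + c then complex_of_real (\<alpha> (b + c) x * reply_prob n x y / sqrt r / sqrt 2) else 0)"
      using y by (intro sum.cong refl sum_decode) (auto simp: histories_def T_def)
    also have "\<dots> = (\<Sum>x\<in>tuples n A. complex_of_real (\<alpha> (b + c) x * reply_prob n x y / sqrt r / sqrt 2))"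
      by (subst sum.swap) simp
    also have "\<dots> = complex_of_real (r / sqrt r / sqrt 2)"
      by (simp add: r_def reply_marginal_def sum_divide_distrib)
    also have "r / sqrt r = sqrt r" using r0 by (simp add: real_div_sqrt)
    finally show ?thesis unfolding r_def .
  qed
  define G where "G E b w = (\<Sum>y\<in>T. complex_of_real (sqrt (\<beta> b y)) * \<Phi> E ((b + c, y), (b, y, w)))" for E b w
  have "alice_outputs_prob n A B \<alpha> \<beta> c S = Re (\<Sum>b\<in>UNIV. \<Sum>y\<in>T. \<Sum>y2\<in>T.
      complex_of_real (sqrt (\<beta> b y) * sqrt (\<beta> b y2)) *
        final_state n A \<alpha> S ((b + c, y2), (b, y2, 0)) ((b + c, y), (b, y, 0)))"
    using alice_outputs_prob_eq[of n B A \<alpha> \<beta> c S] fT by (simp add: T_def S_def)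
  also have "(\<Sum>b\<in>UNIV. \<Sum>y\<in>T. \<Sum>y2\<in>T.
      complex_of_real (sqrt (\<beta> b y) * sqrt (\<beta> b y2)) *
        final_state n A \<alpha> S ((b + c, y2), (b, y2, 0)) ((b + c, y), (b, y, 0)))
     = (\<Sum>b\<in>UNIV. \<Sum>E\<leftarrow>reveal_kraus # Es. G E b 0 * cnj (G E b 0))"
  proof (intro sum.cong refl)
    fix b
    have "(\<Sum>y\<in>T. \<Sum>y2\<in>T. complex_of_real (sqrt (\<beta> b y) * sqrt (\<beta> b y2)) *
        final_state n A \<alpha> S ((b + c, y2), (b, y2, 0)) ((b + c, y), (b, y, 0)))
      = (\<Sum>y\<in>T. \<Sum>y2\<in>T. \<Sum>E\<leftarrow>reveal_kraus # Es. complex_of_real (sqrt (\<beta> b y) * sqrt (\<beta> b y2)) *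
        (\<Phi> E ((b + c, y2), (b, y2, 0)) * cnj (\<Phi> E ((b + c, y), (b, y, 0)))))"
      by (intro sum.cong refl) (simp only: final fst_conv snd_conv sum_list_const_mult)
    also have "\<dots> = (\<Sum>E\<leftarrow>reveal_kraus # Es. \<Sum>y\<in>T. \<Sum>y2\<in>T. complex_of_real (sqrt (\<beta> b y) * sqrt (\<beta> b y2)) *
        (\<Phi> E ((b + c, y2), (b, y2, 0)) * cnj (\<Phi> E ((b + c, y), (b, y, 0)))))"
      by (simp only: sum_sum_list_swap)
    also have "\<dots> = (\<Sum>E\<leftarrow>reveal_kraus # Es. G E b 0 * cnj (G E b 0))"
    proof -
      have "(\<Sum>y\<in>T. \<Sum>y2\<in>T. complex_of_real (sqrt (\<beta> b y) * sqrt (\<beta> b y2)) *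
        (\<Phi> E ((b + c, y2), (b, y2, 0)) * cnj (\<Phi> E ((b + c, y), (b, y, 0))))) = G E b 0 * cnj (G E b 0)" for E
        unfolding G_def cnj_sum sum_product
        by (subst sum.swap) (intro sum.cong refl, simp add: mult_ac)
      thus ?thesis by simp
    qed
    finally show "(\<Sum>y\<in>T. \<Sum>y2\<in>T. complex_of_real (sqrt (\<beta> b y) * sqrt (\<beta> b y2)) *
        final_state n A \<alpha> S ((b + c, y2), (b, y2, 0)) ((b + c, y), (b, y, 0)))
      = (\<Sum>E\<leftarrow>reveal_kraus # Es. G E b 0 * cnj (G E b 0))" .
  qed
  also have "Re \<dots> = (\<Sum>b\<in>UNIV. Re (G reveal_kraus b 0 * cnj (G reveal_kraus b 0)) + Re (\<Sum>E\<leftarrow>Es. G E b 0 * cnj (G E b 0)))"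
    by simp
  finally have prob: "alice_outputs_prob n A B \<alpha> \<beta> c S = 
     (\<Sum>b\<in>UNIV. Re (G reveal_kraus b 0 * cnj (G reveal_kraus b 0)) + Re (\<Sum>E\<leftarrow>Es. G E b 0 * cnj (G E b 0)))" .
  have "1/2 * (\<Sum>a\<in>{0,1}. fidelity T (\<lambda>y. \<Sum>x\<in>tuples n A. \<alpha> a x * reply_prob n x y) (\<beta> (a + c)))
      = 1/2 * (\<Sum>a\<in>UNIV. fidelity T (reply_marginal a) (\<beta> (a + c)))"
    by (simp add: bit_UNIV reply_marginal_def[abs_def])
  also have "\<dots> = 1/2 * (\<Sum>b\<in>UNIV. fidelity T (reply_marginal (b + c)) (\<beta> b))"
    by (rule arg_cong[of _ _ "\<lambda>x. 1/2 * x"], rule sum.reindex_bij_witness[of _ "\<lambda>b. b + c" "\<lambda>b. b + c"]) auto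
  also have "\<dots> = (\<Sum>b\<in>UNIV. Re (G reveal_kraus b 0 * cnj (G reveal_kraus b 0)))"
    unfolding sum_distrib_left
  proof (intro sum.cong refl)
    fix b
    have "G reveal_kraus b 0 = complex_of_real ((\<Sum>y\<in>T. sqrt (reply_marginal (b + c) y) * sqrt (\<beta> b y)) / sqrt 2)"
      unfolding G_def sum_divide_distrib of_real_sum
      by (intro sum.cong refl) (simp only: \<Phi> of_real_mult of_real_divide times_divide_eq_right mult.commute)
    thus "1/2 * fidelity T (reply_marginal (b + c)) (\<beta> b) = Re (G reveal_kraus b 0 * cnj (G reveal_kraus b 0))"
      by (simp add: fidelity_def power2_eq_square)
  qed
  also have "\<dots> \<le> alice_outputs_prob n A B \<alpha> \<beta> c S"
    unfolding prob
  proof (intro sum_mono)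
    fix b
    have "(\<Sum>E\<leftarrow>Es. G E b 0 * cnj (G E b 0)) \<in> \<real>\<^sub>\<ge>\<^sub>0"
      by (intro sum_list_nonneg_Reals) (auto simp: complex_nonneg_Reals_iff)
    thus "Re (G reveal_kraus b 0 * cnj (G reveal_kraus b 0)) \<le> Re (G reveal_kraus b 0 * cnj (G reveal_kraus b 0)) + Re (\<Sum>E\<leftarrow>Es. G E b 0 * cnj (G E b 0))"
      by (simp add: complex_nonneg_Reals_iff)
  qed
  also have "\<dots> \<le> P_Bob n A B \<alpha> \<beta> c" by (rule alice_outputs_prob_le_P_Bob[OF fin \<alpha> \<beta> valid])
  finally show ?thesis unfolding T_def reply_prob_def .
qed

end

section \<open>Joint distributions as successive replies\<close>

lemma tuples_nonempty_component:
  assumes "tuples n X \<noteq> {}" "i \<in> {1..n}"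
  shows "X i \<noteq> {}"
  using assms by (auto simp: PiE_eq_empty_iff)

definition marginal :: "nat \<Rightarrow> (nat \<Rightarrow> 'b set) \<Rightarrow> ((nat \<Rightarrow> 'b) \<Rightarrow> real) \<Rightarrow> nat \<Rightarrow> (nat \<Rightarrow> 'b) \<Rightarrow> real" where
  "marginal n B w i y = (\<Sum>z | z \<in> tuples n B \<and> restrict z {1..i} = restrict y {1..i}. w z)"

text \<open>
  The conditional probability of \<open>y i\<close> given \<open>y 1, \<dots>, y (i - 1)\<close>.  It is uniform where the condition has
  probability 0, since Bob's reply must be a distribution after every history.
\<close>

definition conditional :: "nat \<Rightarrow> (nat \<Rightarrow> 'b set) \<Rightarrow> ((nat \<Rightarrow> 'b) \<Rightarrow> real) \<Rightarrow> nat \<Rightarrow> (nat \<Rightarrow> 'b) \<Rightarrow> real" where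
  "conditional n B w i y = (if marginal n B w (i - 1) y = 0 then 1 / real (card (B i))
     else marginal n B w i y / marginal n B w (i - 1) y)"

lemma marginal_restrict: "i \<le> j \<Longrightarrow> marginal n B w i (restrict y {1..j}) = marginal n B w i y"
proof -
  assume "i \<le> j"
  hence "{1..j} \<inter> {1..i} = {1..i}" by auto
  thus ?thesis by (simp only: marginal_def restrict_restrict)
qed

lemma marginal_upd: "marginal n B w (i - 1) (y(i := b)) = marginal n B w (i - 1) y"
proof -
  have "restrict (y(i := b)) {1..i - 1} = restrict y {1..i - 1}"
    by (auto simp: restrict_def fun_eq_iff)
  thus ?thesis by (simp only: marginal_def)
qed

lemma marginal_nonneg: "prob_vec (tuples n B) w \<Longrightarrow> 0 \<le> marginal n B w i y"
  unfolding marginal_def prob_vec_def by (intro sum_nonneg) auto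

lemma restrict_upd_eq_iff:
  fixes y z :: "nat \<Rightarrow> 'b"
  assumes "1 \<le> i"
  shows "restrict z {1..i} = restrict (y(i := b)) {1..i} \<longleftrightarrow>
     restrict z {1..i - 1} = restrict y {1..i - 1} \<and> z i = b"
proof -
  have eq: "restrict f I = restrict g I \<longleftrightarrow> (\<forall>j\<in>I. f j = g j)" for f g :: "nat \<Rightarrow> 'b" and I
    by (auto simp: fun_eq_iff restrict_def)
  have "{1..i} = insert i {1..i - 1}" and "i \<notin> {1..i - 1}" using assms by auto
  thus ?thesis unfolding eq by auto
qed

lemma sum_marginal:
  assumes fin: "\<forall>i\<in>{1..n}. finite (B i)" and i: "i \<in> {1..n}"
  shows "(\<Sum>b\<in>B i. marginal n B w i (y(i := b))) = marginal n B w (i - 1) y"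
proof -
  define Z where "Z = {z. z \<in> tuples n B \<and> restrict z {1..i - 1} = restrict y {1..i - 1}}"
  have "finite (tuples n B)" using fin by (intro finite_PiE) auto
  hence "finite Z" by (simp add: Z_def)
  moreover have "(\<lambda>z. z i) ` Z \<subseteq> B i" using i by (auto simp: Z_def PiE_iff)
  ultimately have "(\<Sum>b\<in>B i. sum w {z \<in> Z. z i = b}) = sum w Z"
    using fin i by (intro sum.group) auto
  moreover have "{z \<in> Z. z i = b} = {z. z \<in> tuples n B \<and> restrict z {1..i} = restrict (y(i := b)) {1..i}}" for b
    using restrict_upd_eq_iff[of i _ y b] i unfolding Z_def by auto
  ultimately show ?thesis by (simp only: marginal_def Z_def)
qed

lemma conditional_nonneg: "prob_vec (tuples n B) w \<Longrightarrow> 0 \<le> conditional n B w i y"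
  by (simp add: conditional_def marginal_nonneg)

lemma sum_conditional:
  assumes fin: "\<forall>i\<in>{1..n}. finite (B i)" and w: "prob_vec (tuples n B) w" and i: "i \<in> {1..n}"
  shows "(\<Sum>b\<in>B i. conditional n B w i (y(i := b))) = 1"
proof (cases "marginal n B w (i - 1) y = 0")
  case True
  have "tuples n B \<noteq> {}" using w by (auto simp: prob_vec_def)
  hence "B i \<noteq> {}" "finite (B i)" using i fin tuples_nonempty_component[of n B i] by auto
  thus ?thesis using True unfolding conditional_def marginal_upd by simp
next
  case False
  thus ?thesis using sum_marginal[OF fin i, of w y]
    unfolding conditional_def marginal_upd by (simp flip: sum_divide_distrib)
qed

text \<open>
  The chain rule.  The value of \<open>conditional\<close> on null events is harmless: the product has already
  dropped to 0 there, as has the marginal.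
\<close>

lemma prod_conditional:
  assumes fin: "\<forall>i\<in>{1..n}. finite (B i)" and w: "prob_vec (tuples n B) w"
    and y: "y \<in> tuples n B"
  shows "(\<Prod>j\<in>{1..n}. conditional n B w j (restrict y {1..j})) = w y"
proof -
  have "(\<Prod>j\<in>{1..i}. conditional n B w j (restrict y {1..j})) = marginal n B w i y" if "i \<le> n" for i
    using that
  proof (induction i)
    case 0
    show ?case using w by (simp add: marginal_def prob_vec_def restrict_def)
  next
    case (Suc i)
    have c: "conditional n B w (Suc i) (restrict y {1..Suc i}) = conditional n B w (Suc i) y"
      using marginal_restrict[of i "Suc i" n B w y] marginal_restrict[of "Suc i" "Suc i" n B w y]
      by (simp only: conditional_def diff_Suc_1 le_refl le_SucI simp_thms)
    have "marginal n B w (Suc i) y = 0" if "marginal n B w i y = 0"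
    proof -
      have "marginal n B w (Suc i) y = marginal n B w (Suc i) (y(Suc i := y (Suc i)))" by simp
      also have "\<dots> \<le> (\<Sum>b\<in>B (Suc i). marginal n B w (Suc i) (y(Suc i := b)))"
        using fin y Suc.prems by (intro member_le_sum marginal_nonneg[OF w]) (auto simp: PiE_iff)
      also have "\<dots> = 0" using sum_marginal[OF fin, of "Suc i" w y] that Suc.prems by simp
      finally show ?thesis using marginal_nonneg[OF w, of "Suc i" y] by linarith
    qed
    hence m: "marginal n B w i y * conditional n B w (Suc i) y = marginal n B w (Suc i) y"
      by (auto simp: conditional_def)
    have "(\<Prod>j\<in>{1..Suc i}. conditional n B w j (restrict y {1..j}))
       = (\<Prod>j\<in>{1..i}. conditional n B w j (restrict y {1..j})) * conditional n B w (Suc i) (restrict y {1..Suc i})"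
      by (subst prod.cl_ivl_Suc) simp
    also have "\<dots> = marginal n B w (Suc i) y"
      unfolding c Suc.IH[OF Suc_leD[OF Suc.prems]] by (rule m)
    finally show ?case .
  qed
  moreover have "marginal n B w n y = w y"
  proof -
    have "restrict z {1..n} = z" if "z \<in> tuples n B" for z
      using that by (auto simp: PiE_iff extensional_restrict)
    hence "{z. z \<in> tuples n B \<and> restrict z {1..n} = restrict y {1..n}} = {y}" using y by auto
    thus ?thesis by (simp only: marginal_def) simp
  qed
  ultimately show ?thesis by simp
qed

section \<open>Partial traces and guessing the committed bit\<close>

text \<open>
  A sum over all coordinates in which only those in \<open>K\<close> matter to \<open>h\<close> is a sum over the marginal of \<open>f\<close>.
\<close>

lemma sum_partial_trace:
  assumes "J \<inter> K = {}"
  shows "(\<Sum>x\<in>PiE (J \<union> K) X. f x * h (restrict x K)) = (\<Sum>t\<in>PiE K X. partial_trace X J K f t * h t)"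
proof -
  have "(\<Sum>x\<in>PiE (J \<union> K) X. f x * h (restrict x K))
      = (\<Sum>(s, t)\<in>PiE J X \<times> PiE K X. f (merge J K (s, t)) * h t)"
  proof (rule sum.reindex_bij_witness[where i = "merge J K" and j = "\<lambda>x. (restrict x J, restrict x K)"])
    show "merge J K (restrict x J, restrict x K) = x" if "x \<in> PiE (J \<union> K) X" for x
      using that by (auto simp: merge_def PiE_iff extensional_def fun_eq_iff)
    show "(restrict (merge J K p) J, restrict (merge J K p) K) = p" if "p \<in> PiE J X \<times> PiE K X" for p
      using that assms by (cases p) (auto simp: merge_def PiE_iff extensional_def fun_eq_iff)
    show "merge J K p \<in> PiE (J \<union> K) X" if "p \<in> PiE J X \<times> PiE K X" for p
      using that assms by (cases p) (auto simp: merge_def PiE_iff extensional_def)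
    show "(case (restrict x J, restrict x K) of (s, t) \<Rightarrow> f (merge J K (s, t)) * h t) = f x * h (restrict x K)"
      if "x \<in> PiE (J \<union> K) X" for x
    proof -
      have "merge J K (restrict x J, restrict x K) = x"
        using that by (auto simp: merge_def PiE_iff extensional_def fun_eq_iff)
      thus ?thesis by simp
    qed
  qed auto
  also have "\<dots> = (\<Sum>t\<in>PiE K X. \<Sum>s\<in>PiE J X. f (merge J K (s, t)) * h t)"
    by (subst sum.swap) (simp add: sum.cartesian_product)
  finally show ?thesis by (simp add: partial_trace_def sum_distrib_right)
qed

lemma prob_vec_partial_trace:
  assumes "J \<inter> K = {}" and "prob_vec (PiE (J \<union> K) X) f"
  shows "prob_vec (PiE K X) (partial_trace X J K f)"
  unfolding prob_vec_def
proof (intro conjI ballI)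
  fix t assume t: "t \<in> PiE K X"
  show "0 \<le> partial_trace X J K f t" unfolding partial_trace_def
  proof (rule sum_nonneg)
    fix s assume "s \<in> PiE J X"
    hence "merge J K (s, t) \<in> PiE (J \<union> K) X"
      using t assms(1) by (auto simp: merge_def PiE_iff extensional_def)
    thus "0 \<le> f (merge J K (s, t))" using assms(2) by (auto simp: prob_vec_def)
  qed
next
  show "(\<Sum>t\<in>PiE K X. partial_trace X J K f t) = 1"
    using sum_partial_trace[OF assms(1), of f "\<lambda>_. 1" X] assms(2) by (simp add: prob_vec_def)
qed

lemma partial_trace_last:
  assumes t: "t \<in> PiE {1} X"
  shows "partial_trace X {2} {1} f t = (\<Sum>b\<in>X 2. f (t(2 := b)))"
proof -
  have "(\<Sum>b\<in>X 2. f (t(2 := b))) = (\<Sum>s\<in>PiE {2} X. f (merge {2} {1} (s, t)))"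
    by (rule sum.reindex_bij_witness[where i = "\<lambda>s. s 2" and j = "\<lambda>b. \<lambda>i\<in>{2}. b"])
      (use t in \<open>auto simp: PiE_iff extensional_def merge_def restrict_def fun_eq_iff intro!: arg_cong[of _ _ f]\<close>)
  thus ?thesis by (simp add: partial_trace_def)
qed

text \<open>
  \<open>max s t = (s + t + \<bar>s - t\<bar>) / 2\<close>, summed over \<open>S\<close>.
\<close>

lemma sum_guess:
  assumes "(\<Sum>x\<in>S. t 0 x) = 1" and "(\<Sum>x\<in>S. t 1 x) = 1"
  shows "(\<Sum>x\<in>S. t (guess t x) x) = 1 + trace_dist S (t 0) (t 1)"
proof -
  have "(\<Sum>x\<in>S. t (guess t x) x) = (\<Sum>x\<in>S. 1/2 * t 0 x + 1/2 * t 1 x + 1/2 * \<bar>t 0 x - t 1 x\<bar>)"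
    by (intro sum.cong refl) (auto simp: guess_def abs_if field_simps)
  also have "\<dots> = 1/2 * (\<Sum>x\<in>S. t 0 x) + 1/2 * (\<Sum>x\<in>S. t 1 x) + trace_dist S (t 0) (t 1)"
    by (simp add: sum.distrib trace_dist_def flip: sum_distrib_left sum_divide_distrib)
  finally show ?thesis by (simp add: assms)
qed

text \<open>
  \<open>\<kappa>\<close> and \<open>\<zeta>\<close> are twice the probabilities that the bit is 0, respectively 1, and is guessed right.
\<close>

lemma kappa_eq: "finite S \<Longrightarrow> kappa S \<alpha> = (\<Sum>x\<in>S. if guess \<alpha> x = 0 then \<alpha> 0 x else 0)"
  unfolding kappa_def by (subst sum.inter_filter[symmetric]) (auto simp: guess_def intro!: sum.cong)

lemma zeta_eq: "finite S \<Longrightarrow> zeta S \<alpha> = (\<Sum>x\<in>S. if guess \<alpha> x = 1 then \<alpha> 1 x else 0)"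
  unfolding zeta_def by (subst sum.inter_filter[symmetric]) (auto simp: guess_def intro!: sum.cong)

section \<open>Bounds for any number of rounds\<close>

context coin_flipping
begin

abbreviation \<gamma> :: "bit \<Rightarrow> (nat \<Rightarrow> 'b) \<Rightarrow> real" where "\<gamma> a \<equiv> \<beta> (a + c)"

lemma \<gamma>: "prob_vec (tuples n B) (\<gamma> a)" using \<beta> by blast

text \<open>
  After the first message Bob may aim at any joint distribution \<open>w\<close> of all his replies, by the chain rule.
\<close>

lemma P_Bob_ge_first_message:
  assumes w: "\<And>u. u \<in> A 1 \<Longrightarrow> prob_vec (tuples n B) (w u)"
  shows "P_Bob n A B \<alpha> \<beta> c \<ge> 1/2 * (\<Sum>a\<in>{0,1}. fidelity (tuples n B)
      (\<lambda>y. \<Sum>x\<in>tuples n A. \<alpha> a x * w (x 1) y) (\<gamma> a))"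
proof -
  define q where "q i h k = conditional n B (w (h 1)) i k" for i :: nat and h :: "nat \<Rightarrow> 'a" and k
  have fB: "\<forall>i\<in>{1..n}. finite (B i)" using fin by blast
  have h1: "prob_vec (tuples n B) (w (h 1))" if "h \<in> tuples i A" "1 \<le> i" for h i
    using that by (intro w) (auto simp: PiE_iff)
  interpret controlled_replies n A B \<alpha> \<beta> c q
  proof
    show "0 \<le> q i h k" if "i \<in> {1..n}" "h \<in> tuples i A" "k \<in> tuples i B" for i h k
      unfolding q_def using that h1 by (intro conditional_nonneg) auto
    show "(\<Sum>b\<in>B i. q i h (k(i := b))) = 1" if "i \<in> {1..n}" "h \<in> tuples i A" "k \<in> tuples (i - 1) B" for i h k
      unfolding q_def using that h1[OF that(2)] by (intro sum_conditional[OF fB]) auto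
  qed
  have "(\<Prod>j\<in>{1..n}. q j (restrict x {1..j}) (restrict y {1..j})) = w (x 1) y"
    if "x \<in> tuples n A" "y \<in> tuples n B" for x y
  proof -
    have "(\<Prod>j\<in>{1..n}. q j (restrict x {1..j}) (restrict y {1..j}))
       = (\<Prod>j\<in>{1..n}. conditional n B (w (x 1)) j (restrict y {1..j}))"
      by (intro prod.cong refl) (auto simp: q_def)
    also have "\<dots> = w (x 1) y" by (rule prod_conditional[OF fB h1[OF that(1) n_pos] that(2)])
    finally show ?thesis .
  qed
  hence "fidelity (tuples n B) (\<lambda>y. \<Sum>x\<in>tuples n A. \<alpha> a x *
         (\<Prod>j\<in>{1..n}. q j (restrict x {1..j}) (restrict y {1..j}))) (\<gamma> a)
    = fidelity (tuples n B) (\<lambda>y. \<Sum>x\<in>tuples n A. \<alpha> a x * w (x 1) y) (\<gamma> a)" for a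
    by (intro fidelity_cong sum.cong refl) simp
  thus ?thesis using P_Bob_ge_controlled_replies by (simp only:)
qed

text \<open>
  If Bob's guess \<open>g x\<close> is right, his replies have the intended distribution \<open>r\<close>; the contribution of
  the wrong guesses is dropped.
\<close>

lemma fidelity_ge_weight:
  assumes "\<And>x y. x \<in> tuples n A \<Longrightarrow> y \<in> tuples n B \<Longrightarrow> 0 \<le> p x y"
    and "\<And>x y. x \<in> tuples n A \<Longrightarrow> y \<in> tuples n B \<Longrightarrow> g x = a \<Longrightarrow> p x y = r y"
  shows "(\<Sum>x\<in>tuples n A. if g x = a then \<alpha> a x else 0) * fidelity (tuples n B) r (\<gamma> a)
    \<le> fidelity (tuples n B) (\<lambda>y. \<Sum>x\<in>tuples n A. \<alpha> a x * p x y) (\<gamma> a)"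
proof -
  define t where "t = (\<Sum>x\<in>tuples n A. if g x = a then \<alpha> a x else 0)"
  have t: "0 \<le> t" unfolding t_def using weights_nonneg by (intro sum_nonneg) auto
  have e: "t * r y = (\<Sum>x\<in>tuples n A. if g x = a then \<alpha> a x * p x y else 0)" if "y \<in> tuples n B" for y
    unfolding t_def sum_distrib_right using assms(2) that by (intro sum.cong refl) auto
  have "t * fidelity (tuples n B) r (\<gamma> a) = fidelity (tuples n B) (\<lambda>y. t * r y) (\<gamma> a)"
    using t by (simp add: fidelity_scale)
  also have "\<dots> \<le> fidelity (tuples n B) (\<lambda>y. \<Sum>x\<in>tuples n A. \<alpha> a x * p x y) (\<gamma> a)"
  proof (rule fidelity_mono)
    fix y assume y: "y \<in> tuples n B"
    show "0 \<le> \<gamma> a y" using weights_nonneg y by blast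
    show "0 \<le> t * r y" unfolding e[OF y] using assms(1) y weights_nonneg by (intro sum_nonneg) auto
    show "t * r y \<le> (\<Sum>x\<in>tuples n A. \<alpha> a x * p x y)"
      unfolding e[OF y] using assms(1) y weights_nonneg by (intro sum_mono) auto
  qed
  finally show ?thesis unfolding t_def .
qed

text \<open>
  Bob ignores the messages.  His replies have the distribution whose square root is as close to
  \<open>\<surd>\<beta>\<^sub>0\<close> as to \<open>\<surd>\<beta>\<^sub>1\<close>, so he can still claim either bit.
\<close>

theorem P_Bob_ge_fidelity:
  "P_Bob n A B \<alpha> \<beta> c \<ge> 1/2 + 1/2 * sqrt (fidelity (tuples n B) (\<beta> 0) (\<beta> 1))"
proof -
  obtain z where z: "\<And>y. y \<in> tuples n B \<Longrightarrow> 0 \<le> z y" "(\<Sum>y\<in>tuples n B. (z y)\<^sup>2) = 1"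
    "(\<Sum>y\<in>tuples n B. vsqrt (\<beta> 0) y * z y)\<^sup>2 = 1/2 + 1/2 * sqrt (fidelity (tuples n B) (\<beta> 0) (\<beta> 1))"
    "(\<Sum>y\<in>tuples n B. vsqrt (\<beta> 1) y * z y)\<^sup>2 = 1/2 + 1/2 * sqrt (fidelity (tuples n B) (\<beta> 0) (\<beta> 1))"
    by (rule bisecting_vector[OF spec[OF \<beta>, of 0] spec[OF \<beta>, of 1]], rule that)
  have zb: "(\<Sum>y\<in>tuples n B. vsqrt (\<beta> b) y * z y)\<^sup>2 = 1/2 + 1/2 * sqrt (fidelity (tuples n B) (\<beta> 0) (\<beta> 1))" for b
    using z(3,4) by (cases b) auto
  have F: "fidelity (tuples n B) (\<lambda>y. \<Sum>x\<in>tuples n A. \<alpha> a x * (z y)\<^sup>2) (\<gamma> a)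
      = 1/2 + 1/2 * sqrt (fidelity (tuples n B) (\<beta> 0) (\<beta> 1))" for a
  proof -
    have "fidelity (tuples n B) (\<lambda>y. \<Sum>x\<in>tuples n A. \<alpha> a x * (z y)\<^sup>2) (\<gamma> a)
       = (\<Sum>y\<in>tuples n B. vsqrt (\<gamma> a) y * z y)\<^sup>2"
      using \<alpha> z(1) unfolding fidelity_def
      by (intro arg_cong[of _ _ "\<lambda>x. x\<^sup>2"] sum.cong refl)
        (simp add: prob_vec_def vsqrt_def mult.commute flip: sum_distrib_left sum_distrib_right)
    thus ?thesis unfolding zb .
  qed
  have "P_Bob n A B \<alpha> \<beta> c \<ge> 1/2 * (\<Sum>a\<in>{0,1}. fidelity (tuples n B)
      (\<lambda>y. \<Sum>x\<in>tuples n A. \<alpha> a x * (z y)\<^sup>2) (\<gamma> a))"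
    using z(2) by (intro P_Bob_ge_first_message[of "\<lambda>_ y. (z y)\<^sup>2"]) (simp add: prob_vec_def)
  thus ?thesis unfolding F by simp
qed

text \<open>
  Bob guesses \<open>a\<close> from the first message by maximum likelihood and behaves as if he had committed
  honestly to the bit that makes the outcome \<open>c\<close>.  The right guess passes with probability 1, and
  the sum over \<open>a\<close> of the probabilities of guessing right is 1 plus the trace distance.
\<close>

theorem P_Bob_ge_trace_dist:
  "P_Bob n A B \<alpha> \<beta> c \<ge> 1/2 + 1/2 * trace_dist (tuples 1 A)
        (partial_trace A {2..n} {1} (\<alpha> 0)) (partial_trace A {2..n} {1} (\<alpha> 1))"
proof -
  define \<tau> where "\<tau> a = partial_trace A {2..n} {1} (\<alpha> a)" for a
  define g where "g u = guess \<tau> (\<lambda>i\<in>{1}. u)" for u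
  have D: "{2..n} \<inter> {1} = {}" and U: "{1..n} = {2..n} \<union> {1}" using n_pos by auto
  have \<tau>: "prob_vec (PiE {1} A) (\<tau> a)" for a
    unfolding \<tau>_def using \<alpha> by (intro prob_vec_partial_trace[OF D]) (simp only: U)
  have res: "(\<lambda>i\<in>{1}. x 1) = restrict x {1}" for x :: "nat \<Rightarrow> 'a"
    by (auto simp: restrict_def fun_eq_iff)
  \<comment> \<open>The weight of the right guesses depends only on the marginal of \<open>\<alpha>\<^sub>a\<close> on \<open>A\<^sub>1\<close>.\<close>
  have W: "(\<Sum>x\<in>tuples n A. if g (x 1) = a then \<alpha> a x else 0) = (\<Sum>t\<in>PiE {1} A. if guess \<tau> t = a then \<tau> a t else 0)" for a
  proof -
    have "(\<Sum>x\<in>tuples n A. if g (x 1) = a then \<alpha> a x else 0)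
        = (\<Sum>x\<in>PiE ({2..n} \<union> {1}) A. \<alpha> a x * (if guess \<tau> (restrict x {1}) = a then 1 else 0))"
      unfolding U g_def res by (intro sum.cong refl) simp
    also have "\<dots> = (\<Sum>t\<in>PiE {1} A. \<tau> a t * (if guess \<tau> t = a then 1 else 0))"
      unfolding \<tau>_def[of a] by (rule sum_partial_trace[OF D])
    finally show ?thesis by (simp add: if_distrib[of "\<lambda>x. _ * x"] cong: if_cong)
  qed
  have "1 + trace_dist (PiE {1} A) (\<tau> 0) (\<tau> 1) = (\<Sum>t\<in>PiE {1} A. \<tau> (guess \<tau> t) t)"
    using \<tau> by (simp add: sum_guess prob_vec_def)
  also have "\<dots> = (\<Sum>t\<in>PiE {1} A. \<Sum>a\<in>{0,1}. if guess \<tau> t = a then \<tau> a t else 0)"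
    by (intro sum.cong refl) (simp add: guess_def)
  also have "\<dots> = (\<Sum>a\<in>{0,1}. \<Sum>x\<in>tuples n A. if g (x 1) = a then \<alpha> a x else 0)"
    unfolding W by (rule sum.swap)
  also have "\<dots> \<le> (\<Sum>a\<in>{0,1}. fidelity (tuples n B) (\<lambda>y. \<Sum>x\<in>tuples n A. \<alpha> a x * \<gamma> (g (x 1)) y) (\<gamma> a))"
  proof (intro sum_mono)
    fix a
    show "(\<Sum>x\<in>tuples n A. if g (x 1) = a then \<alpha> a x else 0)
        \<le> fidelity (tuples n B) (\<lambda>y. \<Sum>x\<in>tuples n A. \<alpha> a x * \<gamma> (g (x 1)) y) (\<gamma> a)"
      using fidelity_ge_weight[of "\<lambda>x. \<gamma> (g (x 1))" "\<lambda>x. g (x 1)" a "\<gamma> a"] fidelity_self[OF \<gamma>[of a]] weights_nonneg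
      by simp
  qed
  also have "\<dots> \<le> 2 * P_Bob n A B \<alpha> \<beta> c"
    using P_Bob_ge_first_message[of "\<lambda>u. \<gamma> (g u)"] \<gamma> by simp
  finally have "1 + trace_dist (PiE {1} A) (\<tau> 0) (\<tau> 1) \<le> 2 * P_Bob n A B \<alpha> \<beta> c" .
  thus ?thesis by (simp add: \<tau>_def)
qed

text \<open>
  Bob returns what he receives, so his replies have the distribution \<open>\<alpha>\<^sub>a\<close> if Alice chose \<open>a\<close>.
\<close>

theorem P_Bob_ge_identified:
  assumes \<sigma>: "\<forall>i\<in>{1..n}. bij_betw (\<sigma> i) (A i) (B i)"
  shows "P_Bob n A B \<alpha> \<beta> c \<ge> 1/2 * (\<Sum>a\<in>{0,1}. fidelity (tuples n A) (\<alpha> a)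
          (\<lambda>x. \<gamma> a (\<lambda>i\<in>{1..n}. \<sigma> i (x i))))"
proof -
  define q :: "nat \<Rightarrow> (nat \<Rightarrow> 'a) \<Rightarrow> (nat \<Rightarrow> 'b) \<Rightarrow> real" where
    "q i h k = (if k i = \<sigma> i (h i) then 1 else 0)" for i h k
  define \<tau> where "\<tau> x = (\<lambda>i\<in>{1..n}. \<sigma> i (x i))" for x
  interpret controlled_replies n A B \<alpha> \<beta> c q
  proof
    show "(\<Sum>b\<in>B i. q i h (k(i := b))) = 1" if "i \<in> {1..n}" "h \<in> tuples i A" "k \<in> tuples (i - 1) B" for i h k
    proof -
      have "h i \<in> A i" using that by (auto simp: PiE_iff)
      hence "\<sigma> i (h i) \<in> B i" by (rule bij_betw_apply[OF bspec[OF \<sigma> that(1)]])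
      thus ?thesis using fin that by (simp add: q_def)
    qed
  qed (simp add: q_def)
  have \<tau>: "bij_betw \<tau> (tuples n A) (tuples n B)"
  proof (rule bij_betw_byWitness[where f' = "\<lambda>y. \<lambda>i\<in>{1..n}. inv_into (A i) (\<sigma> i) (y i)"])
    have m: "\<sigma> i u \<in> B i" if "i \<in> {1..n}" "u \<in> A i" for i u
      using \<sigma> that by (auto intro: bij_betw_apply)
    have m': "inv_into (A i) (\<sigma> i) v \<in> A i" if "i \<in> {1..n}" "v \<in> B i" for i v
      using \<sigma> that by (metis bij_betw_def inv_into_into)
    show "\<tau> ` tuples n A \<subseteq> tuples n B" using m by (auto simp: \<tau>_def PiE_iff)
    show "(\<lambda>y. \<lambda>i\<in>{1..n}. inv_into (A i) (\<sigma> i) (y i)) ` tuples n B \<subseteq> tuples n A"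
      using m' by (auto simp: PiE_iff)
    have "inv_into (A i) (\<sigma> i) (\<sigma> i u) = u" if "i \<in> {1..n}" "u \<in> A i" for i u
      using \<sigma> that by (metis bij_betw_inv_into_left)
    thus "\<forall>x\<in>tuples n A. (\<lambda>i\<in>{1..n}. inv_into (A i) (\<sigma> i) (\<tau> x i)) = x"
      by (auto simp: \<tau>_def PiE_iff extensional_def restrict_def fun_eq_iff)
    have "\<sigma> i (inv_into (A i) (\<sigma> i) v) = v" if "i \<in> {1..n}" "v \<in> B i" for i v
      using \<sigma> that by (metis bij_betw_inv_into_right)
    thus "\<forall>y\<in>tuples n B. \<tau> (\<lambda>i\<in>{1..n}. inv_into (A i) (\<sigma> i) (y i)) = y"
      by (auto simp: \<tau>_def PiE_iff extensional_def restrict_def fun_eq_iff)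
  qed
  have prod: "(\<Prod>j\<in>{1..n}. q j (restrict x {1..j}) (restrict y {1..j})) = (if \<tau> x = y then 1 else 0)"
    if "x \<in> tuples n A" "y \<in> tuples n B" for x y
  proof (cases "\<tau> x = y")
    case True
    thus ?thesis by (auto simp: q_def \<tau>_def intro!: prod.neutral)
  next
    case False
    have "\<exists>j\<in>{1..n}. y j \<noteq> \<sigma> j (x j)"
    proof (rule ccontr)
      assume "\<not> ?thesis"
      hence "\<tau> x = y" using that(2) by (auto simp: \<tau>_def PiE_iff extensional_def restrict_def fun_eq_iff)
      thus False using False by simp
    qed
    hence "\<exists>j\<in>{1..n}. q j (restrict x {1..j}) (restrict y {1..j}) = 0" by (auto simp: q_def)
    thus ?thesis using False by (simp add: prod_zero)
  qed
  have "fidelity (tuples n B) (\<lambda>y. \<Sum>x\<in>tuples n A. \<alpha> a x *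
         (\<Prod>j\<in>{1..n}. q j (restrict x {1..j}) (restrict y {1..j}))) (\<gamma> a)
    = fidelity (tuples n A) (\<alpha> a) (\<lambda>x. \<gamma> a (\<tau> x))" for a
  proof -
    define r where "r y = (\<Sum>x\<in>tuples n A. \<alpha> a x *
         (\<Prod>j\<in>{1..n}. q j (restrict x {1..j}) (restrict y {1..j})))" for y
    have r: "r (\<tau> x') = \<alpha> a x'" if x': "x' \<in> tuples n A" for x'
    proof -
      have "r (\<tau> x') = (\<Sum>x\<in>tuples n A. if x = x' then \<alpha> a x' else 0)"
        unfolding r_def
      proof (intro sum.cong refl)
        fix x assume x: "x \<in> tuples n A"
        have "\<tau> x = \<tau> x' \<longleftrightarrow> x = x'" using \<tau> x x' by (metis bij_betw_inv_into_left)
        thus "\<alpha> a x * (\<Prod>j\<in>{1..n}. q j (restrict x {1..j}) (restrict (\<tau> x') {1..j})) = (if x = x' then \<alpha> a x' else 0)"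
          using prod[OF x bij_betwE[OF \<tau>, rule_format, OF x']] by simp
      qed
      thus ?thesis using x' finite_tuples by simp
    qed
    have "(\<Sum>y\<in>tuples n B. sqrt (r y) * sqrt (\<gamma> a y)) = (\<Sum>x\<in>tuples n A. sqrt (r (\<tau> x)) * sqrt (\<gamma> a (\<tau> x)))"
      by (rule sum.reindex_bij_betw[OF \<tau>, symmetric])
    thus ?thesis using r by (simp add: fidelity_def r_def)
  qed
  thus ?thesis using P_Bob_ge_controlled_replies by (simp only: \<tau>_def)
qed

end

section \<open>Four rounds\<close>

context coin_flipping
begin

lemma four_round_principal:
  assumes x: "x \<in> tuples n A"
  shows "\<exists>v. principal_eigenvector (tuples n B) (four_round_matrix \<alpha> \<gamma> x) (vsqrt v)"
    and "(\<Sum>a\<in>{0,1}. \<alpha> a x * (\<Sum>y\<in>tuples n B. vsqrt (\<gamma> a) y * z y)\<^sup>2)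
      \<le> lambda_max (tuples n B) (four_round_matrix \<alpha> \<gamma> x) * (\<Sum>y\<in>tuples n B. (z y)\<^sup>2)"
    and "principal_eigenvector (tuples n B) (four_round_matrix \<alpha> \<gamma> x) (vsqrt w) \<Longrightarrow>
      lambda_max (tuples n B) (four_round_matrix \<alpha> \<gamma> x) = (\<Sum>a\<in>{0,1}. \<alpha> a x * fidelity (tuples n B) w (\<gamma> a))"
proof -
  have u: "(\<Sum>y\<in>tuples n B. (vsqrt (\<gamma> a) y)\<^sup>2) = 1" for a
    using \<gamma> by (rule prob_vec_sq_vsqrt)
  have u0: "\<forall>y\<in>tuples n B. 0 \<le> vsqrt (\<gamma> a) y" for a
    using weights_nonneg(2) by (simp add: vsqrt_def)
  have M: "four_round_matrix \<alpha> \<gamma> x y y' = \<alpha> 0 x * outer (vsqrt (\<gamma> 0)) y y' + \<alpha> 1 x * outer (vsqrt (\<gamma> 1)) y y'" for y y'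
    by (simp add: four_round_matrix_def)
  note R = two_rank_one_principal[OF u u u0 u0 weights_nonneg(1)[OF x] weights_nonneg(1)[OF x] M]
  show "\<exists>v. principal_eigenvector (tuples n B) (four_round_matrix \<alpha> \<gamma> x) (vsqrt v)"
    by (rule R(1))
  show "(\<Sum>a\<in>{0,1}. \<alpha> a x * (\<Sum>y\<in>tuples n B. vsqrt (\<gamma> a) y * z y)\<^sup>2)
      \<le> lambda_max (tuples n B) (four_round_matrix \<alpha> \<gamma> x) * (\<Sum>y\<in>tuples n B. (z y)\<^sup>2)"
    using R(2)[of z] by simp
  show "lambda_max (tuples n B) (four_round_matrix \<alpha> \<gamma> x) = (\<Sum>a\<in>{0,1}. \<alpha> a x * fidelity (tuples n B) w (\<gamma> a))"
    if "principal_eigenvector (tuples n B) (four_round_matrix \<alpha> \<gamma> x) (vsqrt w)"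
    using R(3)[OF that] by (simp add: fidelity_def vsqrt_def mult.commute)
qed

theorem P_Bob_ge_four_round:
  assumes n1: "n = 1"
    and v: "\<And>x. x \<in> tuples n A \<Longrightarrow> principal_eigenvector (tuples n B) (four_round_matrix \<alpha> \<gamma> x) (vsqrt (v x))"
  shows "P_Bob n A B \<alpha> \<beta> c \<ge> 1/2 * (\<Sum>a\<in>{0,1}. fidelity (tuples n B)
      (\<lambda>y. \<Sum>x\<in>tuples n A. \<alpha> a x * v x y) (\<gamma> a))"
proof -
  \<comment> \<open>A message in \<open>tuples 1 A\<close> is determined by its only component.\<close>
  have e: "(\<lambda>i\<in>{1..n}. x 1) = x" if "x \<in> tuples n A" for x :: "nat \<Rightarrow> 'a"
    using that n1 by (auto simp: PiE_iff extensional_def restrict_def fun_eq_iff)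
  have "P_Bob n A B \<alpha> \<beta> c \<ge> 1/2 * (\<Sum>a\<in>{0,1}. fidelity (tuples n B)
      (\<lambda>y. \<Sum>x\<in>tuples n A. \<alpha> a x * v (\<lambda>i\<in>{1..n}. x 1) y) (\<gamma> a))"
  proof (rule P_Bob_ge_first_message)
    show "prob_vec (tuples n B) (v (\<lambda>i\<in>{1..n}. u))" if "u \<in> A 1" for u
    proof (rule prob_vec_principal_eigenvector[OF v])
      show "(\<lambda>i\<in>{1..n}. u) \<in> tuples n A" using that n1 by auto
    qed
  qed
  moreover have "fidelity (tuples n B) (\<lambda>y. \<Sum>x\<in>tuples n A. \<alpha> a x * v (\<lambda>i\<in>{1..n}. x 1) y) (\<gamma> a)
      = fidelity (tuples n B) (\<lambda>y. \<Sum>x\<in>tuples n A. \<alpha> a x * v x y) (\<gamma> a)" for a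
    by (intro fidelity_cong sum.cong refl) (simp only: e)
  ultimately show ?thesis by (simp only:)
qed

text \<open>
  Each eigenvalue is the Rayleigh quotient at its principal eigenvector, that is
  \<open>\<Sum>\<^sub>a \<alpha>\<^bsub>a,x\<^esub> F(v\<^sub>x, \<gamma>\<^sub>a)\<close>; concavity of the fidelity moves the sum over \<open>x\<close> inside.
\<close>

lemma four_round_fidelity_ge_lambda_max:
  assumes v: "\<And>x. x \<in> tuples n A \<Longrightarrow> principal_eigenvector (tuples n B) (four_round_matrix \<alpha> \<gamma> x) (vsqrt (v x))"
  shows "(\<Sum>x\<in>tuples n A. lambda_max (tuples n B) (four_round_matrix \<alpha> \<gamma> x))
    \<le> (\<Sum>a\<in>{0,1}. fidelity (tuples n B) (\<lambda>y. \<Sum>x\<in>tuples n A. \<alpha> a x * v x y) (\<gamma> a))"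
proof -
  have vn: "0 \<le> v x y" if "x \<in> tuples n A" "y \<in> tuples n B" for x y
    using prob_vec_principal_eigenvector[OF v[OF that(1)]] that(2) by (simp add: prob_vec_def)
  have "(\<Sum>x\<in>tuples n A. lambda_max (tuples n B) (four_round_matrix \<alpha> \<gamma> x))
      = (\<Sum>x\<in>tuples n A. \<Sum>a\<in>{0,1}. \<alpha> a x * fidelity (tuples n B) (v x) (\<gamma> a))"
    by (intro sum.cong refl four_round_principal(3) v)
  also have "\<dots> = (\<Sum>a\<in>{0,1}. \<Sum>x\<in>tuples n A. \<alpha> a x * fidelity (tuples n B) (v x) (\<gamma> a))"
    by (rule sum.swap)
  also have "\<dots> \<le> (\<Sum>a\<in>{0,1}. fidelity (tuples n B) (\<lambda>y. \<Sum>x\<in>tuples n A. \<alpha> a x * v x y) (\<gamma> a))"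
    by (intro sum_mono fidelity_concave weights_nonneg vn)
  finally show ?thesis .
qed

text \<open>
  The Rayleigh quotient at \<open>\<surd>\<gamma>\<^sub>a\<close>, for the larger of \<open>\<alpha>\<^bsub>0,x\<^esub>\<close> and \<open>\<alpha>\<^bsub>1,x\<^esub>\<close>.
\<close>

lemma four_round_lambda_max_ge_trace_dist:
  "1 + trace_dist (tuples n A) (\<alpha> 0) (\<alpha> 1)
    \<le> (\<Sum>x\<in>tuples n A. lambda_max (tuples n B) (four_round_matrix \<alpha> \<gamma> x))"
proof -
  have "1 + trace_dist (tuples n A) (\<alpha> 0) (\<alpha> 1) = (\<Sum>x\<in>tuples n A. \<alpha> (guess \<alpha> x) x)"
    using \<alpha> by (simp add: sum_guess prob_vec_def)
  also have "\<dots> \<le> (\<Sum>x\<in>tuples n A. lambda_max (tuples n B) (four_round_matrix \<alpha> \<gamma> x))"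
  proof (rule sum_mono)
    fix x assume x: "x \<in> tuples n A"
    define g where "g = guess \<alpha> x"
    have one: "(\<Sum>y\<in>tuples n B. (vsqrt (\<gamma> g) y)\<^sup>2) = 1" using \<gamma> by (rule prob_vec_sq_vsqrt)
    have "\<alpha> g x = \<alpha> g x * (\<Sum>y\<in>tuples n B. vsqrt (\<gamma> g) y * vsqrt (\<gamma> g) y)\<^sup>2"
      using one by (simp add: power2_eq_square)
    also have "\<dots> \<le> (\<Sum>a\<in>{0,1}. \<alpha> a x * (\<Sum>y\<in>tuples n B. vsqrt (\<gamma> a) y * vsqrt (\<gamma> g) y)\<^sup>2)"
      by (rule member_le_sum) (use weights_nonneg(1)[OF x] in \<open>auto simp: g_def guess_def\<close>)
    also have "\<dots> \<le> lambda_max (tuples n B) (four_round_matrix \<alpha> \<gamma> x)"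
      using four_round_principal(2)[OF x, of "vsqrt (\<gamma> g)"] one by simp
    finally show "\<alpha> (guess \<alpha> x) x \<le> lambda_max (tuples n B) (four_round_matrix \<alpha> \<gamma> x)" by (simp add: g_def)
  qed
  finally show ?thesis .
qed

text \<open>
  The Rayleigh quotient at the vector bisecting \<open>\<surd>\<gamma>\<^sub>0\<close> and \<open>\<surd>\<gamma>\<^sub>1\<close>, for every \<open>x\<close>.
\<close>

lemma four_round_lambda_max_ge_fidelity:
  "1 + sqrt (fidelity (tuples n B) (\<beta> 0) (\<beta> 1))
    \<le> (\<Sum>x\<in>tuples n A. lambda_max (tuples n B) (four_round_matrix \<alpha> \<gamma> x))"
proof -
  define f where "f = 1/2 + 1/2 * sqrt (fidelity (tuples n B) (\<beta> 0) (\<beta> 1))"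
  obtain z where z: "\<And>y. y \<in> tuples n B \<Longrightarrow> 0 \<le> z y" "(\<Sum>y\<in>tuples n B. (z y)\<^sup>2) = 1"
    "(\<Sum>y\<in>tuples n B. vsqrt (\<gamma> 0) y * z y)\<^sup>2 = f" "(\<Sum>y\<in>tuples n B. vsqrt (\<gamma> 1) y * z y)\<^sup>2 = f"
    by (rule bisecting_vector[OF \<gamma>[of 0] \<gamma>[of 1],
        unfolded fidelity_shift[of _ \<beta> c], folded f_def], rule that)
  have "1 + sqrt (fidelity (tuples n B) (\<beta> 0) (\<beta> 1)) = (\<Sum>x\<in>tuples n A. \<Sum>a\<in>{0,1}. \<alpha> a x * f)"
    using \<alpha> by (simp add: sum.distrib prob_vec_def f_def flip: sum_distrib_right)
  also have "\<dots> \<le> (\<Sum>x\<in>tuples n A. lambda_max (tuples n B) (four_round_matrix \<alpha> \<gamma> x))"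
  proof (rule sum_mono)
    fix x assume x: "x \<in> tuples n A"
    show "(\<Sum>a\<in>{0,1}. \<alpha> a x * f) \<le> lambda_max (tuples n B) (four_round_matrix \<alpha> \<gamma> x)"
      using four_round_principal(2)[OF x, of z] z(2-4) by simp
  qed
  finally show ?thesis .
qed

end

section \<open>Six rounds\<close>

locale six_round = coin_flipping n A B \<alpha> \<beta> c
  for n :: nat and A :: "nat \<Rightarrow> 'a set" and B :: "nat \<Rightarrow> 'b set"
    and \<alpha> :: "bit \<Rightarrow> (nat \<Rightarrow> 'a) \<Rightarrow> real" and \<beta> :: "bit \<Rightarrow> (nat \<Rightarrow> 'b) \<Rightarrow> real"
    and c :: bit +
  assumes n2: "n = 2"
begin

abbreviation \<mu> :: "bit \<Rightarrow> (nat \<Rightarrow> 'b) \<Rightarrow> real" where "\<mu> a \<equiv> partial_trace B {2} {1} (\<gamma> a)"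

lemma split_tuples: "tuples n X = PiE ({2} \<union> {1}) X" "tuples 1 X = PiE {1} X"
proof -
  have "{1..n} = {2} \<union> {1}" using n2 by auto
  thus "tuples n X = PiE ({2} \<union> {1}) X" by (simp only:)
qed simp

lemma finite_tuples1: "finite (tuples 1 B)"
  using fin n_pos by (intro finite_PiE) auto

lemma \<mu>: "prob_vec (tuples 1 B) (\<mu> a)"
  unfolding split_tuples(2) by (rule prob_vec_partial_trace) (use \<gamma> split_tuples(1)[of B] in auto)

lemma \<mu>_nonneg: "t \<in> tuples 1 B \<Longrightarrow> 0 \<le> \<mu> a t"
  using \<mu> by (simp add: prob_vec_def)

text \<open>
  In particular \<open>\<gamma>\<^sub>a\<close> vanishes wherever its marginal does, so the replies that \<open>six_round_p2\<close> prescribes there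
  do not contribute to the fidelity.
\<close>

lemma \<gamma>_le_\<mu>:
  assumes y: "y \<in> tuples n B"
  shows "\<gamma> a y \<le> \<mu> a (restrict y {1})"
proof -
  have r: "restrict y {1} \<in> PiE {1} B" using y n2 by (auto simp: PiE_iff)
  have "(restrict y {1})(2 := y 2) = y" 
    using y n2 by (auto simp: PiE_iff extensional_def restrict_def fun_eq_iff)
  hence "\<gamma> a y = \<gamma> a ((restrict y {1})(2 := y 2))" by simp
  also have "\<dots> \<le> (\<Sum>b\<in>B 2. \<gamma> a ((restrict y {1})(2 := b)))"
  proof (rule member_le_sum)
    show "0 \<le> \<gamma> a ((restrict y {1})(2 := b))" if "b \<in> B 2 - {y 2}" for b
      using r that n2 by (intro weights_nonneg) (auto simp: PiE_iff extensional_def)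
  qed (use y n2 fin in \<open>auto simp: PiE_iff\<close>)
  also have "\<dots> = \<mu> a (restrict y {1})" by (rule partial_trace_last[OF r, symmetric])
  finally show ?thesis .
qed

lemma six_round_principal:
  shows "\<exists>u. principal_eigenvector (tuples 1 B) (six_round_matrix (tuples n A) \<alpha> B \<gamma>) (vsqrt u)"
    and "kappa (tuples n A) \<alpha> * (\<Sum>y\<in>tuples 1 B. vsqrt (\<mu> 0) y * z y)\<^sup>2
      + zeta (tuples n A) \<alpha> * (\<Sum>y\<in>tuples 1 B. vsqrt (\<mu> 1) y * z y)\<^sup>2
      \<le> lambda_max (tuples 1 B) (six_round_matrix (tuples n A) \<alpha> B \<gamma>) * (\<Sum>y\<in>tuples 1 B. (z y)\<^sup>2)"
    and "principal_eigenvector (tuples 1 B) (six_round_matrix (tuples n A) \<alpha> B \<gamma>) (vsqrt w) \<Longrightarrow>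
      lambda_max (tuples 1 B) (six_round_matrix (tuples n A) \<alpha> B \<gamma>)
      = kappa (tuples n A) \<alpha> * fidelity (tuples 1 B) w (\<mu> 0) + zeta (tuples n A) \<alpha> * fidelity (tuples 1 B) w (\<mu> 1)"
proof -
  have u: "(\<Sum>y\<in>tuples 1 B. (vsqrt (\<mu> a) y)\<^sup>2) = 1" for a
    using \<mu> by (rule prob_vec_sq_vsqrt)
  have u0: "\<forall>y\<in>tuples 1 B. 0 \<le> vsqrt (\<mu> a) y" for a
    using \<mu>_nonneg by (simp add: vsqrt_def)
  have k: "0 \<le> kappa (tuples n A) \<alpha>" "0 \<le> zeta (tuples n A) \<alpha>"
    unfolding kappa_def zeta_def using weights_nonneg by (auto intro!: sum_nonneg)
  have M: "six_round_matrix (tuples n A) \<alpha> B \<gamma> y y' =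
    kappa (tuples n A) \<alpha> * outer (vsqrt (\<mu> 0)) y y' + zeta (tuples n A) \<alpha> * outer (vsqrt (\<mu> 1)) y y'" for y y'
    by (simp only: six_round_matrix_def)
  note R = two_rank_one_principal[OF u u u0 u0 k M]
  show "\<exists>u. principal_eigenvector (tuples 1 B) (six_round_matrix (tuples n A) \<alpha> B \<gamma>) (vsqrt u)"
    by (rule R(1))
  show "kappa (tuples n A) \<alpha> * (\<Sum>y\<in>tuples 1 B. vsqrt (\<mu> 0) y * z y)\<^sup>2
      + zeta (tuples n A) \<alpha> * (\<Sum>y\<in>tuples 1 B. vsqrt (\<mu> 1) y * z y)\<^sup>2
      \<le> lambda_max (tuples 1 B) (six_round_matrix (tuples n A) \<alpha> B \<gamma>) * (\<Sum>y\<in>tuples 1 B. (z y)\<^sup>2)"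
    by (rule R(2))
  show "lambda_max (tuples 1 B) (six_round_matrix (tuples n A) \<alpha> B \<gamma>)
      = kappa (tuples n A) \<alpha> * fidelity (tuples 1 B) w (\<mu> 0) + zeta (tuples n A) \<alpha> * fidelity (tuples 1 B) w (\<mu> 1)"
    if "principal_eigenvector (tuples 1 B) (six_round_matrix (tuples n A) \<alpha> B \<gamma>) (vsqrt w)"
    using R(3)[OF that] by (simp add: fidelity_def vsqrt_def mult.commute)
qed

text \<open>
  Bob draws \<open>y\<^sub>1\<close> from \<open>u\<close> without regard to \<open>x\<^sub>1\<close>.  Having seen all of \<open>x\<close>, he draws \<open>y\<^sub>2\<close> from the
  conditional distribution of \<open>\<gamma>\<^sub>a\<close> given \<open>y\<^sub>1\<close>, for the more likely \<open>a\<close>; below, \<open>r\<close> is this conditional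
  distribution.
\<close>

theorem P_Bob_ge_six_round:
  assumes u: "prob_vec (tuples 1 B) u"
  shows "P_Bob n A B \<alpha> \<beta> c \<ge> 1/2 * (\<Sum>a\<in>{0,1}. fidelity (tuples n B)
      (\<lambda>y. \<Sum>x\<in>tuples n A. \<alpha> a x * six_round_p2 \<alpha> B \<gamma> u x y) (\<gamma> a))"
proof -
  define r where "r h k = (let t = restrict k {1}; m = \<mu> (guess \<alpha> h) t in
    if m > 0 then \<gamma> (guess \<alpha> h) k / m else 1 / real (card (B 2)))" for h k
  define q where "q i h k = (if i = 1 then u k else r h k)" for i :: nat and h k
  have cases: "i = 1 \<or> i = 2" if "i \<in> {1..n}" for i using that n2 by auto
  have t1: "tuples (2 - 1) B = tuples 1 B" by simp
  interpret controlled_replies n A B \<alpha> \<beta> c q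
  proof
    fix i h k assume i: "i \<in> {1..n}" and h: "h \<in> tuples i A"
    show "0 \<le> q i h k" if k: "k \<in> tuples i B"
    proof (cases "i = 1")
      case True
      thus ?thesis using k u by (auto simp: q_def prob_vec_def)
    next
      case False
      hence "i = n" using cases[OF i] n2 by simp
      hence "0 \<le> \<gamma> (guess \<alpha> h) k" using weights_nonneg k by blast
      thus ?thesis using False by (simp add: q_def r_def Let_def)
    qed
    show "(\<Sum>b\<in>B i. q i h (k(i := b))) = 1" if k: "k \<in> tuples (i - 1) B"
      using cases[OF i]
    proof
      assume i1: "i = 1"
      have "(\<Sum>b\<in>B 1. u (k(1 := b))) = (\<Sum>t\<in>PiE {1} B. u t)"
        by (rule sum.reindex_bij_witness[where i = "\<lambda>t. t 1" and j = "\<lambda>b. k(1 := b)"])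
          (use k i1 in \<open>auto simp: PiE_iff extensional_def fun_eq_iff\<close>)
      also have "\<dots> = 1" using u by (simp add: prob_vec_def)
      finally show ?thesis using i1 by (simp add: q_def)
    next
      assume i2: "i = 2"
      have k1: "k \<in> PiE {1} B" using k i2 by simp
      have res: "restrict (k(2 := b)) {1} = k" for b
        using k1 by (auto simp: PiE_iff extensional_def restrict_def fun_eq_iff)
      define m where "m = \<mu> (guess \<alpha> h) k"
      have m: "m = (\<Sum>b\<in>B 2. \<gamma> (guess \<alpha> h) (k(2 := b)))"
        unfolding m_def by (rule partial_trace_last[OF k1])
      have m0: "0 \<le> m" unfolding m_def using k1 by (intro \<mu>_nonneg) simp
      have "tuples n B \<noteq> {}" using \<beta> by (auto simp: prob_vec_def)
      hence B2: "B 2 \<noteq> {}" "finite (B 2)"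
        using n2 fin tuples_nonempty_component[of n B 2] by auto
      have "(\<Sum>b\<in>B 2. q 2 h (k(2 := b))) = (\<Sum>b\<in>B 2. if m > 0 then \<gamma> (guess \<alpha> h) (k(2 := b)) / m else 1 / real (card (B 2)))"
        by (simp only: q_def r_def Let_def res m_def) simp
      also have "\<dots> = 1"
        using B2 m by (cases "m > 0") (simp_all flip: sum_divide_distrib)
      finally show ?thesis using i2 by simp
    qed
  qed
  have "(\<Prod>j\<in>{1..n}. q j (restrict x {1..j}) (restrict y {1..j})) = six_round_p2 \<alpha> B \<gamma> u x y"
    if "x \<in> tuples n A" "y \<in> tuples n B" for x y
  proof -
    have "{1..n} = {1, 2}" using n2 by auto
    moreover have "restrict x {1..2} = x" "restrict y {1..2} = y"
      using that n2 by (auto simp: PiE_iff extensional_restrict)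
    moreover have "restrict y {1..1} = restrict y {1}" by simp
    ultimately show ?thesis by (simp add: q_def r_def six_round_p2_def Let_def)
  qed
  hence "fidelity (tuples n B) (\<lambda>y. \<Sum>x\<in>tuples n A. \<alpha> a x *
         (\<Prod>j\<in>{1..n}. q j (restrict x {1..j}) (restrict y {1..j}))) (\<gamma> a)
    = fidelity (tuples n B) (\<lambda>y. \<Sum>x\<in>tuples n A. \<alpha> a x * six_round_p2 \<alpha> B \<gamma> u x y) (\<gamma> a)" for a
    by (intro fidelity_cong sum.cong refl) simp
  thus ?thesis using P_Bob_ge_controlled_replies by (simp only:)
qed

text \<open>
  Where the guess is \<open>a\<close>, Bob's replies have the distribution \<open>r a\<close>, which shares with \<open>\<gamma>\<^sub>a\<close> the conditional
  distribution of \<open>y\<^sub>2\<close> given \<open>y\<^sub>1\<close>.  The overlap of their square roots is therefore that of the marginals on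
  \<open>B\<^sub>1\<close>, and the weighted sum of the marginal fidelities is the Rayleigh quotient at the principal
  eigenvector.
\<close>

lemma six_round_fidelity_ge_lambda_max:
  assumes pu: "principal_eigenvector (tuples 1 B) (six_round_matrix (tuples n A) \<alpha> B \<gamma>) (vsqrt u)"
  shows "lambda_max (tuples 1 B) (six_round_matrix (tuples n A) \<alpha> B \<gamma>)
    \<le> (\<Sum>a\<in>{0,1}. fidelity (tuples n B)
      (\<lambda>y. \<Sum>x\<in>tuples n A. \<alpha> a x * six_round_p2 \<alpha> B \<gamma> u x y) (\<gamma> a))"
proof -
  have u: "0 \<le> u t" if "t \<in> tuples 1 B" for t using prob_vec_principal_eigenvector[OF pu] that by (simp add: prob_vec_def)
  have r1: "restrict y {1} \<in> tuples 1 B" if "y \<in> tuples n B" for y using that n2 by (auto simp: PiE_iff)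
  define r where "r a y = (if \<mu> a (restrict y {1}) > 0 then u (restrict y {1}) * (\<gamma> a y / \<mu> a (restrict y {1}))
     else u (restrict y {1}) * (1 / real (card (B 2))))" for a y
  have F: "fidelity (tuples n B) (r a) (\<gamma> a) = fidelity (tuples 1 B) u (\<mu> a)" for a
  proof -
    have "(\<Sum>y\<in>tuples n B. sqrt (r a y) * sqrt (\<gamma> a y))
        = (\<Sum>y\<in>PiE ({2} \<union> {1}) B. \<gamma> a y * (sqrt (u (restrict y {1})) / sqrt (\<mu> a (restrict y {1}))))"
      unfolding split_tuples(1)[symmetric]
    proof (intro sum.cong refl)
      fix y assume y: "y \<in> tuples n B"
      have g: "0 \<le> \<gamma> a y" using weights_nonneg y by blast
      show "sqrt (r a y) * sqrt (\<gamma> a y) = \<gamma> a y * (sqrt (u (restrict y {1})) / sqrt (\<mu> a (restrict y {1})))"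
      proof (cases "\<mu> a (restrict y {1}) > 0")
        case True
        have "sqrt (\<gamma> a y) * sqrt (\<gamma> a y) = \<gamma> a y" using g by simp
        thus ?thesis using True by (simp add: r_def real_sqrt_mult real_sqrt_divide mult_ac)
      next
        case False
        hence "\<gamma> a y = 0" using \<gamma>_le_\<mu>[OF y, of a] g by linarith
        thus ?thesis by simp
      qed
    qed
    also have "\<dots> = (\<Sum>t\<in>PiE {1} B. \<mu> a t * (sqrt (u t) / sqrt (\<mu> a t)))"
      by (rule sum_partial_trace) simp
    also have "\<dots> = (\<Sum>t\<in>tuples 1 B. sqrt (u t) * sqrt (\<mu> a t))"
    proof (rule sum.cong)
      fix t assume "t \<in> tuples 1 B"
      hence "\<mu> a t / sqrt (\<mu> a t) = sqrt (\<mu> a t)" using \<mu>_nonneg by (simp add: real_div_sqrt)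
      thus "\<mu> a t * (sqrt (u t) / sqrt (\<mu> a t)) = sqrt (u t) * sqrt (\<mu> a t)"
        by (metis mult.commute times_divide_eq_right)
    qed simp
    finally show ?thesis by (simp only: fidelity_def)
  qed
  have ge: "(\<Sum>x\<in>tuples n A. if guess \<alpha> x = a then \<alpha> a x else 0) * fidelity (tuples 1 B) u (\<mu> a)
    \<le> fidelity (tuples n B) (\<lambda>y. \<Sum>x\<in>tuples n A. \<alpha> a x * six_round_p2 \<alpha> B \<gamma> u x y) (\<gamma> a)" for a
    unfolding F[symmetric]
  proof (rule fidelity_ge_weight)
    show "0 \<le> six_round_p2 \<alpha> B \<gamma> u x y" if "x \<in> tuples n A" "y \<in> tuples n B" for x y
      using u[OF r1[OF that(2)]] weights_nonneg(2)[OF that(2)] by (simp add: six_round_p2_def Let_def)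
    show "six_round_p2 \<alpha> B \<gamma> u x y = r a y" if "x \<in> tuples n A" "y \<in> tuples n B" "guess \<alpha> x = a" for x y
      using that(3) by (simp add: six_round_p2_def Let_def r_def)
  qed
  show ?thesis
    unfolding six_round_principal(3)[OF pu] kappa_eq[OF finite_tuples(1)] zeta_eq[OF finite_tuples(1)]
    using ge[of 0] ge[of 1] by simp
qed

text \<open>
  The Rayleigh quotient at the vector bisecting the square roots of the two marginals; the weights \<open>\<kappa>\<close>
  and \<open>\<zeta>\<close> sum to 1 plus the trace distance.
\<close>

lemma six_round_lambda_max_ge_product:
  "1/2 * lambda_max (tuples 1 B) (six_round_matrix (tuples n A) \<alpha> B \<gamma>) \<ge>
    (1/2 + 1/2 * sqrt (fidelity (tuples 1 B)
       (partial_trace B {2} {1} (\<beta> 0)) (partial_trace B {2} {1} (\<beta> 1)))) *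
    (1/2 + 1/2 * trace_dist (tuples n A) (\<alpha> 0) (\<alpha> 1))"
proof -
  define f where "f = 1/2 + 1/2 * sqrt (fidelity (tuples 1 B) (partial_trace B {2} {1} (\<beta> 0)) (partial_trace B {2} {1} (\<beta> 1)))"
  obtain z where z: "\<And>y. y \<in> tuples 1 B \<Longrightarrow> 0 \<le> z y" "(\<Sum>y\<in>tuples 1 B. (z y)\<^sup>2) = 1"
    "(\<Sum>y\<in>tuples 1 B. vsqrt (\<mu> 0) y * z y)\<^sup>2 = f" "(\<Sum>y\<in>tuples 1 B. vsqrt (\<mu> 1) y * z y)\<^sup>2 = f"
    by (rule bisecting_vector[OF \<mu>[of 0] \<mu>[of 1],
        unfolded fidelity_shift[of _ "\<lambda>a. partial_trace B {2} {1} (\<beta> a)" c], folded f_def], rule that)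
  have "kappa (tuples n A) \<alpha> + zeta (tuples n A) \<alpha> = (\<Sum>x\<in>tuples n A. \<alpha> (guess \<alpha> x) x)"
    unfolding kappa_eq[OF finite_tuples(1)] zeta_eq[OF finite_tuples(1)] sum.distrib[symmetric]
    by (intro sum.cong refl) (simp add: guess_def)
  also have "\<dots> = 1 + trace_dist (tuples n A) (\<alpha> 0) (\<alpha> 1)"
    using \<alpha> by (simp add: sum_guess prob_vec_def)
  finally have k: "kappa (tuples n A) \<alpha> + zeta (tuples n A) \<alpha> = 1 + trace_dist (tuples n A) (\<alpha> 0) (\<alpha> 1)" .
  have "(kappa (tuples n A) \<alpha> + zeta (tuples n A) \<alpha>) * f \<le> lambda_max (tuples 1 B) (six_round_matrix (tuples n A) \<alpha> B \<gamma>)"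
    using six_round_principal(2)[of z] unfolding z(2-4) by (simp add: distrib_right)
  hence "(1 + trace_dist (tuples n A) (\<alpha> 0) (\<alpha> 1)) * f / 2
     \<le> 1/2 * lambda_max (tuples 1 B) (six_round_matrix (tuples n A) \<alpha> B \<gamma>)" unfolding k by simp
  moreover have e: "f * (1/2 + 1/2 * D) = (1 + D) * f / 2" for D :: real by (simp add: field_simps)
  ultimately show ?thesis unfolding f_def[symmetric] e by (simp only:)
qed

end

section \<open>All lower bounds\<close>

theorem theorem5p3:
  fixes n :: nat
    and A :: "nat \<Rightarrow> 'a set" and B :: "nat \<Rightarrow> 'b set"
    and \<alpha> :: "bit \<Rightarrow> (nat \<Rightarrow> 'a) \<Rightarrow> real" and \<beta> :: "bit \<Rightarrow> (nat \<Rightarrow> 'b) \<Rightarrow> real"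
    and c :: bit
  assumes "n \<ge> 1"
    and "\<forall>i\<in>{1..n}. finite (A i) \<and> finite (B i)"
    and "\<forall>a. prob_vec (tuples n A) (\<alpha> a)"
    and "\<forall>b. prob_vec (tuples n B) (\<beta> b)"
  shows
    "P_Bob n A B \<alpha> \<beta> c \<ge> 1/2 + 1/2 * sqrt (fidelity (tuples n B) (\<beta> 0) (\<beta> 1)) \<and>
     P_Bob n A B \<alpha> \<beta> c \<ge> 1/2 + 1/2 * trace_dist (tuples 1 A)
        (partial_trace A {2..n} {1} (\<alpha> 0)) (partial_trace A {2..n} {1} (\<alpha> 1)) \<and>
     (n = 1 \<longrightarrow>
      (\<forall>x\<in>tuples n A. \<exists>v. principal_eigenvector (tuples n B)
         (four_round_matrix \<alpha> (\<lambda>a. \<beta> (a + c)) x) (vsqrt v)) \<and>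
      (\<forall>v. (\<forall>x\<in>tuples n A. principal_eigenvector (tuples n B)
              (four_round_matrix \<alpha> (\<lambda>a. \<beta> (a + c)) x) (vsqrt (v x))) \<longrightarrow>
         P_Bob n A B \<alpha> \<beta> c \<ge>
           1/2 * (\<Sum>a\<in>{0,1}. fidelity (tuples n B)
             (\<lambda>y. \<Sum>x\<in>tuples n A. \<alpha> a x * v x y) (\<beta> (a + c))) \<and>
         1/2 * (\<Sum>a\<in>{0,1}. fidelity (tuples n B)
             (\<lambda>y. \<Sum>x\<in>tuples n A. \<alpha> a x * v x y) (\<beta> (a + c))) \<ge>
           1/2 * (\<Sum>x\<in>tuples n A. lambda_max (tuples n B)
             (four_round_matrix \<alpha> (\<lambda>a. \<beta> (a + c)) x))) \<and>
      1/2 * (\<Sum>x\<in>tuples n A. lambda_max (tuples n B)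
          (four_round_matrix \<alpha> (\<lambda>a. \<beta> (a + c)) x)) \<ge>
        max (1/2 + 1/2 * trace_dist (tuples n A) (\<alpha> 0) (\<alpha> 1))
            (1/2 + 1/2 * sqrt (fidelity (tuples n B) (\<beta> 0) (\<beta> 1)))) \<and>
     (n = 2 \<longrightarrow>
      (\<exists>u. principal_eigenvector (tuples 1 B)
         (six_round_matrix (tuples n A) \<alpha> B (\<lambda>a. \<beta> (a + c))) (vsqrt u)) \<and>
      (\<forall>u. principal_eigenvector (tuples 1 B)
              (six_round_matrix (tuples n A) \<alpha> B (\<lambda>a. \<beta> (a + c))) (vsqrt u) \<longrightarrow>
         P_Bob n A B \<alpha> \<beta> c \<ge>
           1/2 * (\<Sum>a\<in>{0,1}. fidelity (tuples n B)
             (\<lambda>y. \<Sum>x\<in>tuples n A. \<alpha> a x * six_round_p2 \<alpha> B (\<lambda>a. \<beta> (a + c)) u x y) (\<beta> (a + c))) \<and>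
         1/2 * (\<Sum>a\<in>{0,1}. fidelity (tuples n B)
             (\<lambda>y. \<Sum>x\<in>tuples n A. \<alpha> a x * six_round_p2 \<alpha> B (\<lambda>a. \<beta> (a + c)) u x y) (\<beta> (a + c))) \<ge>
           1/2 * lambda_max (tuples 1 B)
             (six_round_matrix (tuples n A) \<alpha> B (\<lambda>a. \<beta> (a + c)))) \<and>
      1/2 * lambda_max (tuples 1 B) (six_round_matrix (tuples n A) \<alpha> B (\<lambda>a. \<beta> (a + c))) \<ge>
        (1/2 + 1/2 * sqrt (fidelity (tuples 1 B)
           (partial_trace B {2} {1} (\<beta> 0)) (partial_trace B {2} {1} (\<beta> 1)))) *
        (1/2 + 1/2 * trace_dist (tuples n A) (\<alpha> 0) (\<alpha> 1))) \<and>
     (\<forall>\<sigma>. (\<forall>i\<in>{1..n}. bij_betw (\<sigma> i) (A i) (B i)) \<longrightarrow>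
      P_Bob n A B \<alpha> \<beta> c \<ge>
        1/2 * (\<Sum>a\<in>{0,1}. fidelity (tuples n A) (\<alpha> a)
          (\<lambda>x. \<beta> (a + c) (\<lambda>i\<in>{1..n}. \<sigma> i (x i)))))"
proof -
  interpret coin_flipping n A B \<alpha> \<beta> c using assms by unfold_locales
  show ?thesis
  proof (intro conjI impI allI ballI)
    assume n1: "n = 1"
    show "\<exists>v. principal_eigenvector (tuples n B) (four_round_matrix \<alpha> \<gamma> x) (vsqrt v)" if "x \<in> tuples n A" for x
      by (rule four_round_principal(1)[OF that])
    fix v assume v: "\<forall>x\<in>tuples n A. principal_eigenvector (tuples n B) (four_round_matrix \<alpha> \<gamma> x) (vsqrt (v x))"
    show "P_Bob n A B \<alpha> \<beta> c \<ge> 1/2 * (\<Sum>a\<in>{0,1}. fidelity (tuples n B)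
             (\<lambda>y. \<Sum>x\<in>tuples n A. \<alpha> a x * v x y) (\<gamma> a))"
      by (rule P_Bob_ge_four_round[OF n1 bspec[OF v]])
    show "1/2 * (\<Sum>a\<in>{0,1}. fidelity (tuples n B) (\<lambda>y. \<Sum>x\<in>tuples n A. \<alpha> a x * v x y) (\<gamma> a)) \<ge>
           1/2 * (\<Sum>x\<in>tuples n A. lambda_max (tuples n B) (four_round_matrix \<alpha> \<gamma> x))"
      by (rule mult_left_mono[OF four_round_fidelity_ge_lambda_max[OF bspec[OF v]]]) simp_all
  next
    show "1/2 * (\<Sum>x\<in>tuples n A. lambda_max (tuples n B) (four_round_matrix \<alpha> \<gamma> x)) \<ge>
        max (1/2 + 1/2 * trace_dist (tuples n A) (\<alpha> 0) (\<alpha> 1))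
            (1/2 + 1/2 * sqrt (fidelity (tuples n B) (\<beta> 0) (\<beta> 1)))"
      using four_round_lambda_max_ge_trace_dist four_round_lambda_max_ge_fidelity by (intro max.boundedI) linarith+
  next
    assume "n = 2"
    then interpret six_round n A B \<alpha> \<beta> c by unfold_locales
    show "\<exists>u. principal_eigenvector (tuples 1 B) (six_round_matrix (tuples n A) \<alpha> B \<gamma>) (vsqrt u)"
      by (rule six_round_principal(1))
    show "1/2 * lambda_max (tuples 1 B) (six_round_matrix (tuples n A) \<alpha> B \<gamma>) \<ge>
        (1/2 + 1/2 * sqrt (fidelity (tuples 1 B)
           (partial_trace B {2} {1} (\<beta> 0)) (partial_trace B {2} {1} (\<beta> 1)))) *
        (1/2 + 1/2 * trace_dist (tuples n A) (\<alpha> 0) (\<alpha> 1))"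
      by (rule six_round_lambda_max_ge_product)
    fix u assume u: "principal_eigenvector (tuples 1 B) (six_round_matrix (tuples n A) \<alpha> B \<gamma>) (vsqrt u)"
    show "P_Bob n A B \<alpha> \<beta> c \<ge> 1/2 * (\<Sum>a\<in>{0,1}. fidelity (tuples n B)
             (\<lambda>y. \<Sum>x\<in>tuples n A. \<alpha> a x * six_round_p2 \<alpha> B \<gamma> u x y) (\<gamma> a))"
      by (rule P_Bob_ge_six_round[OF prob_vec_principal_eigenvector[OF u]])
    show "1/2 * (\<Sum>a\<in>{0,1}. fidelity (tuples n B)
             (\<lambda>y. \<Sum>x\<in>tuples n A. \<alpha> a x * six_round_p2 \<alpha> B \<gamma> u x y) (\<gamma> a)) \<ge>
           1/2 * lambda_max (tuples 1 B) (six_round_matrix (tuples n A) \<alpha> B \<gamma>)"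
      by (rule mult_left_mono[OF six_round_fidelity_ge_lambda_max[OF u]]) simp
  next
    show "P_Bob n A B \<alpha> \<beta> c \<ge> 1/2 + 1/2 * sqrt (fidelity (tuples n B) (\<beta> 0) (\<beta> 1))"
      by (rule P_Bob_ge_fidelity)
    show "P_Bob n A B \<alpha> \<beta> c \<ge> 1/2 + 1/2 * trace_dist (tuples 1 A)
        (partial_trace A {2..n} {1} (\<alpha> 0)) (partial_trace A {2..n} {1} (\<alpha> 1))"
      by (rule P_Bob_ge_trace_dist)
    show "P_Bob n A B \<alpha> \<beta> c \<ge> 1/2 * (\<Sum>a\<in>{0,1}. fidelity (tuples n A) (\<alpha> a)
          (\<lambda>x. \<gamma> a (\<lambda>i\<in>{1..n}. \<sigma> i (x i))))"
      if "\<forall>i\<in>{1..n}. bij_betw (\<sigma> i) (A i) (B i)" for \<sigma>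
      by (rule P_Bob_ge_identified[OF that])
  qed
qed

end
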